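(* The functional $J_{\sigma,\delta,\varepsilon}$ has a minimizer in $W^{1,p}(\mathbb{R}^n)$. Moreover, if $u_{\sigma,\delta,\varepsilon}$ is such a minimizer, then $$0\le u_{\sigma,\delta,\varepsilon}\le\|\varphi\|_\infty.$$
   Context: $\Omega\subset\mathbb{R}^n$ is a smooth bounded domain, $\Omega^c$ its complement, $\varphi:\mathbb{R}^n\to\mathbb{R}$ is a smooth non-negative function compactly supported in $\Omega$, $\gamma>0$ and $1<p<\infty$. For $\sigma,\delta,\varepsilon>0$ and $v\in W^{1,p}(\mathbb{R}^n)$, $$J_{\sigma,\delta,\varepsilon}(v)=\int_{\mathbb{R}^n}\Big(\frac1p|\nabla v|^p+g_\sigma(v-\varphi)\Big)dx+f_\varepsilon\Big(\int_{\Omega^c}h_\delta(v)\,dx\Big),$$ where: $g_\sigma:\mathbb{R}\to\mathbb{R}$ is a non-negative, decreasing (non-increasing), convex function with $g_\sigma(t)=-\frac1\sigma(t+\frac\sigma2)$ for $t<-\sigma$, $g_\sigma(t)=0$ for $t\ge0$, and smooth interpolation for $-\sigma\le t<0$; $h_\delta:\mathbb{R}\to\mathbb{R}$ is the piecewise linear function equal to $0$ on $(-\infty,0]$, equal to $1$ on $[\delta,\infty)$ and linear on $[0,\delta]$; $f_\varepsilon(t)=\frac1\varepsilon(t-\gamma)$ for $t\ge\gamma$ and $f_\varepsilon(t)=\varepsilon(t-\gamma)$ for $t\le\gamma$. *)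

theory Defs
  imports "HOL-Analysis.Analysis"
begin

section \<open>Smooth functions and smooth bounded domains\<close>

fun C_k :: "nat \<Rightarrow> ('a::real_normed_vector \<Rightarrow> 'b::real_normed_vector) \<Rightarrow> bool" where
  "C_k 0 f \<longleftrightarrow> continuous_on UNIV f"
| "C_k (Suc k) f \<longleftrightarrow>
     (\<forall>x. f differentiable (at x)) \<and> (\<forall>v. C_k k (\<lambda>x. frechet_derivative f (at x) v))"

definition smooth :: "('a::real_normed_vector \<Rightarrow> 'b::real_normed_vector) \<Rightarrow> bool" where
  "smooth f \<longleftrightarrow> (\<forall>k. C_k k f)"

definition supp :: "('a::topological_space \<Rightarrow> real) \<Rightarrow> 'a set" where
  "supp f = closure {x. f x \<noteq> 0}"

text \<open>The set lies locally on one side of the graph of a smooth function. The unit vector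
  \<open>e\<close> is the vertical direction after relabelling the coordinates; the invariance of
  \<open>\<beta>\<close> along \<open>e\<close> says that \<open>\<beta>\<close> is a function of the remaining n - 1 coordinates only.\<close>

definition smooth_boundary :: "(real ^ 'n) set \<Rightarrow> bool" where
  "smooth_boundary \<Omega> \<longleftrightarrow>
     (\<forall>x0 \<in> frontier \<Omega>. \<exists>e r. \<exists>\<beta> :: real ^ 'n \<Rightarrow> real.
        norm e = 1 \<and> r > 0 \<and> smooth \<beta> \<and> (\<forall>x t. \<beta> (x + t *\<^sub>R e) = \<beta> x) \<and>
        \<Omega> \<inter> ball x0 r = {x \<in> ball x0 r. x \<bullet> e > \<beta> x})"

definition smooth_bounded_domain :: "(real ^ 'n) set \<Rightarrow> bool" where
  "smooth_bounded_domain \<Omega> \<longleftrightarrow>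
     open \<Omega> \<and> connected \<Omega> \<and> \<Omega> \<noteq> {} \<and> bounded \<Omega> \<and> smooth_boundary \<Omega>"


section \<open>The Sobolev space\<close>

definition in_Lp :: "real \<Rightarrow> ('a::euclidean_space \<Rightarrow> 'b::real_normed_vector) \<Rightarrow> bool" where
  "in_Lp p f \<longleftrightarrow>
     f \<in> borel_measurable lebesgue \<and> integrable lebesgue (\<lambda>x. norm (f x) powr p)"

definition locally_integrable :: "('a::euclidean_space \<Rightarrow> 'b::euclidean_space) \<Rightarrow> bool" where
  "locally_integrable f \<longleftrightarrow> (\<forall>K. compact K \<longrightarrow> f absolutely_integrable_on K)"

definition has_weak_gradient :: "(real ^ 'n \<Rightarrow> real) \<Rightarrow> (real ^ 'n \<Rightarrow> real ^ 'n) \<Rightarrow> bool" where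
  "has_weak_gradient v G \<longleftrightarrow>
     locally_integrable v \<and> locally_integrable G \<and>
     (\<forall>\<psi> :: real ^ 'n \<Rightarrow> real. smooth \<psi> \<and> compact (supp \<psi>) \<longrightarrow>
        (\<forall>i. (LINT x|lebesgue. v x * frechet_derivative \<psi> (at x) (axis i 1)) =
             - (LINT x|lebesgue. G x $ i * \<psi> x)))"

text \<open>Elements are functions, not classes modulo equality almost everywhere.\<close>

definition W1p :: "real \<Rightarrow> (real ^ 'n \<Rightarrow> real) set" where
  "W1p p = {v. in_Lp p v \<and> (\<exists>G. has_weak_gradient v G \<and> in_Lp p G)}"

text \<open>Weak gradients are unique up to null sets, so the choice does not affect integrals.\<close>

definition weak_grad :: "(real ^ 'n \<Rightarrow> real) \<Rightarrow> real ^ 'n \<Rightarrow> real ^ 'n" where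
  "weak_grad v = (SOME G. has_weak_gradient v G)"


section \<open>The functional\<close>

text \<open>The conditions fix \<open>g\<close> outside \<open>[-\<sigma>, 0)\<close> only; on that interval it is any
  interpolation for which \<open>g\<close> is smooth on the whole line.\<close>

definition is_g :: "real \<Rightarrow> (real \<Rightarrow> real) \<Rightarrow> bool" where
  "is_g \<sigma> g \<longleftrightarrow>
     (\<forall>t. g t \<ge> 0) \<and> antimono g \<and> convex_on UNIV g \<and> smooth g \<and>
     (\<forall>t. t < - \<sigma> \<longrightarrow> g t = - (1 / \<sigma>) * (t + \<sigma> / 2)) \<and>
     (\<forall>t. t \<ge> 0 \<longrightarrow> g t = 0)"

definition h_delta :: "real \<Rightarrow> real \<Rightarrow> real" where
  "h_delta \<delta> t = (if t \<le> 0 then 0 else if t \<ge> \<delta> then 1 else t / \<delta>)"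

text \<open>For v in \<open>W\<^sup>1\<^sup>,\<^sup>p\<close> with p > 1 the integrals of \<open>h_delta \<delta> (v x)\<close> and
  of \<open>g (v x - \<phi> x)\<close> may be infinite, since v need not be integrable. The function below is
  therefore extended by its limit \<open>\<infinity>\<close> at \<open>\<infinity>\<close>, and the functional takes values in
  \<open>(-\<infinity>, \<infinity>]\<close>.\<close>

definition f_eps :: "real \<Rightarrow> real \<Rightarrow> ereal \<Rightarrow> ereal" where
  "f_eps \<gamma> \<epsilon> t =
     (if t \<ge> ereal \<gamma> then ereal (1 / \<epsilon>) * (t - ereal \<gamma>) else ereal \<epsilon> * (t - ereal \<gamma>))"

lemma f_eps_ereal:
  "f_eps \<gamma> \<epsilon> (ereal t) = ereal (if t \<ge> \<gamma> then 1 / \<epsilon> * (t - \<gamma>) else \<epsilon> * (t - \<gamma>))"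
  by (simp add: f_eps_def)

lemma f_eps_PInfty: "\<epsilon> > 0 \<Longrightarrow> f_eps \<gamma> \<epsilon> \<infinity> = \<infinity>"
  by (simp add: f_eps_def)

definition J_fun ::
  "real \<Rightarrow> (real ^ 'n) set \<Rightarrow> (real ^ 'n \<Rightarrow> real) \<Rightarrow> real \<Rightarrow> (real \<Rightarrow> real) \<Rightarrow> real \<Rightarrow> real \<Rightarrow>
   (real ^ 'n \<Rightarrow> real) \<Rightarrow> ereal" where
  "J_fun p \<Omega> \<phi> \<gamma> g \<delta> \<epsilon> v =
     enn2ereal (\<integral>\<^sup>+ x. ennreal (1 / p * norm (weak_grad v x) powr p + g (v x - \<phi> x)) \<partial>lebesgue)
     + f_eps \<gamma> \<epsilon> (enn2ereal (\<integral>\<^sup>+ x \<in> - \<Omega>. ennreal (h_delta \<delta> (v x)) \<partial>lebesgue))"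

end

theory Submission
  imports Defs "HOL-Complex_Analysis.Great_Picard"
begin

text \<open>Existence is proved by the direct method, and both claims rest on truncation. Replacing \<open>v\<close> by
  \<open>min (max v 0) M\<close>, where \<open>M\<close> is the maximum of the obstacle, keeps the gradient on the set
  \<open>0 < v < M\<close> and deletes it elsewhere, and it increases neither the penalty \<open>g\<close> nor the volume term.
  Hence a minimizing sequence may be assumed to take values in \<open>[0, M]\<close>. For such functions the volume
  term controls the \<open>L\<^sup>p\<close> norm outside the bounded set \<open>\<Omega>\<close>, so the functional is coercive. The
  same comparison, applied to a minimizer, shows that its gradient vanishes where it is negative or
  exceeds \<open>M\<close>; the two excess parts are then constant and in \<open>L\<^sup>p\<close>, hence zero.

  The volume term is not convex, so passing to the limit in it requires almost everywhere convergence
  of the minimizing sequence, and not just weak convergence. This is the lemma \<open>Rellich\<close>. Penalty and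
  volume are then handled by Fatou. The Dirichlet term is handled by \<open>wgrad_lower_semicontinuous\<close>,
  which replaces weak compactness of \<open>L\<^sup>p\<close> by an argument with midpoints: nearly optimal convex
  combinations of tails of the sequence have gradients that form a Cauchy sequence in \<open>L\<^sup>p\<close>, by uniform
  convexity of the \<open>p\<close>-th power of the norm.

  Translation estimates and the chain rule follow from \<open>wgrad_increment\<close>: for each \<open>h\<close>,
  the increment \<open>v (x + h) - v x\<close> is, for almost every \<open>x\<close>, the integral of the directional derivative
  along the segment. It gives the translation estimate behind \<open>Rellich\<close>, it shows that functions with
  vanishing gradient are invariant under translations, and together with continuity of translations in
  \<open>L\<^sup>1\<close> it makes difference quotients converge in the mean on balls. The chain rule, and from it the gradient of
  a truncation, follow by computing difference quotients, without mollification.\<close>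

section \<open>Smooth functions and bumps\<close>

text \<open>The recursive clause in usable form: any family of derivatives may serve, since Frechet
  derivatives are unique.\<close>

lemma C_k_SucI:
  assumes "\<And>x. (f has_derivative f' x) (at x)" and "\<And>v. C_k k (\<lambda>x. f' x v)"
  shows "C_k (Suc k) f"
proof -
  have "frechet_derivative f (at x) = f' x" for x
    using frechet_derivative_at[OF assms(1)[of x]] by simp
  then show ?thesis
    using assms by (auto simp: differentiable_def)
qed

lemma C_k_SucD: "C_k (Suc k) f \<Longrightarrow> C_k k f"
proof (induction k arbitrary: f)
  case 0
  then show ?case
    by (auto intro!: continuous_at_imp_continuous_on differentiable_imp_continuous_within)
next
  case (Suc k)
  then show ?case by simp
qed

lemma C_k_const: "C_k k (\<lambda>x. c)"
proof (induction k arbitrary: c)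
  case (Suc k)
  then show ?case
    by (intro C_k_SucI[where f' = "\<lambda>x v. 0"]) auto
qed simp

lemma C_k_add: "C_k k f \<Longrightarrow> C_k k g \<Longrightarrow> C_k k (\<lambda>x. f x + g x)"
proof (induction k arbitrary: f g)
  case 0
  then show ?case by (auto intro: continuous_intros)
next
  case (Suc k)
  show ?case
  proof (rule C_k_SucI[where f' = "\<lambda>x v. frechet_derivative f (at x) v + frechet_derivative g (at x) v"])
    show "((\<lambda>x. f x + g x) has_derivative
        (\<lambda>v. frechet_derivative f (at x) v + frechet_derivative g (at x) v)) (at x)" for x
      using Suc.prems by (intro has_derivative_add) (auto simp: frechet_derivative_works[symmetric])
  qed (use Suc in auto)
qed

lemma C_k_mult:
  fixes f g :: "'a::real_normed_vector \<Rightarrow> real"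
  shows "C_k k f \<Longrightarrow> C_k k g \<Longrightarrow> C_k k (\<lambda>x. f x * g x)"
proof (induction k arbitrary: f g)
  case 0
  then show ?case by (auto intro: continuous_intros)
next
  case (Suc k)
  show ?case
  proof (rule C_k_SucI[where
        f' = "\<lambda>x v. f x * frechet_derivative g (at x) v + frechet_derivative f (at x) v * g x"])
    show "((\<lambda>x. f x * g x) has_derivative
        (\<lambda>v. f x * frechet_derivative g (at x) v + frechet_derivative f (at x) v * g x)) (at x)" for x
      using Suc.prems by (intro has_derivative_mult) (auto simp: frechet_derivative_works[symmetric])
    show "C_k k (\<lambda>x. f x * frechet_derivative g (at x) v + frechet_derivative f (at x) v * g x)" for v
      using Suc.prems C_k_SucD[OF Suc.prems(1)] C_k_SucD[OF Suc.prems(2)]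
      by (intro C_k_add Suc.IH) auto
  qed
qed

lemma C_k_prod:
  fixes f :: "'i \<Rightarrow> 'a::real_normed_vector \<Rightarrow> real"
  assumes "\<And>i. i \<in> I \<Longrightarrow> C_k k (f i)"
  shows "C_k k (\<lambda>x. \<Prod>i\<in>I. f i x)"
  using assms by (induction I rule: infinite_finite_induct) (auto intro: C_k_mult C_k_const)

lemma smooth_translate:
  assumes "smooth \<psi>"
  shows "smooth (\<lambda>x. \<psi> (x - h))"
    and "frechet_derivative (\<lambda>x. \<psi> (x - h)) (at x) = frechet_derivative \<psi> (at (x - h))"
proof -
  have der: "((\<lambda>x. f (x - h)) has_derivative frechet_derivative f (at (x - h))) (at x)"
    if "\<forall>x. f differentiable (at x)" for f :: "'a \<Rightarrow> 'b" and x
  proof -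
    have "(f has_derivative frechet_derivative f (at (x - h))) (at ((\<lambda>x. x - h) x))"
      using that frechet_derivative_works by blast
    moreover have "((\<lambda>x. x - h) has_derivative (\<lambda>x. x)) (at x)"
      by (auto intro!: derivative_eq_intros)
    ultimately show ?thesis
      using diff_chain_at[of "\<lambda>x. x - h" "\<lambda>x. x" x f] by (simp add: o_def)
  qed
  have "C_k k f \<Longrightarrow> C_k k (\<lambda>x. f (x - h))" for k and f :: "'a \<Rightarrow> 'b"
  proof (induction k arbitrary: f)
    case 0
    then have "continuous_on UNIV f" by simp
    then show ?case
      by (auto intro!: continuous_on_compose2[of UNIV f] continuous_intros)
  next
    case (Suc k)
    then show ?case
      by (intro C_k_SucI[OF der]) auto
  qed
  with assms show "smooth (\<lambda>x. \<psi> (x - h))" by (auto simp: smooth_def)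
  have "C_k (Suc 0) \<psi>" using assms unfolding smooth_def by blast
  then show "frechet_derivative (\<lambda>x. \<psi> (x - h)) (at x) = frechet_derivative \<psi> (at (x - h))"
    using frechet_derivative_at[OF der] by auto
qed

text \<open>Gluing a function to zero at the origin is differentiable there as soon as the function
  is bounded by a parabola; this serves both for the bump functions and for the smoothed positive
  part.\<close>

lemma DERIV_zero_if_quadratic_bound:
  fixes f :: "real \<Rightarrow> real"
  assumes "\<And>t. \<bar>f t\<bar> \<le> K * t\<^sup>2"
  shows "(f has_real_derivative 0) (at 0)"
proof -
  have "f 0 = 0" using assms[of 0] by simp
  have "(\<lambda>h. (f (0 + h) - f 0) / h) \<midarrow>0\<rightarrow> 0"
  proof (rule Lim_null_comparison)
    show "\<forall>\<^sub>F h in at 0. norm ((f (0 + h) - f 0) / h) \<le> K * \<bar>h\<bar>"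
      unfolding eventually_at_filter
    proof (intro always_eventually allI impI)
      fix h :: real assume "h \<noteq> 0"
      have "\<bar>f h\<bar> \<le> K * \<bar>h\<bar> * \<bar>h\<bar>"
        using assms[of h] by (simp add: power2_eq_square abs_mult[symmetric])
      with \<open>h \<noteq> 0\<close> \<open>f 0 = 0\<close> show "norm ((f (0 + h) - f 0) / h) \<le> K * \<bar>h\<bar>"
        by (simp add: divide_le_eq)
    qed
    show "(\<lambda>h. K * \<bar>h\<bar>) \<midarrow>0\<rightarrow> (0::real)"
      by (auto intro!: tendsto_eq_intros)
  qed
  then show ?thesis by (simp add: DERIV_def)
qed

text \<open>For \<open>m = 0\<close> this is the standard function that is flat at the origin. The
  derivative of each member of the family is a combination of two other members, so smoothness of
  all of them follows by one induction on the order of differentiation.\<close>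

definition flat :: "nat \<Rightarrow> real \<Rightarrow> real" where
  "flat m t = (if t \<le> 0 then 0 else inverse t ^ m * exp (- inverse t))"

lemma power_over_fact_le_exp:
  assumes "0 \<le> (y::real)"
  shows "y ^ n / fact n \<le> exp y"
proof -
  have "(\<Sum>k\<in>{n}. y ^ k /\<^sub>R fact k) \<le> (\<Sum>k. y ^ k /\<^sub>R fact k)"
    using assms by (intro sum_le_suminf summable_exp_generic) auto
  then show ?thesis
    by (simp add: exp_def divide_inverse mult.commute)
qed

text \<open>The exponential series dominates each of its terms, so the exponential decay beats the
  pole of order \<open>m\<close> with two powers of \<open>t\<close> to spare.\<close>

lemma flat_bound: "\<bar>flat m t\<bar> \<le> fact (m + 2) * t\<^sup>2"
proof (cases "t \<le> 0")
  case False
  define y where "y = inverse t"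
  have y: "y > 0" and t: "t = inverse y" using False by (auto simp: y_def)
  have "y ^ (m + 2) / fact (m + 2) \<le> exp y"
    using power_over_fact_le_exp[of y "m + 2"] y by simp
  then have "y ^ (m + 2) / exp y \<le> fact (m + 2)"
    by (simp only: pos_divide_le_eq fact_gt_zero exp_gt_zero mult.commute)
  then have "y ^ (m + 2) * exp (- y) \<le> fact (m + 2)"
    by (simp only: exp_minus divide_inverse)
  then have "y ^ m * exp (- y) \<le> fact (m + 2) * (inverse y)\<^sup>2"
    using y by (simp add: field_simps power_add power2_eq_square)
  then show ?thesis
    using False y by (simp add: flat_def y_def[symmetric] t)
qed (simp add: flat_def)

lemma flat_deriv:
  "(flat m has_real_derivative (flat (m + 2) t - real m * flat (m + 1) t)) (at t)"
proof (cases t "0::real" rule: linorder_cases)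
  case less
  have "((\<lambda>t. 0) has_real_derivative 0) (at t)" by simp
  then have "(flat m has_real_derivative 0) (at t)"
    by (rule DERIV_cong_ev[THEN iffD1, rotated -1])
       (use less eventually_nhds_in_open[of "{..<0}" t] in
         \<open>auto simp: flat_def elim!: eventually_mono\<close>)
  then show ?thesis using less by (simp add: flat_def)
next
  case equal
  have "(flat m has_real_derivative 0) (at 0)"
    by (rule DERIV_zero_if_quadratic_bound[OF flat_bound])
  then show ?thesis using equal by (simp add: flat_def)
next
  case greater
  have "((\<lambda>t. inverse t ^ m * exp (- inverse t)) has_real_derivative
      (inverse t ^ (m + 2) * exp (- inverse t) - real m * (inverse t ^ (m + 1) * exp (- inverse t)))) (at t)"
    using greater
    by (auto intro!: derivative_eq_intros simp: field_simps power2_eq_square)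
       (cases m, auto simp: field_simps)
  then have "(flat m has_real_derivative
      (inverse t ^ (m + 2) * exp (- inverse t) - real m * (inverse t ^ (m + 1) * exp (- inverse t)))) (at t)"
    by (rule DERIV_cong_ev[THEN iffD1, rotated -1])
       (use greater eventually_nhds_in_open[of "{0<..}" t] in
         \<open>auto simp: flat_def elim!: eventually_mono\<close>)
  then show ?thesis using greater by (simp add: flat_def)
qed

lemma C_k_flat_inner:
  fixes a :: "'a::real_inner"
  shows "C_k k (\<lambda>x. flat m (x \<bullet> a + c))"
proof (induction k arbitrary: m)
  case 0
  have "continuous_on UNIV (flat m)"
    using flat_deriv by (intro continuous_at_imp_continuous_on ballI) (rule DERIV_isCont)
  then show ?case
    by (auto intro!: continuous_on_compose2[of UNIV "flat m"] continuous_intros)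
next
  case (Suc k)
  show ?case
  proof (rule C_k_SucI)
    fix x :: 'a
    have "((\<lambda>x. x \<bullet> a + c) has_derivative (\<lambda>v. v \<bullet> a)) (at x)"
      by (auto intro!: derivative_eq_intros)
    from has_derivative_compose[OF this flat_deriv[of m "x \<bullet> a + c", unfolded has_field_derivative_def]]
    show "((\<lambda>x. flat m (x \<bullet> a + c)) has_derivative
        (\<lambda>v. (flat (m + 2) (x \<bullet> a + c) + (- real m) * flat (m + 1) (x \<bullet> a + c)) * (v \<bullet> a))) (at x)"
      by simp
  next
    show "C_k k (\<lambda>x. (flat (m + 2) (x \<bullet> a + c) + (- real m) * flat (m + 1) (x \<bullet> a + c)) * (v \<bullet> a))" for v
      by (intro C_k_mult C_k_add C_k_const Suc.IH)
  qed
qed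

definition test_fun :: "('a::euclidean_space \<Rightarrow> real) \<Rightarrow> bool" where
  "test_fun \<psi> \<longleftrightarrow> smooth \<psi> \<and> compact (supp \<psi>)"

text \<open>The functions are products over the coordinates of \<open>flat 0\<close> at multiples
  of the distances to the faces of the box. They vanish exactly off the box, and increasing the
  multiple makes them tend to the indicator function pointwise, because
  \<open>exp (- 1 / (k * d))\<close> tends to 1 for every \<open>d > 0\<close>.\<close>

lemma exists_box_bump:
  fixes a b :: "'a::euclidean_space"
  shows "\<exists>\<psi> :: nat \<Rightarrow> 'a \<Rightarrow> real. (\<forall>k. test_fun (\<psi> k)) \<and> (\<forall>k x. 0 \<le> \<psi> k x \<and> \<psi> k x \<le> 1) \<and>
    (\<forall>k x. x \<notin> box a b \<longrightarrow> \<psi> k x = 0) \<and> (\<forall>x. (\<lambda>k. \<psi> k x) \<longlonglongrightarrow> indicator (box a b) x)"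
proof -
  define \<psi> :: "nat \<Rightarrow> 'a \<Rightarrow> real" where
    "\<psi> k x = (\<Prod>i\<in>Basis. flat 0 (x \<bullet> (real (Suc k) *\<^sub>R i) + (- real (Suc k) * (a \<bullet> i))) *
        flat 0 (x \<bullet> ((- real (Suc k)) *\<^sub>R i) + (real (Suc k) * (b \<bullet> i))))" for k x
  have \<psi>_eq: "\<psi> k x = (\<Prod>i\<in>Basis. flat 0 (real (Suc k) * (x \<bullet> i - a \<bullet> i)) *
        flat 0 (real (Suc k) * (b \<bullet> i - x \<bullet> i)))" for k x
    unfolding \<psi>_def by (intro prod.cong) (auto simp: algebra_simps)
  have flat01: "0 \<le> flat 0 t \<and> flat 0 t \<le> 1" for t by (simp add: flat_def)
  have out: "\<psi> k x = 0" if x: "x \<notin> box a b" for k x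
  proof -
    obtain i where i: "i \<in> Basis" "\<not> (a \<bullet> i < x \<bullet> i \<and> x \<bullet> i < b \<bullet> i)"
      using x by (auto simp: box_def)
    then have "flat 0 (real (Suc k) * (x \<bullet> i - a \<bullet> i)) * flat 0 (real (Suc k) * (b \<bullet> i - x \<bullet> i)) = 0"
      by (auto simp: flat_def mult_le_0_iff not_less)
    with i(1) show ?thesis unfolding \<psi>_eq by (intro prod_zero) auto
  qed
  have smooth: "smooth (\<psi> k)" for k
    unfolding smooth_def \<psi>_def by (intro allI C_k_prod C_k_mult C_k_flat_inner)
  have "closure {x. \<psi> k x \<noteq> 0} \<subseteq> cbox a b" for k
    using out[of _ k] box_subset_cbox[of a b] by (intro closure_minimal) auto
  then have "compact (supp (\<psi> k))" for k
    unfolding supp_def by (metis bounded_cbox bounded_subset closed_closure compact_eq_bounded_closed)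
  with smooth have test: "test_fun (\<psi> k)" for k by (simp add: test_fun_def)
  have lim: "(\<lambda>k. \<psi> k x) \<longlonglongrightarrow> indicator (box a b) x" for x
  proof (cases "x \<in> box a b")
    case True
    have flat_lim: "(\<lambda>k. flat 0 (real (Suc k) * d)) \<longlonglongrightarrow> 1" if "d > 0" for d :: real
    proof -
      have "(\<lambda>k. exp (- (inverse (real (Suc k)) * inverse d))) \<longlonglongrightarrow> exp (- (0 * inverse d))"
        by (intro tendsto_intros LIMSEQ_inverse_real_of_nat)
      moreover have "flat 0 (real (Suc k) * d) = exp (- (inverse (real (Suc k)) * inverse d))" for k
        using that by (simp add: flat_def mult_le_0_iff del: of_nat_Suc)
      ultimately show ?thesis by simp
    qed
    have "(\<lambda>k. \<psi> k x) \<longlonglongrightarrow> (\<Prod>i\<in>(Basis::'a set). 1 * 1)"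
      unfolding \<psi>_eq using True
      by (intro tendsto_prod tendsto_mult flat_lim) (auto simp: box_def)
    then show ?thesis using True by simp
  qed (simp add: out)
  have bds: "0 \<le> \<psi> k x \<and> \<psi> k x \<le> 1" for k x
    unfolding \<psi>_eq using flat01 by (auto intro!: prod_nonneg prod_le_1 mult_le_one)
  show ?thesis using test out lim bds by blast
qed

lemma bounded_subset_cball0: "bounded S \<Longrightarrow> \<exists>R. S \<subseteq> cball (0::'a::real_normed_vector) R"
  unfolding bounded_iff by (metis mem_cball_0 subsetI)

section \<open>Local integrability and the fundamental lemma\<close>

text \<open>Measurability is with respect to the Borel sets, so that the theorems of Tonelli and
  Fubini apply to compositions such as \<open>f (x + s *\<^sub>R h)\<close>. Lebesgue
  measurable functions are replaced by Borel representatives.\<close>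

definition locint :: "('a::euclidean_space \<Rightarrow> 'b::euclidean_space) \<Rightarrow> bool" where
  "locint f \<longleftrightarrow> f \<in> borel_measurable borel \<and>
     (\<forall>R. integrable lborel (\<lambda>x. indicator (cball 0 R) x *\<^sub>R f x))"

lemma locint_measurable [measurable_dest]: "locint f \<Longrightarrow> f \<in> borel_measurable borel"
  by (simp add: locint_def)

lemma locint_integrable_mult:
  assumes f: "locint f" and [measurable]: "\<phi> \<in> borel_measurable borel"
    and bd: "\<And>x. \<bar>\<phi> x\<bar> \<le> C * indicator (cball 0 R) x"
  shows "integrable lborel (\<lambda>x. \<phi> x *\<^sub>R f x)"
proof (rule Bochner_Integration.integrable_bound)
  note [measurable] = locint_measurable[OF f]
  show "integrable lborel (\<lambda>x. C *\<^sub>R (indicator (cball 0 R) x *\<^sub>R f x))"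
    using f unfolding locint_def by (intro integrable_scaleR_right) auto
  show "(\<lambda>x. \<phi> x *\<^sub>R f x) \<in> borel_measurable lborel" by measurable
  show "AE x in lborel. norm (\<phi> x *\<^sub>R f x) \<le> norm (C *\<^sub>R (indicator (cball 0 R) x *\<^sub>R f x))"
  proof (intro AE_I2)
    fix x :: 'a
    have "\<bar>\<phi> x\<bar> * norm (f x) \<le> (C * indicator (cball 0 R) x) * norm (f x)"
      by (intro mult_right_mono bd) auto
    also have "\<dots> \<le> \<bar>C\<bar> * indicator (cball 0 R) x * norm (f x)"
      by (intro mult_right_mono) auto
    finally show "norm (\<phi> x *\<^sub>R f x) \<le> norm (C *\<^sub>R (indicator (cball 0 R) x *\<^sub>R f x))"
      by (simp add: abs_mult)
  qed
qed

lemma locint_bound: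
  assumes g: "locint g" and [measurable]: "f \<in> borel_measurable borel"
    and bd: "\<And>x. norm (f x) \<le> norm (g x)"
  shows "locint f"
proof -
  have "integrable lborel (\<lambda>x. indicator (cball 0 R) x *\<^sub>R f x)" for R
  proof (rule Bochner_Integration.integrable_bound)
    show "integrable lborel (\<lambda>x. indicator (cball 0 R) x *\<^sub>R g x)"
      using g by (simp add: locint_def)
  qed (auto simp: indicator_def bd)
  then show ?thesis by (simp add: locint_def)
qed

lemma locint_const:
  fixes c :: "'b::euclidean_space"
  shows "locint (\<lambda>x :: 'a::euclidean_space. c)"
proof -
  have "integrable lborel (\<lambda>x. indicator (cball (0::'a) R) x *\<^sub>R c)" for R
    using emeasure_bounded_finite[OF bounded_cball, of 0 R]
    by (intro integrable_scaleR_left integrable_real_indicator) auto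
  then show ?thesis by (simp add: locint_def)
qed

lemma locint_add: "locint f \<Longrightarrow> locint g \<Longrightarrow> locint (\<lambda>x. f x + g x)"
  by (auto simp: locint_def scaleR_add_right)

lemma locint_inner:
  assumes "locint G"
  shows "locint (\<lambda>x. G x \<bullet> h)"
proof -
  have "integrable lborel (\<lambda>x. (indicator (cball 0 R) x *\<^sub>R G x) \<bullet> h)" for R
    using assms by (intro integrable_inner_left) (auto simp: locint_def)
  with assms show ?thesis by (auto simp: locint_def)
qed

lemma compactly_supported_bound:
  fixes f :: "'a::euclidean_space \<Rightarrow> real"
  assumes "continuous_on UNIV f" "compact K" "\<And>x. x \<notin> K \<Longrightarrow> f x = 0"
  shows "\<exists>C R. 0 \<le> C \<and> (\<forall>x. \<bar>f x\<bar> \<le> C * indicator (cball 0 R) x)"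
proof -
  obtain R where R: "K \<subseteq> cball 0 R"
    using assms(2) compact_imp_bounded bounded_subset_cball0 by blast
  have "compact (f ` cball 0 R)"
    using assms(1) by (intro compact_continuous_image) (auto intro: continuous_on_subset)
  then obtain C where C: "\<And>x. x \<in> cball 0 R \<Longrightarrow> \<bar>f x\<bar> \<le> C"
    by (meson bounded_real compact_imp_bounded imageI)
  have "\<bar>f x\<bar> \<le> max C 0 * indicator (cball 0 R) x" for x
  proof (cases "x \<in> cball 0 R")
    case False
    then have "x \<notin> K" using R by blast
    then show ?thesis using assms(3)[of x] by simp
  qed (use C[of x] in simp)
  then show ?thesis by (intro exI[of _ "max C 0"] exI[of _ R]) auto
qed

lemma test_fun_differentiable:
  assumes "test_fun \<psi>"
  shows "(\<psi> has_derivative frechet_derivative \<psi> (at x)) (at x)"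
proof -
  have "C_k (Suc 0) \<psi>" using assms unfolding test_fun_def smooth_def by blast
  then show ?thesis by (auto simp: frechet_derivative_works[symmetric])
qed

lemma test_fun_continuous:
  assumes "test_fun \<psi>"
  shows "continuous_on UNIV \<psi>" "continuous_on UNIV (\<lambda>x. frechet_derivative \<psi> (at x) h)"
proof -
  have "C_k 0 \<psi>" "C_k (Suc 0) \<psi>" using assms unfolding test_fun_def smooth_def by blast+
  then show "continuous_on UNIV \<psi>" "continuous_on UNIV (\<lambda>x. frechet_derivative \<psi> (at x) h)"
    by auto
qed

lemma test_fun_borel:
  assumes "test_fun \<psi>"
  shows "\<psi> \<in> borel_measurable borel" "(\<lambda>x. frechet_derivative \<psi> (at x) h) \<in> borel_measurable borel"
  by (rule borel_measurable_continuous_onI[OF test_fun_continuous(1)[OF assms]],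
      rule borel_measurable_continuous_onI[OF test_fun_continuous(2)[OF assms]])

lemma test_fun_outside:
  assumes "x \<notin> supp \<psi>"
  shows "\<psi> x = 0" "frechet_derivative \<psi> (at x) h = 0"
proof -
  have *: "\<psi> y = 0" if "y \<notin> supp \<psi>" for y
    using that closure_subset[of "{x. \<psi> x \<noteq> 0}"] by (auto simp: supp_def)
  then show "\<psi> x = 0" using assms by blast
  have "open (- supp \<psi>)" by (auto simp: supp_def)
  moreover have "((\<lambda>y. 0) has_derivative (\<lambda>v. 0)) (at x)" by simp
  ultimately have "(\<psi> has_derivative (\<lambda>v. 0)) (at x)"
    using assms * has_derivative_transform_within_open[of "\<lambda>y. 0" "\<lambda>v. 0" x UNIV "- supp \<psi>" \<psi>]
    by simp
  then show "frechet_derivative \<psi> (at x) h = 0"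
    by (metis frechet_derivative_at)
qed

text \<open>Both bounds have the form in which they are used for domination: a constant times the
  indicator function of a ball.\<close>

lemma test_fun_bound:
  assumes "test_fun \<psi>"
  shows "\<exists>C R. 0 \<le> C \<and> (\<forall>x. \<bar>\<psi> x\<bar> \<le> C * indicator (cball 0 R) x)"
    and "\<exists>C R. 0 \<le> C \<and> (\<forall>x. \<bar>frechet_derivative \<psi> (at x) h\<bar> \<le> C * indicator (cball 0 R) x)"
proof -
  have K: "compact (supp \<psi>)" using assms by (simp add: test_fun_def)
  show "\<exists>C R. 0 \<le> C \<and> (\<forall>x. \<bar>\<psi> x\<bar> \<le> C * indicator (cball 0 R) x)"
    by (rule compactly_supported_bound[OF test_fun_continuous(1)[OF assms] K test_fun_outside(1)[of _ \<psi>]])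
  show "\<exists>C R. 0 \<le> C \<and> (\<forall>x. \<bar>frechet_derivative \<psi> (at x) h\<bar> \<le> C * indicator (cball 0 R) x)"
    by (rule compactly_supported_bound[OF test_fun_continuous(2)[OF assms] K test_fun_outside(2)[of _ \<psi>]])
qed

lemma test_fun_translate:
  assumes "test_fun \<psi>"
  shows "test_fun (\<lambda>x. \<psi> (x - h))"
proof -
  have "(+) h ` supp \<psi> = supp (\<lambda>x. \<psi> (x - h))"
  proof -
    have "(+) h ` {x. \<psi> x \<noteq> 0} = {x. \<psi> (x - h) \<noteq> 0}"
    proof (intro set_eqI iffI)
      fix x assume "x \<in> {x. \<psi> (x - h) \<noteq> 0}"
      then show "x \<in> (+) h ` {x. \<psi> x \<noteq> 0}"
        by (intro image_eqI[of _ _ "x - h"]) auto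
    qed auto
    then show ?thesis unfolding supp_def
      using closure_translation[of h "{x. \<psi> x \<noteq> 0}"] by simp
  qed
  moreover have "compact ((+) h ` supp \<psi>)"
    using assms by (intro compact_translation) (simp add: test_fun_def)
  ultimately show ?thesis
    using assms by (auto simp: test_fun_def smooth_translate)
qed

text \<open>A locally integrable function orthogonal to all test functions has integral zero over
  every box, by dominated convergence along the bumps that approximate the indicator function. Boxes
  are stable under intersection and generate the Borel sets, so the integral over every Borel subset
  of a large box vanishes, and the function is zero almost everywhere.\<close>

theorem fundamental_lemma:
  fixes w :: "'a::euclidean_space \<Rightarrow> real"
  assumes w: "locint w"
    and test: "\<And>\<psi>. test_fun \<psi> \<Longrightarrow> (LBINT x. w x * \<psi> x) = 0"
  shows "AE x in lborel. w x = 0"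
proof -
  note [measurable] = locint_measurable[OF w]
  have box0: "(LBINT x. indicator (box a b) x * w x) = 0" for a b :: 'a
  proof -
    obtain \<psi> :: "nat \<Rightarrow> 'a \<Rightarrow> real" where \<psi>: "\<And>k. test_fun (\<psi> k)"
      "\<And>k x. 0 \<le> \<psi> k x \<and> \<psi> k x \<le> 1" "\<And>k x. x \<notin> box a b \<Longrightarrow> \<psi> k x = 0"
      "\<And>x. (\<lambda>k. \<psi> k x) \<longlonglongrightarrow> indicator (box a b) x"
      using exists_box_bump[of a b] by blast
    obtain R where R: "box a b \<subseteq> cball 0 R"
      using bounded_box bounded_subset_cball0 by blast
    have [measurable]: "\<psi> k \<in> borel_measurable borel" for k
      using test_fun_continuous(1)[OF \<psi>(1)] by (rule borel_measurable_continuous_onI)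
    have "(\<lambda>k. LBINT x. \<psi> k x * w x) \<longlonglongrightarrow> (LBINT x. indicator (box a b) x * w x)"
    proof (rule integral_dominated_convergence)
      show "integrable lborel (\<lambda>x. norm (indicator (cball 0 R) x *\<^sub>R w x))"
        using w by (intro integrable_norm) (simp add: locint_def)
      show "AE x in lborel. (\<lambda>k. \<psi> k x * w x) \<longlonglongrightarrow> indicator (box a b) x * w x"
        by (intro AE_I2 tendsto_intros \<psi>)
      show "AE x in lborel. norm (\<psi> k x * w x) \<le> norm (indicator (cball 0 R) x *\<^sub>R w x)" for k
      proof (intro AE_I2)
        fix x
        show "norm (\<psi> k x * w x) \<le> norm (indicator (cball 0 R) x *\<^sub>R w x)"
          using \<psi>(2)[of k x] \<psi>(3)[of x k] R
          by (cases "x \<in> box a b") (auto simp: abs_mult mult_left_le_one_le)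
      qed
    qed auto
    moreover have "(LBINT x. \<psi> k x * w x) = 0" for k
      using test[OF \<psi>(1)] by (simp add: mult.commute)
    ultimately show ?thesis by (simp add: LIMSEQ_const_iff)
  qed
  \<comment> \<open>Cutting off to a large box makes the function integrable, so that complements
    can be treated in the Dynkin argument.\<close>
  define f where "f n x = indicator (box (- real n *\<^sub>R One) (real n *\<^sub>R One)) x * w x" for n and x :: 'a
  have f_int: "integrable lborel (f n)" for n
  proof -
    obtain R where R: "box (- real n *\<^sub>R One) (real n *\<^sub>R One) \<subseteq> cball (0::'a) R"
      using bounded_box bounded_subset_cball0 by blast
    have "integrable lborel (\<lambda>x. indicator (box (- real n *\<^sub>R One) (real n *\<^sub>R One)) x *\<^sub>R w x)"
    proof (rule locint_integrable_mult[OF w, where C = 1 and R = R])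
      show "\<bar>indicator (box (- real n *\<^sub>R One) (real n *\<^sub>R One)) x\<bar>
          \<le> 1 * indicat_real (cball 0 R) x" for x :: 'a
        using R subsetD[OF R, of x] by (auto simp: indicator_def simp del: mem_cball_0)
    qed auto
    then show ?thesis by (simp add: f_def[abs_def])
  qed
  have "AE x in lborel. f n x = 0" for n
  proof (rule sigma_finite_measure.density_zero[OF sigma_finite_lborel f_int])
    have sets_eq: "sets lborel = sigma_sets UNIV (range (\<lambda>(a, b). box a b :: 'a set))"
      by (simp add: borel_eq_box)
    fix A :: "'a set" assume "A \<in> sets lborel"
    then have A: "A \<in> sigma_sets UNIV (range (\<lambda>(a, b). box a b))"
      by (simp only: sets_eq)
    have "Int_stable (range (\<lambda>(a, b). box a b :: 'a set))"
      by (auto simp: Int_stable_def box_Int_box)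
    moreover have "range (\<lambda>(a, b). box a b :: 'a set) \<subseteq> Pow UNIV" by simp
    moreover note A
    ultimately show "set_lebesgue_integral lborel A (f n) = 0"
    proof (induction rule: sigma_sets_induct_disjoint)
      case (basic A)
      then obtain a b where A: "A = box a b" by auto
      have "indicator A x *\<^sub>R f n x = indicator (A \<inter> box (- real n *\<^sub>R One) (real n *\<^sub>R One)) x * w x" for x
        by (simp add: f_def indicator_def)
      then show ?case
        by (simp add: set_lebesgue_integral_def A box_Int_box box0)
    next
      case (compl A)
      then have A: "A \<in> sets lborel" by (simp only: sets_eq)
      have "indicator (UNIV - A) x *\<^sub>R f n x = f n x - indicator A x *\<^sub>R f n x" for x
        by (simp add: indicator_def)
      moreover have "integral\<^sup>L lborel (f n) = 0"
        unfolding f_def by (rule box0)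
      moreover have "integrable lborel (\<lambda>x. indicator A x *\<^sub>R f n x)"
        by (intro integrable_mult_indicator f_int A)
      ultimately show ?case
        using compl f_int[of n] by (simp add: set_lebesgue_integral_def)
    next
      case (union A)
      have meas: "A i \<in> sets lborel" for i using union(2) unfolding sets_eq by blast
      have "set_integrable lborel (\<Union>i. A i) (f n)"
        unfolding set_integrable_def using meas by (intro integrable_mult_indicator f_int) auto
      then show ?case
        using union meas
        by (subst lebesgue_integral_countable_add) (auto simp: disjoint_family_on_def)
    qed (auto simp: set_lebesgue_integral_def)
  qed
  then have "AE x in lborel. \<forall>n. f n x = 0" by (simp add: AE_all_countable)
  then show ?thesis
  proof eventually_elim
    fix x assume *: "\<forall>n. f n x = 0"
    have "x \<in> (\<Union>n::nat. box (- (real n *\<^sub>R One)) (real n *\<^sub>R One))"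
      by (simp only: UN_box_eq_UNIV UNIV_I)
    then obtain n :: nat where "x \<in> box (- real n *\<^sub>R One) (real n *\<^sub>R One)"
      by auto
    with * show "w x = 0" by (auto simp: f_def dest!: spec[of _ n])
  qed
qed

section \<open>Continuity of translations in the mean\<close>

lemma nn_integral_translate:
  fixes f :: "'a::euclidean_space \<Rightarrow> ennreal"
  assumes [measurable]: "f \<in> borel_measurable borel"
  shows "(\<integral>\<^sup>+x. f (x + h) \<partial>lborel) = (\<integral>\<^sup>+x. f x \<partial>lborel)"
proof -
  have "(\<integral>\<^sup>+x. f x \<partial>lborel) = (\<integral>\<^sup>+x. f x \<partial>distr lborel borel ((+) h))"
    by (simp add: lborel_distr_plus)
  also have "\<dots> = (\<integral>\<^sup>+x. f (h + x) \<partial>lborel)"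
    by (subst nn_integral_distr) auto
  finally show ?thesis by (simp add: add.commute)
qed

lemma integral_translate:
  fixes f :: "'a::euclidean_space \<Rightarrow> 'b::euclidean_space"
  assumes [measurable]: "f \<in> borel_measurable borel"
  shows "(LBINT x. f (x + h)) = (LBINT x. f x)"
proof -
  have "(LBINT x. f x) = (\<integral>x. f x \<partial>distr lborel borel ((+) h))"
    by (simp add: lborel_distr_plus)
  also have "\<dots> = (LBINT x. f (h + x))"
    by (subst integral_distr) auto
  finally show ?thesis by (simp add: add.commute)
qed

lemma integrable_translate:
  fixes f :: "'a::euclidean_space \<Rightarrow> 'b::euclidean_space"
  assumes "integrable lborel f"
  shows "integrable lborel (\<lambda>x. f (x + h))"
proof -
  have [measurable]: "f \<in> borel_measurable borel" using assms by auto
  have "integrable (distr lborel borel ((+) h)) f"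
    using assms by (simp add: lborel_distr_plus)
  then show ?thesis
    by (subst (asm) integrable_distr_eq) (auto simp: add.commute)
qed

lemma locint_translate:
  assumes "locint f"
  shows "locint (\<lambda>x. f (x + h))"
  unfolding locint_def
proof (intro conjI allI)
  note [measurable] = locint_measurable[OF assms]
  show "(\<lambda>x. f (x + h)) \<in> borel_measurable borel" by measurable
  fix R
  have "integrable lborel (\<lambda>x. indicat_real (cball h R) x *\<^sub>R f x)"
  proof (rule locint_integrable_mult[OF assms, where C = 1 and R = "norm h + R"])
    fix x show "\<bar>indicat_real (cball h R) x\<bar> \<le> 1 * indicat_real (cball 0 (norm h + R)) x"
      using norm_triangle_sub[of x h] by (auto simp: indicator_def dist_norm norm_minus_commute)
  qed (rule borel_measurable_indicator, simp)
  from integrable_translate[OF this, of h]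
  show "integrable lborel (\<lambda>x. indicat_real (cball 0 R) x *\<^sub>R f (x + h))"
    by (simp add: indicator_def dist_norm)
qed

text \<open>Stated with sequences because dominated convergence is.\<close>

definition L1_translation_continuous :: "('a::euclidean_space \<Rightarrow> 'b::euclidean_space) \<Rightarrow> bool" where
  "L1_translation_continuous f \<longleftrightarrow>
     (\<forall>h. h \<longlonglongrightarrow> 0 \<longrightarrow> (\<lambda>n. LBINT x. norm (f (x + h n) - f x)) \<longlonglongrightarrow> 0)"

text \<open>Functions with this property form a closed subset of \<open>L\<^sup>1\<close>:
  translation is an isometry, so the error of approximation enters twice.\<close>

lemma L1_translation_continuous_approx:
  fixes f :: "'a::euclidean_space \<Rightarrow> 'b::euclidean_space"
  assumes f: "integrable lborel f"
    and approx: "\<And>e. e > 0 \<Longrightarrow>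
      \<exists>g. integrable lborel g \<and> L1_translation_continuous g \<and> (LBINT x. norm (f x - g x)) < e"
  shows "L1_translation_continuous f"
  unfolding L1_translation_continuous_def
proof (intro allI impI LIMSEQ_I)
  fix h :: "nat \<Rightarrow> 'a" and e :: real assume h: "h \<longlonglongrightarrow> 0" and "e > 0"
  obtain g where g: "integrable lborel g" "L1_translation_continuous g"
    and fg: "(LBINT x. norm (f x - g x)) < e / 3"
    using approx[of "e / 3"] \<open>e > 0\<close> by auto
  obtain N where N: "\<And>n. n \<ge> N \<Longrightarrow> \<bar>LBINT x. norm (g (x + h n) - g x)\<bar> < e / 3"
    using LIMSEQ_D[OF g(2)[unfolded L1_translation_continuous_def, rule_format, OF h], of "e / 3"] \<open>e > 0\<close>
    by auto
  have "\<bar>LBINT x. norm (f (x + h n) - f x)\<bar> < e" if "n \<ge> N" for n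
  proof -
    have i: "integrable lborel (\<lambda>x. norm (f (x + h n) - g (x + h n)))"
      "integrable lborel (\<lambda>x. norm (g (x + h n) - g x))" "integrable lborel (\<lambda>x. norm (f x - g x))"
      using f g integrable_translate[OF f, of "h n"] integrable_translate[OF g(1), of "h n"] by auto
    have fg_m: "(\<lambda>x. norm (f x - g x)) \<in> borel_measurable borel"
      using f g by auto
    have "(LBINT x. norm (f (x + h n) - f x)) \<le> (LBINT x. norm (f (x + h n) - g (x + h n))
        + norm (g (x + h n) - g x) + norm (f x - g x))"
    proof (rule integral_mono)
      show "integrable lborel (\<lambda>x. norm (f (x + h n) - f x))"
        using f integrable_translate[OF f, of "h n"] by auto
      show "norm (f (x + h n) - f x) \<le> norm (f (x + h n) - g (x + h n))
        + norm (g (x + h n) - g x) + norm (f x - g x)" for x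
        using norm_triangle_ineq[of "f (x + h n) - g (x + h n)" "g (x + h n) - g x"]
          norm_triangle_ineq4[of "f (x + h n) - g x" "f x - g x"] by simp
    qed (use i in auto)
    also have "\<dots> = (LBINT x. norm (f (x + h n) - g (x + h n))) + (LBINT x. norm (g (x + h n) - g x))
        + (LBINT x. norm (f x - g x))"
      using i by simp
    also have "(LBINT x. norm (f (x + h n) - g (x + h n))) = (LBINT x. norm (f x - g x))"
      using integral_translate[OF fg_m, of "h n"] .
    finally show ?thesis using fg N[OF that] by (simp add: abs_of_nonneg)
  qed
  then show "\<exists>N. \<forall>n\<ge>N. norm ((LBINT x. norm (f (x + h n) - f x)) - 0) < e"
    by auto
qed

text \<open>For an open set \<open>U\<close> the indicator function at \<open>x + h\<close> is
  eventually 1 for each \<open>x\<close> in \<open>U\<close>, which controls the points that leave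
  \<open>U\<close>; those that enter have the same measure, since translation preserves the measure
  of \<open>U\<close>.\<close>

lemma L1_translation_continuous_open:
  fixes U :: "'a::euclidean_space set" and c :: "'b::euclidean_space"
  assumes U: "open U" "emeasure lborel U < \<infinity>"
  shows "L1_translation_continuous (\<lambda>x. indicator U x *\<^sub>R c)"
  unfolding L1_translation_continuous_def
proof (intro allI impI)
  fix h :: "nat \<Rightarrow> 'a" assume h: "h \<longlonglongrightarrow> 0"
  have [measurable]: "U \<in> sets borel" using U by auto
  have i: "integrable lborel (indicat_real U)" using U by auto
  have eq: "(LBINT x. norm (indicat_real U (x + y) *\<^sub>R c - indicat_real U x *\<^sub>R c))
      = 2 * norm c * (LBINT x. indicat_real U x - indicat_real U x * indicat_real U (x + y))" for y
  proof -
    have i': "integrable lborel (\<lambda>x. indicat_real U (x + y))"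
      by (rule integrable_translate[OF i])
    have i'': "integrable lborel (\<lambda>x. indicat_real U x * indicat_real U (x + y))"
      by (rule Bochner_Integration.integrable_bound[OF i]) (auto simp: indicator_def)
    \<comment> \<open>The last summand integrates to zero by invariance under translation.\<close>
    have "norm (indicat_real U (x + y) *\<^sub>R c - indicat_real U x *\<^sub>R c)
        = norm c * (2 * (indicat_real U x - indicat_real U x * indicat_real U (x + y))
            + (indicat_real U (x + y) - indicat_real U x))" for x
      by (auto simp: indicator_def)
    then have "(LBINT x. norm (indicat_real U (x + y) *\<^sub>R c - indicat_real U x *\<^sub>R c))
      = norm c * (2 * (LBINT x. (indicat_real U x - indicat_real U x * indicat_real U (x + y)))
            + ((LBINT x. indicat_real U (x + y)) - (LBINT x. indicat_real U x)))"
      using i i' i'' by simp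
    then show ?thesis using integral_translate[of "indicat_real U" y] by simp
  qed
  have "(\<lambda>n. LBINT x. indicat_real U x - indicat_real U x * indicat_real U (x + h n))
      \<longlonglongrightarrow> (\<integral>(x::'a). 0 \<partial>lborel)"
  proof (rule integral_dominated_convergence[OF _ _ i])
    show "AE x in lborel. (\<lambda>n. indicat_real U x - indicat_real U x * indicat_real U (x + h n)) \<longlonglongrightarrow> 0"
    proof (intro AE_I2)
      fix x
      show "(\<lambda>n. indicat_real U x - indicat_real U x * indicat_real U (x + h n)) \<longlonglongrightarrow> 0"
      proof (cases "x \<in> U")
        case True
        have "(\<lambda>n. x + h n) \<longlonglongrightarrow> x + 0" by (intro tendsto_intros h)
        then have "\<forall>\<^sub>F n in sequentially. x + h n \<in> U"
          using U(1) True by (simp add: topological_tendstoD)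
        then have "\<forall>\<^sub>F n in sequentially. indicat_real U x - indicat_real U x * indicat_real U (x + h n) = 0"
          by eventually_elim (use True in auto)
        then show ?thesis by (rule tendsto_eventually)
      qed simp
    qed
  qed (auto simp: indicator_def)
  then have "(\<lambda>n. 2 * norm c * (LBINT x. indicat_real U x - indicat_real U x * indicat_real U (x + h n)))
      \<longlonglongrightarrow> 2 * norm c * 0"
    by (intro tendsto_mult tendsto_const) simp
  then show "(\<lambda>n. LBINT x. norm (indicat_real U (x + h n) *\<^sub>R c - indicat_real U x *\<^sub>R c)) \<longlonglongrightarrow> 0"
    unfolding eq by simp
qed

text \<open>Induction over integrable functions. A Borel set of finite measure is approximated from
  outside by an open set.\<close>

lemma L1_translation_continuous_integrable:
  fixes f :: "'a::euclidean_space \<Rightarrow> 'b::euclidean_space"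
  assumes "integrable lborel f"
  shows "L1_translation_continuous f"
  using assms
proof (induction rule: integrable_induct)
  case (base A c)
  then have [measurable]: "A \<in> sets borel" by simp
  show ?case
  proof (rule L1_translation_continuous_approx)
    show "integrable lborel (\<lambda>x. indicat_real A x *\<^sub>R c)"
      using base by (intro integrable_scaleR_left) auto
    fix e :: real assume "e > 0"
    define d where "d = e / (norm c + 1)"
    have "d > 0" using \<open>e > 0\<close> by (auto simp: d_def intro!: divide_pos_pos add_nonneg_pos)
    obtain U where U: "open U" "A \<subseteq> U" "emeasure lborel (U - A) < d"
      using outer_regular_lborel[of A d] \<open>d > 0\<close> by auto
    then have [measurable]: "U \<in> sets borel" by auto
    have "emeasure lborel U \<le> emeasure lborel A + emeasure lborel (U - A)"
      using emeasure_subadditive[of A lborel "U - A"] U(2) by (simp add: Un_absorb1)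
    also have "\<dots> < \<infinity>" using base U(3) by (auto simp: less_top[symmetric] top_unique)
    finally have Ufin: "emeasure lborel U < \<infinity>" .
    have i: "integrable lborel (\<lambda>x. indicat_real U x *\<^sub>R c)"
      using Ufin by (intro integrable_scaleR_left) auto
    have UA: "measure lborel (U - A) < d"
      using U(3) \<open>d > 0\<close> unfolding measure_def
      by (subst enn2real_less_iff) (auto simp: less_top[symmetric] top_unique)
    have "norm (indicat_real A x *\<^sub>R c - indicat_real U x *\<^sub>R c) = norm c * indicat_real (U - A) x" for x
      using U(2) by (auto simp: indicator_def)
    then have "(LBINT x. norm (indicat_real A x *\<^sub>R c - indicat_real U x *\<^sub>R c)) = norm c * measure lborel (U - A)"
      by simp
    also have "\<dots> \<le> (norm c) * d" using UA by (intro mult_left_mono) auto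
    also have "\<dots> < (norm c + 1) * d" using \<open>d > 0\<close> by simp
    also have "\<dots> = e"
      using add_nonneg_pos[OF norm_ge_zero[of c] zero_less_one] by (simp add: d_def)
    finally show "\<exists>g. integrable lborel g \<and> L1_translation_continuous g \<and>
        (LBINT x. norm (indicat_real A x *\<^sub>R c - g x)) < e"
      using i L1_translation_continuous_open[OF U(1) Ufin, of c] by blast
  qed
next
  case (add f g)
  show ?case
    unfolding L1_translation_continuous_def
  proof (intro allI impI)
    fix h :: "nat \<Rightarrow> 'a" assume h: "h \<longlonglongrightarrow> 0"
    have "(\<lambda>n. (LBINT x. norm (f (x + h n) - f x)) + (LBINT x. norm (g (x + h n) - g x))) \<longlonglongrightarrow> 0 + 0"
      using add h unfolding L1_translation_continuous_def by (intro tendsto_add) auto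
    then have lim: "(\<lambda>n. (LBINT x. norm (f (x + h n) - f x)) + (LBINT x. norm (g (x + h n) - g x))) \<longlonglongrightarrow> 0"
      by simp
    show "(\<lambda>n. LBINT x. norm (f (x + h n) + g (x + h n) - (f x + g x))) \<longlonglongrightarrow> 0"
    proof (rule tendsto_sandwich[OF _ _ tendsto_const lim])
      show "\<forall>\<^sub>F n in sequentially. (LBINT x. norm (f (x + h n) + g (x + h n) - (f x + g x)))
          \<le> (LBINT x. norm (f (x + h n) - f x)) + (LBINT x. norm (g (x + h n) - g x))"
      proof (intro always_eventually allI)
        fix n
        have i: "integrable lborel (\<lambda>x. norm (f (x + h n) - f x))" "integrable lborel (\<lambda>x. norm (g (x + h n) - g x))"
          "integrable lborel (\<lambda>x. norm (f (x + h n) + g (x + h n) - (f x + g x)))"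
          using add integrable_translate[of f "h n"] integrable_translate[of g "h n"] by auto
        have "(LBINT x. norm (f (x + h n) + g (x + h n) - (f x + g x)))
          \<le> (LBINT x. norm (f (x + h n) - f x) + norm (g (x + h n) - g x))"
        proof (rule integral_mono)
          show "norm (f (x + h n) + g (x + h n) - (f x + g x))
            \<le> norm (f (x + h n) - f x) + norm (g (x + h n) - g x)" for x
            using norm_triangle_ineq[of "f (x + h n) - f x" "g (x + h n) - g x"]
            by (simp add: algebra_simps)
        qed (use i in auto)
        with i show "(LBINT x. norm (f (x + h n) + g (x + h n) - (f x + g x)))
          \<le> (LBINT x. norm (f (x + h n) - f x)) + (LBINT x. norm (g (x + h n) - g x))"
          by simp
      qed
    qed (auto intro!: always_eventually)
  qed
next
  case (lim f s)
  have f: "integrable lborel f"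
    and s: "\<And>x. (\<lambda>i. s i x) \<longlonglongrightarrow> f x" "\<And>i x. norm (s i x) \<le> 2 * norm (f x)"
      "\<And>i. integrable lborel (s i)" "\<And>i. L1_translation_continuous (s i)"
    using lim by auto
  show ?case
  proof (rule L1_translation_continuous_approx[OF f])
    fix e :: real assume "e > 0"
    have "(\<lambda>i. LBINT x. norm (f x - s i x)) \<longlonglongrightarrow> (\<integral>(x::'a). 0 \<partial>lborel)"
    proof (rule integral_dominated_convergence)
      show "integrable lborel (\<lambda>x. 3 * norm (f x))" using f by simp
      show "AE x in lborel. (\<lambda>i. norm (f x - s i x)) \<longlonglongrightarrow> 0"
      proof (intro AE_I2)
        fix x
        have "(\<lambda>i. norm (f x - s i x)) \<longlonglongrightarrow> norm (f x - f x)"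
          using s(1)[of x] by (intro tendsto_intros) auto
        then show "(\<lambda>i. norm (f x - s i x)) \<longlonglongrightarrow> 0" by simp
      qed
      show "AE x in lborel. norm (norm (f x - s i x)) \<le> 3 * norm (f x)" for i
      proof (intro AE_I2)
        fix x
        show "norm (norm (f x - s i x)) \<le> 3 * norm (f x)"
          using s(2)[of i x] norm_triangle_ineq4[of "f x" "s i x"] by simp
      qed
    qed (use f s in auto)
    then have "(\<lambda>i. LBINT x. norm (f x - s i x)) \<longlonglongrightarrow> 0" by simp
    from order_tendstoD(2)[OF this \<open>e > 0\<close>]
    obtain i where "(LBINT x. norm (f x - s i x)) < e"
      by (auto simp: eventually_sequentially)
    then show "\<exists>g. integrable lborel g \<and> L1_translation_continuous g \<and> (LBINT x. norm (f x - g x)) < e"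
      using s(3,4) by blast
  qed
qed

lemma L1_translation_isCont:
  fixes f :: "'a::euclidean_space \<Rightarrow> 'b::euclidean_space"
  assumes "integrable lborel f"
  shows "isCont (\<lambda>h. LBINT x. norm (f (x + h) - f x)) 0"
  using L1_translation_continuous_integrable[OF assms]
  unfolding continuous_at_sequentially L1_translation_continuous_def by (auto simp: o_def)

section \<open>Weak gradients and averages over segments\<close>

text \<open>The weak gradient for Borel functions, tested in every direction at once instead of in
  the coordinate directions only.\<close>

definition wgrad :: "('a::euclidean_space \<Rightarrow> real) \<Rightarrow> ('a \<Rightarrow> 'a) \<Rightarrow> bool" where
  "wgrad v G \<longleftrightarrow> locint v \<and> locint G \<and>
     (\<forall>\<psi> h. test_fun \<psi> \<longrightarrow>
        (LBINT x. v x * frechet_derivative \<psi> (at x) h) = - (LBINT x. (G x \<bullet> h) * \<psi> x))"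

text \<open>The average of \<open>k\<close> over the segment from \<open>x\<close> to
  \<open>x + h\<close>. For \<open>k = G \<bullet> h\<close> it is the increment of a function
  with gradient \<open>G\<close>.\<close>

definition seg :: "('a::euclidean_space \<Rightarrow> real) \<Rightarrow> 'a \<Rightarrow> 'a \<Rightarrow> real" where
  "seg k h x = (LBINT s. indicator {0..1} s * k (x + s *\<^sub>R h))"

lemma seg_measurable [measurable]:
  assumes [measurable]: "k \<in> borel_measurable borel"
  shows "seg k h \<in> borel_measurable borel"
  unfolding seg_def[abs_def] by measurable

text \<open>If \<open>k\<close> is not integrable along the segment, then the right-hand side is
  infinite, so no case distinction is needed when the bound is integrated in
  \<open>x\<close>.\<close>

lemma seg_diff_bound:
  assumes [measurable]: "k \<in> borel_measurable borel"
  shows "ennreal \<bar>seg k h x - c\<bar> \<le>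
    (\<integral>\<^sup>+s. indicator {0..1} s * ennreal \<bar>k (x + s *\<^sub>R h) - c\<bar> \<partial>lborel)"
proof (cases "(\<integral>\<^sup>+s. indicator {0..1} s * ennreal \<bar>k (x + s *\<^sub>R h) - c\<bar> \<partial>lborel) = \<infinity>")
  case False
  have eq: "ennreal (norm (indicator {0..1} s * (k (x + s *\<^sub>R h) - c)))
      = indicator {0..1} s * ennreal \<bar>k (x + s *\<^sub>R h) - c\<bar>" for s :: real
    by (auto simp: indicator_def)
  have int: "integrable lborel (\<lambda>s::real. indicator {0..1} s * (k (x + s *\<^sub>R h) - c))"
  proof (rule integrableI_bounded)
    show "(\<integral>\<^sup>+s. ennreal (norm (indicator {0..1} s * (k (x + s *\<^sub>R h) - c))) \<partial>lborel) < \<infinity>"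
      unfolding eq using False by (simp add: less_top)
  qed measurable
  have c: "has_bochner_integral lborel (\<lambda>s::real. indicator {0..1} s * c) c"
    using has_bochner_integral_mult_left[of c lborel "indicator {0..1::real}" 1]
      has_bochner_integral_real_indicator[of "{0..1::real}" lborel] by simp
  have "integrable lborel (\<lambda>s::real. indicator {0..1} s * (k (x + s *\<^sub>R h) - c) + indicator {0..1} s * c)"
    using int c by (intro Bochner_Integration.integrable_add) (auto simp: has_bochner_integral_iff)
  then have int': "integrable lborel (\<lambda>s::real. indicator {0..1} s * k (x + s *\<^sub>R h))"
    by (simp add: algebra_simps)
  have "(LBINT s. indicator {0..1} s * (k (x + s *\<^sub>R h) - c)) = seg k h x - c"
    using int' c unfolding seg_def right_diff_distrib
    by (subst Bochner_Integration.integral_diff) (auto simp: has_bochner_integral_iff)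
  then have "ennreal \<bar>seg k h x - c\<bar> = ennreal (norm (LBINT s. indicator {0..1} s * (k (x + s *\<^sub>R h) - c)))"
    by simp
  also have "\<dots> \<le> (\<integral>\<^sup>+s. ennreal (norm (indicator {0..1} s * (k (x + s *\<^sub>R h) - c))) \<partial>lborel)"
    by (rule integral_norm_bound_ennreal[OF int])
  finally show ?thesis unfolding eq .
qed simp

text \<open>Tonelli, then for each point of the segment a translation by at most
  \<open>norm h\<close>, which moves the ball into the larger one.\<close>

lemma seg_L1_bound:
  fixes k :: "'a::euclidean_space \<Rightarrow> real"
  assumes [measurable]: "k \<in> borel_measurable borel"
  shows "(\<integral>\<^sup>+x\<in>cball 0 R. ennreal \<bar>seg k h x\<bar> \<partial>lborel) \<le> (\<integral>\<^sup>+x\<in>cball 0 (R + norm h). ennreal \<bar>k x\<bar> \<partial>lborel)"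
proof -
  have [measurable]: "cball 0 r \<in> sets borel" for r :: real by simp
  have "(\<integral>\<^sup>+x\<in>cball 0 R. ennreal \<bar>seg k h x\<bar> \<partial>lborel)
      \<le> (\<integral>\<^sup>+x\<in>cball 0 R. (\<integral>\<^sup>+s. indicator {0..1} s * ennreal \<bar>k (x + s *\<^sub>R h)\<bar> \<partial>lborel) \<partial>lborel)"
    using seg_diff_bound[of k h _ 0] by (intro nn_integral_mono mult_right_mono) auto
  also have "\<dots> = (\<integral>\<^sup>+x. (\<integral>\<^sup>+s. indicator {0..1} s * (indicator (cball 0 R) x * ennreal \<bar>k (x + s *\<^sub>R h)\<bar>) \<partial>lborel) \<partial>lborel)"
    by (intro nn_integral_cong) (simp add: nn_integral_cmult[symmetric] mult_ac)
  also have "\<dots> = (\<integral>\<^sup>+s. (\<integral>\<^sup>+x. indicator {0..1} s * (indicator (cball 0 R) x * ennreal \<bar>k (x + s *\<^sub>R h)\<bar>) \<partial>lborel) \<partial>lborel)"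
    by (rule lborel_pair.Fubini'[symmetric]) measurable
  also have "\<dots> \<le> (\<integral>\<^sup>+s. indicator {0..1::real} s * (\<integral>\<^sup>+x\<in>cball 0 (R + norm h). ennreal \<bar>k x\<bar> \<partial>lborel) \<partial>lborel)"
  proof (rule nn_integral_mono)
    fix s :: real
    have "(\<integral>\<^sup>+x. indicator (cball 0 R) x * ennreal \<bar>k (x + s *\<^sub>R h)\<bar> \<partial>lborel)
        \<le> (\<integral>\<^sup>+x. indicator (cball 0 (R + norm h)) (x + s *\<^sub>R h) * ennreal \<bar>k (x + s *\<^sub>R h)\<bar> \<partial>lborel)"
      if s: "s \<in> {0..1}"
    proof (intro nn_integral_mono mult_right_mono)
      fix x :: 'a
      have "norm (x + s *\<^sub>R h) \<le> norm x + s * norm h"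
        using s norm_triangle_ineq[of x "s *\<^sub>R h"] by simp
      also have "s * norm h \<le> norm h" using s by (simp add: mult_left_le_one_le)
      finally show "(indicator (cball 0 R) x :: ennreal) \<le> indicator (cball 0 (R + norm h)) (x + s *\<^sub>R h)"
        by (auto simp: indicator_def)
    qed simp
    also have "\<dots> = (\<integral>\<^sup>+x\<in>cball 0 (R + norm h). ennreal \<bar>k x\<bar> \<partial>lborel)"
      by (subst nn_integral_translate[of "\<lambda>x. indicator (cball 0 (R + norm h)) x * ennreal \<bar>k x\<bar>"])
         (auto simp: mult.commute)
    finally show "(\<integral>\<^sup>+x. indicator {0..1} s * (indicator (cball 0 R) x * ennreal \<bar>k (x + s *\<^sub>R h)\<bar>) \<partial>lborel)
        \<le> indicator {0..1::real} s * (\<integral>\<^sup>+x\<in>cball 0 (R + norm h). ennreal \<bar>k x\<bar> \<partial>lborel)"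
      by (cases "s \<in> {0..1}") auto
  qed
  also have "\<dots> = (\<integral>\<^sup>+x\<in>cball 0 (R + norm h). ennreal \<bar>k x\<bar> \<partial>lborel)"
    by (subst nn_integral_multc) auto
  finally show ?thesis .
qed

lemma locint_finite:
  assumes "locint f"
  shows "(\<integral>\<^sup>+x\<in>cball 0 R. ennreal (norm (f x)) \<partial>lborel) < \<infinity>"
proof -
  have "integrable lborel (\<lambda>x. indicator (cball 0 R) x *\<^sub>R f x)" using assms by (simp add: locint_def)
  then have "(\<integral>\<^sup>+x. ennreal (norm (indicator (cball 0 R) x *\<^sub>R f x)) \<partial>lborel) < \<infinity>"
    by (simp add: integrable_iff_bounded)
  also have "(\<integral>\<^sup>+x. ennreal (norm (indicator (cball 0 R) x *\<^sub>R f x)) \<partial>lborel) = (\<integral>\<^sup>+x\<in>cball 0 R. ennreal (norm (f x)) \<partial>lborel)"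
    by (intro nn_integral_cong) (auto simp: indicator_def)
  finally show ?thesis .
qed

lemma locintI:
  fixes f :: "'a::euclidean_space \<Rightarrow> 'b::euclidean_space"
  assumes [measurable]: "f \<in> borel_measurable borel"
    and "\<And>R. (\<integral>\<^sup>+x\<in>cball 0 R. ennreal (norm (f x)) \<partial>lborel) < \<infinity>"
  shows "locint f"
proof -
  have [measurable]: "cball 0 r \<in> sets borel" for r :: real by simp
  have eq: "(\<integral>\<^sup>+x. ennreal (norm (indicator (cball 0 R) x *\<^sub>R f x)) \<partial>lborel) = (\<integral>\<^sup>+x\<in>cball 0 R. ennreal (norm (f x)) \<partial>lborel)" for R
    by (intro nn_integral_cong) (auto simp: indicator_def)
  have "integrable lborel (\<lambda>x. indicator (cball 0 R) x *\<^sub>R f x)" for R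
    using assms(2)[of R] unfolding eq[symmetric] by (intro integrableI_bounded) auto
  then show ?thesis by (simp add: locint_def)
qed

lemma seg_locint:
  assumes "locint k"
  shows "locint (seg k h)"
proof (rule locintI)
  note [measurable] = locint_measurable[OF assms]
  show "seg k h \<in> borel_measurable borel" by measurable
  show "(\<integral>\<^sup>+x\<in>cball 0 R. ennreal (norm (seg k h x)) \<partial>lborel) < \<infinity>" for R
    using le_less_trans[OF seg_L1_bound[of k] locint_finite[OF assms, simplified]] by simp
qed

lemma segment_Fubini_bounded:
  fixes F :: "real \<Rightarrow> 'a::euclidean_space \<Rightarrow> real"
  assumes [measurable]: "case_prod F \<in> borel_measurable (borel \<Otimes>\<^sub>M borel)"
    and K: "K < \<infinity>" "\<And>s. s \<in> {0..1} \<Longrightarrow> (\<integral>\<^sup>+x. ennreal \<bar>F s x\<bar> \<partial>lborel) \<le> K"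
  shows "(LBINT x. (LBINT s. indicator {0..1} s * F s x))
    = (LBINT s. indicator {0..1} s * (LBINT x. F s x))"
proof -
  have "integrable (lborel \<Otimes>\<^sub>M lborel) (\<lambda>(s, x). indicator {0..1} s * F s x)"
  proof (rule integrableI_bounded)
    have "(\<integral>\<^sup>+z. ennreal (norm (case z of (s, x) \<Rightarrow> indicator {0..1} s * F s x)) \<partial>(lborel \<Otimes>\<^sub>M lborel))
        = (\<integral>\<^sup>+s. \<integral>\<^sup>+x. ennreal (norm (indicator {0..1} s * F s x)) \<partial>lborel \<partial>lborel)"
      by (subst lborel.nn_integral_fst[symmetric]) auto
    also have "\<dots> \<le> (\<integral>\<^sup>+s. indicator {0..1::real} s * K \<partial>lborel)"
    proof (rule nn_integral_mono)
      fix s :: real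
      show "(\<integral>\<^sup>+x. ennreal (norm (indicator {0..1} s * F s x)) \<partial>lborel) \<le> indicator {0..1} s * K"
        using K(2)[of s] by (cases "s \<in> {0..1}") auto
    qed
    also have "\<dots> = K" by (subst nn_integral_multc) auto
    also note K(1)
    finally show "(\<integral>\<^sup>+z. ennreal (norm (case z of (s, x) \<Rightarrow> indicator {0..1} s * F s x))
        \<partial>(lborel \<Otimes>\<^sub>M lborel)) < \<infinity>" .
  qed measurable
  from lborel_pair.Fubini_integral[OF this] show ?thesis
    by (simp flip: integral_mult_right_zero)
qed

text \<open>One factor is only locally integrable, the other is bounded with bounded support.
  Translating by a point of the segment keeps the support in one fixed ball, so the hypotheses of
  Fubini hold uniformly along the segment.\<close>

lemma segment_Fubini:
  fixes a b :: "'a::euclidean_space \<Rightarrow> real"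
  assumes a: "locint a" and [measurable]: "b \<in> borel_measurable borel"
    and b: "0 \<le> C" "\<And>x. \<bar>b x\<bar> \<le> C * indicator (cball 0 R) x"
  shows "(LBINT x. (LBINT s. indicator {0..1} s * (a x * b (x + s *\<^sub>R h))))
      = (LBINT s. indicator {0..1} s * (LBINT x. a x * b (x + s *\<^sub>R h)))" (is ?first)
    and "(LBINT x. (LBINT s. indicator {0..1} s * (a (x + s *\<^sub>R h) * b x)))
      = (LBINT s. indicator {0..1} s * (LBINT x. a (x + s *\<^sub>R h) * b x))" (is ?second)
proof -
  note [measurable] = locint_measurable[OF a]
  have [measurable]: "cball (0::'a) r \<in> sets borel" for r :: real by simp
  define K where "K = (\<integral>\<^sup>+x\<in>cball 0 (R + norm h). ennreal \<bar>a x\<bar> \<partial>lborel)"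
  have K: "ennreal C * K < \<infinity>"
    using locint_finite[OF a, of "R + norm h"] by (simp add: K_def ennreal_mult_less_top)
  have bound: "(\<integral>\<^sup>+x. ennreal \<bar>a x * b (x + y)\<bar> \<partial>lborel) \<le> ennreal C * K"
    if y: "norm y \<le> norm h" for y
  proof -
    have "(\<integral>\<^sup>+x. ennreal \<bar>a x * b (x + y)\<bar> \<partial>lborel)
        \<le> (\<integral>\<^sup>+x. ennreal C * (ennreal \<bar>a x\<bar> * indicator (cball 0 (R + norm h)) x) \<partial>lborel)"
    proof (rule nn_integral_mono)
      fix x
      have "\<bar>b (x + y)\<bar> \<le> C * indicator (cball 0 (R + norm h)) x"
        using b(2)[of "x + y"] norm_triangle_ineq4[of "x + y" y] y b(1)
        by (cases "norm (x + y) \<le> R"; cases "norm x \<le> R + norm h") auto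
      from mult_left_mono[OF this abs_ge_zero[of "a x"]]
      have "\<bar>a x * b (x + y)\<bar> \<le> C * (\<bar>a x\<bar> * indicator (cball 0 (R + norm h)) x)"
        by (simp add: abs_mult mult_ac)
      then have "ennreal \<bar>a x * b (x + y)\<bar> \<le> ennreal (C * (\<bar>a x\<bar> * indicator (cball 0 (R + norm h)) x))"
        by (rule ennreal_leI)
      also have "\<dots> = ennreal C * (ennreal \<bar>a x\<bar> * indicator (cball 0 (R + norm h)) x)"
        using b(1) by (simp add: ennreal_mult indicator_def)
      finally show "ennreal \<bar>a x * b (x + y)\<bar> \<le> ennreal C * (ennreal \<bar>a x\<bar> * indicator (cball 0 (R + norm h)) x)" .
    qed
    then show ?thesis by (simp add: nn_integral_cmult K_def)
  qed
  have sh: "norm (s *\<^sub>R h) \<le> norm h" if "s \<in> {0..1}" for s :: real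
    using that by (simp add: mult_left_le_one_le)
  show ?first
    by (rule segment_Fubini_bounded[OF _ K]) (measurable, intro bound sh)
  show ?second
  proof (rule segment_Fubini_bounded[OF _ K])
    fix s :: real assume s: "s \<in> {0..1}"
    have "(\<integral>\<^sup>+x. ennreal \<bar>a (x + s *\<^sub>R h) * b x\<bar> \<partial>lborel) = (\<integral>\<^sup>+x. ennreal \<bar>a x * b (x + - (s *\<^sub>R h))\<bar> \<partial>lborel)"
      using nn_integral_translate[of "\<lambda>x. ennreal \<bar>a x * b (x + - (s *\<^sub>R h))\<bar>" "s *\<^sub>R h"] by simp
    also have "\<dots> \<le> ennreal C * K" using sh[OF s] by (intro bound) simp
    finally show "(\<integral>\<^sup>+x. ennreal \<bar>a (x + s *\<^sub>R h) * b x\<bar> \<partial>lborel) \<le> ennreal C * K" .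
  qed measurable
qed

section \<open>Increments of weakly differentiable functions\<close>

lemma locint_cmult: "locint f \<Longrightarrow> locint (\<lambda>x. c * f x)" for f :: "'a::euclidean_space \<Rightarrow> real"
  unfolding locint_def by (auto simp: mult.left_commute[of _ c])

lemma locint_diff: "locint f \<Longrightarrow> locint g \<Longrightarrow> locint (\<lambda>x. f x - g x)" for f :: "'a::euclidean_space \<Rightarrow> real"
  using locint_add[of f "\<lambda>x. - 1 * g x"] locint_cmult[of g "-1"] by simp

lemma test_fun_line_derivative:
  assumes "test_fun \<psi>"
  shows "((\<lambda>s. \<psi> (x + s *\<^sub>R (- h))) has_real_derivative
    - frechet_derivative \<psi> (at (x + s *\<^sub>R (- h))) h) (at s)"
proof -
  have "((\<lambda>s. x + s *\<^sub>R (- h)) has_derivative (\<lambda>r. r *\<^sub>R (- h))) (at s)"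
    by (auto intro!: derivative_eq_intros)
  from has_derivative_compose[OF this test_fun_differentiable[OF assms]]
  have "((\<lambda>s. \<psi> (x + s *\<^sub>R (- h))) has_derivative
      (\<lambda>r. frechet_derivative \<psi> (at (x + s *\<^sub>R (- h))) (r *\<^sub>R (- h)))) (at s)" .
  moreover have "linear (frechet_derivative \<psi> (at y))" for y
    using test_fun_differentiable[OF assms] has_derivative_linear by blast
  then have "frechet_derivative \<psi> (at y) (r *\<^sub>R (- h)) = (- frechet_derivative \<psi> (at y) h) * r" for r y
    by (simp add: linear_scale linear_neg)
  ultimately show ?thesis
    by (simp only: has_field_derivative_def)
qed

text \<open>The fundamental theorem of calculus for weak gradients; the translation estimate and the
  chain rule are derived from it. Tested against \<open>\<psi>\<close>, the left-hand side becomes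
  the integral of \<open>v\<close> against \<open>\<psi> (x - h) - \<psi> x\<close>, which is
  the integral of a derivative of \<open>\<psi>\<close> along a segment. For each point of the
  segment the definition of the weak gradient, applied to a translated test function, moves the
  derivative onto \<open>v\<close>. Fubini gives the right-hand side.\<close>

lemma wgrad_increment:
  assumes "wgrad v G"
  shows "AE x in lborel. v (x + h) - v x = seg (\<lambda>x. G x \<bullet> h) h x"
proof -
  define k where "k x = G x \<bullet> h" for x
  have v: "locint v" and k: "locint k"
    using assms by (auto simp: wgrad_def k_def[abs_def] intro: locint_inner)
  note [measurable] = locint_measurable[OF v] locint_measurable[OF k]
  have s: "locint (seg k h)" by (rule seg_locint[OF k])
  have vh: "locint (\<lambda>x. v (x + h))" by (rule locint_translate[OF v])
  have "AE x in lborel. v (x + h) - v x - seg k h x = 0"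
  proof (rule fundamental_lemma)
    show "locint (\<lambda>x. v (x + h) - v x - seg k h x)"
      by (intro locint_diff v vh s)
    fix \<psi> :: "'a \<Rightarrow> real" assume \<psi>: "test_fun \<psi>"
    define \<eta> where "\<eta> x = frechet_derivative \<psi> (at x) h" for x
    have cont: "continuous_on UNIV \<psi>" "continuous_on UNIV \<eta>"
      using test_fun_continuous[OF \<psi>] by (auto simp: \<eta>_def[abs_def])
    then have [measurable]: "\<psi> \<in> borel_measurable borel" "\<eta> \<in> borel_measurable borel"
      by (auto intro: borel_measurable_continuous_onI)
    obtain C R where \<psi>_bd: "0 \<le> C" "\<And>x. \<bar>\<psi> x\<bar> \<le> C * indicator (cball 0 R) x"
      using test_fun_bound(1)[OF \<psi>] by auto
    obtain C' R' where \<eta>_bd: "0 \<le> C'" "\<And>x. \<bar>- \<eta> x\<bar> \<le> C' * indicator (cball 0 R') x"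
      using test_fun_bound(2)[OF \<psi>, of h] by (auto simp: \<eta>_def)
    obtain C1 R1 where \<psi>h_bd: "\<And>x. \<bar>\<psi> (x - h)\<bar> \<le> C1 * indicator (cball 0 R1) x"
      using test_fun_bound(1)[OF test_fun_translate[OF \<psi>, of h]] by auto
    have FTC: "\<psi> (x - h) - \<psi> x = (LBINT s. indicator {0..1} s * - \<eta> (x + s *\<^sub>R (- h)))" for x
    proof -
      have "(LBINT s. - \<eta> (x + s *\<^sub>R (- h)) * indicator {0..1} s)
          = \<psi> (x + 1 *\<^sub>R (- h)) - \<psi> (x + 0 *\<^sub>R (- h))"
      proof (rule integral_FTC_Icc_real)
        fix s :: real
        show "((\<lambda>s. \<psi> (x + s *\<^sub>R (- h))) has_real_derivative - \<eta> (x + s *\<^sub>R (- h))) (at s)"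
          unfolding \<eta>_def by (rule test_fun_line_derivative[OF \<psi>])
        have "continuous_on UNIV (\<lambda>s. - \<eta> (x + s *\<^sub>R (- h)))"
          by (intro continuous_on_minus continuous_on_compose2[OF cont(2)] continuous_intros subset_UNIV)
        then show "isCont (\<lambda>s. - \<eta> (x + s *\<^sub>R (- h))) s"
          by (simp add: continuous_on_eq_continuous_at)
      qed simp
      then show ?thesis by (simp add: mult.commute)
    qed
    have inner: "(LBINT x. v x * - \<eta> (x + s *\<^sub>R (- h))) = (LBINT x. k (x + s *\<^sub>R h) * \<psi> x)" for s
    proof -
      have "(LBINT x. v x * \<eta> (x - s *\<^sub>R h)) = - (LBINT x. k x * \<psi> (x - s *\<^sub>R h))"
      proof -
        have "(LBINT x. v x * frechet_derivative (\<lambda>x. \<psi> (x - s *\<^sub>R h)) (at x) h)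
            = - (LBINT x. (G x \<bullet> h) * \<psi> (x - s *\<^sub>R h))"
          using assms test_fun_translate[OF \<psi>, of "s *\<^sub>R h"] by (simp add: wgrad_def)
        moreover have "smooth \<psi>" using \<psi> by (simp add: test_fun_def)
        ultimately show ?thesis by (simp add: smooth_translate(2) k_def \<eta>_def)
      qed
      also have "(LBINT x. k x * \<psi> (x - s *\<^sub>R h)) = (LBINT x. k (x + s *\<^sub>R h) * \<psi> x)"
        using integral_translate[of "\<lambda>x. k x * \<psi> (x - s *\<^sub>R h)" "s *\<^sub>R h"] by simp
      finally show ?thesis by simp
    qed
    have i1: "integrable lborel (\<lambda>x. v (x + h) * \<psi> x)" "integrable lborel (\<lambda>x. v x * \<psi> x)"
      "integrable lborel (\<lambda>x. seg k h x * \<psi> x)" "integrable lborel (\<lambda>x. v x * \<psi> (x - h))"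
      using locint_integrable_mult[OF vh _ \<psi>_bd(2)] locint_integrable_mult[OF v _ \<psi>_bd(2)]
        locint_integrable_mult[OF s _ \<psi>_bd(2)] locint_integrable_mult[OF v _ \<psi>h_bd]
      by (auto simp: mult.commute)
    have "(LBINT x. v (x + h) * \<psi> x) - (LBINT x. v x * \<psi> x)
        = (LBINT x. v x * \<psi> (x - h)) - (LBINT x. v x * \<psi> x)"
      using integral_translate[of "\<lambda>x. v x * \<psi> (x - h)" h] by simp
    also have "\<dots> = (LBINT x. v x * (\<psi> (x - h) - \<psi> x))"
      using i1 by (simp add: right_diff_distrib)
    also have "\<dots> = (LBINT x. (LBINT s. indicator {0..1} s * (v x * - \<eta> (x + s *\<^sub>R (- h)))))"
      unfolding FTC integral_mult_right_zero[symmetric] by (simp only: mult.left_commute)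
    also have "\<dots> = (LBINT s. indicator {0..1} s * (LBINT x. v x * - \<eta> (x + s *\<^sub>R (- h))))"
      by (rule segment_Fubini(1)[OF v _ \<eta>_bd]) measurable
    also have "\<dots> = (LBINT s. indicator {0..1} s * (LBINT x. k (x + s *\<^sub>R h) * \<psi> x))"
      by (simp only: inner)
    also have "\<dots> = (LBINT x. (LBINT s. indicator {0..1} s * (k (x + s *\<^sub>R h) * \<psi> x)))"
      by (rule segment_Fubini(2)[OF k _ \<psi>_bd, symmetric]) measurable
    also have "\<dots> = (LBINT x. seg k h x * \<psi> x)"
      unfolding seg_def integral_mult_left_zero[symmetric] by (simp only: mult.assoc)
    finally show "(LBINT x. (v (x + h) - v x - seg k h x) * \<psi> x) = 0"
      using i1 by (simp add: left_diff_distrib)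
  qed
  then show ?thesis unfolding k_def[abs_def] by eventually_elim simp
qed

text \<open>Averages over short segments are averages of short translations, hence close to the
  identity in the mean.\<close>

lemma seg_tendsto_L1:
  fixes k :: "'a::euclidean_space \<Rightarrow> real"
  assumes k: "locint k" and "e > 0"
  shows "\<exists>d>0. \<forall>y. norm y < d \<longrightarrow> (\<integral>\<^sup>+x\<in>cball 0 R. ennreal \<bar>seg k y x - k x\<bar> \<partial>lborel) \<le> ennreal e"
proof -
  note [measurable] = locint_measurable[OF k]
  have [measurable]: "cball (0::'a) r \<in> sets borel" for r :: real by simp
  define f where "f x = indicat_real (cball 0 (R + 1)) x *\<^sub>R k x" for x
  have f: "integrable lborel f" using k by (simp add: locint_def f_def[abs_def])
  have [measurable]: "f \<in> borel_measurable borel" unfolding f_def[abs_def] by measurable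
  obtain d where d: "d > 0" "\<And>y. norm y < d \<Longrightarrow> \<bar>LBINT x. norm (f (x + y) - f x)\<bar> < e"
    using L1_translation_isCont[OF f] \<open>e > 0\<close>
    unfolding continuous_at_eps_delta by (auto simp: dist_norm)
  have "(\<integral>\<^sup>+x\<in>cball 0 R. ennreal \<bar>seg k y x - k x\<bar> \<partial>lborel) \<le> ennreal e" if y: "norm y < min d 1" for y
  proof -
    have "(\<integral>\<^sup>+x\<in>cball 0 R. ennreal \<bar>seg k y x - k x\<bar> \<partial>lborel)
        \<le> (\<integral>\<^sup>+x\<in>cball 0 R. (\<integral>\<^sup>+s. indicator {0..1} s * ennreal \<bar>k (x + s *\<^sub>R y) - k x\<bar> \<partial>lborel) \<partial>lborel)"
      using seg_diff_bound[of k y] by (intro nn_integral_mono mult_right_mono) auto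
    also have "\<dots> = (\<integral>\<^sup>+x. (\<integral>\<^sup>+s. indicator {0..1} s * (indicator (cball 0 R) x * ennreal \<bar>k (x + s *\<^sub>R y) - k x\<bar>) \<partial>lborel) \<partial>lborel)"
      by (intro nn_integral_cong) (simp add: nn_integral_cmult[symmetric] mult_ac)
    also have "\<dots> = (\<integral>\<^sup>+s. (\<integral>\<^sup>+x. indicator {0..1} s * (indicator (cball 0 R) x * ennreal \<bar>k (x + s *\<^sub>R y) - k x\<bar>) \<partial>lborel) \<partial>lborel)"
      by (rule lborel_pair.Fubini'[symmetric]) measurable
    also have "\<dots> \<le> (\<integral>\<^sup>+s. indicator {0..1::real} s * ennreal e \<partial>lborel)"
    proof (rule nn_integral_mono)
      fix s :: real
      have "(\<integral>\<^sup>+x. indicator (cball 0 R) x * ennreal \<bar>k (x + s *\<^sub>R y) - k x\<bar> \<partial>lborel) \<le> ennreal e"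
        if s: "s \<in> {0..1}"
      proof -
        have sy: "norm (s *\<^sub>R y) \<le> norm y" using s by (simp add: mult_left_le_one_le)
        have "(\<integral>\<^sup>+x. indicator (cball 0 R) x * ennreal \<bar>k (x + s *\<^sub>R y) - k x\<bar> \<partial>lborel)
            \<le> (\<integral>\<^sup>+x. ennreal (norm (f (x + s *\<^sub>R y) - f x)) \<partial>lborel)"
        proof (rule nn_integral_mono)
          fix x
          show "indicator (cball 0 R) x * ennreal \<bar>k (x + s *\<^sub>R y) - k x\<bar> \<le> ennreal (norm (f (x + s *\<^sub>R y) - f x))"
            using norm_triangle_ineq[of x "s *\<^sub>R y"] sy y
            by (cases "norm x \<le> R") (auto simp: f_def indicator_def)
        qed
        also have "\<dots> = ennreal (LBINT x. norm (f (x + s *\<^sub>R y) - f x))"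
          using f integrable_translate[OF f, of "s *\<^sub>R y"] by (intro nn_integral_eq_integral) auto
        also have "\<dots> \<le> ennreal e"
          using d(2)[of "s *\<^sub>R y"] sy y by (intro ennreal_leI) auto
        finally show ?thesis .
      qed
      then show "(\<integral>\<^sup>+x. indicator {0..1} s * (indicator (cball 0 R) x * ennreal \<bar>k (x + s *\<^sub>R y) - k x\<bar>) \<partial>lborel)
          \<le> indicator {0..1::real} s * ennreal e"
        by (cases "s \<in> {0..1}") auto
    qed
    also have "\<dots> = ennreal e" by (subst nn_integral_multc) auto
    finally show ?thesis .
  qed
  then show ?thesis using d(1) by (intro exI[of _ "min d 1"]) auto
qed

section \<open>Difference quotients and the chain rule\<close>

lemma ennreal_tendsto_0I:
  fixes f :: "'b \<Rightarrow> ennreal"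
  assumes "\<And>e::real. e > 0 \<Longrightarrow> \<forall>\<^sub>F n in F. f n \<le> ennreal e"
  shows "(f \<longlongrightarrow> 0) F"
proof (rule order_tendstoI)
  fix a :: ennreal assume "0 < a"
  then obtain b where b: "0 < b" "b < a" using dense by blast
  then obtain e where e: "b = ennreal e" "e \<ge> 0"
    by (metis ennreal_cases not_less_iff_gr_or_eq top_greatest order_less_le_trans linorder_not_le)
  with b have "e > 0" by (cases "e = 0") auto
  from assms[OF this] show "\<forall>\<^sub>F n in F. f n < a"
    by eventually_elim (use b e in auto)
qed auto

text \<open>Difference quotients of \<open>v\<close> are averages of the directional derivative over
  segments that shrink to a point.\<close>

lemma wgrad_difference_quotient_L1:
  assumes wg: "wgrad v G" and lim: "t \<longlonglongrightarrow> 0" and t: "\<And>n::nat. t n > 0"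
  shows "(\<lambda>n. \<integral>\<^sup>+x\<in>cball 0 R. ennreal \<bar>(v (x + t n *\<^sub>R h) - v x) / t n - G x \<bullet> h\<bar> \<partial>lborel) \<longlonglongrightarrow> 0"
proof (rule ennreal_tendsto_0I)
  fix e :: real assume "e > 0"
  define k where "k x = G x \<bullet> h" for x
  have k: "locint k"
    using wg by (auto simp: wgrad_def k_def[abs_def] intro: locint_inner)
  obtain d where d: "d > 0"
    "\<And>y. norm y < d \<Longrightarrow> (\<integral>\<^sup>+x\<in>cball 0 R. ennreal \<bar>seg k y x - k x\<bar> \<partial>lborel) \<le> ennreal e"
    using seg_tendsto_L1[OF k \<open>e > 0\<close>, of R] by auto
  have "(\<lambda>n. t n *\<^sub>R h) \<longlonglongrightarrow> 0 *\<^sub>R h" by (intro tendsto_intros lim)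
  then have "\<forall>\<^sub>F n in sequentially. norm (t n *\<^sub>R h) < d"
    using d(1) by (simp add: tendsto_iff dist_norm)
  then show "\<forall>\<^sub>F n in sequentially.
      (\<integral>\<^sup>+x\<in>cball 0 R. ennreal \<bar>(v (x + t n *\<^sub>R h) - v x) / t n - G x \<bullet> h\<bar> \<partial>lborel) \<le> ennreal e"
  proof eventually_elim
    fix n assume n: "norm (t n *\<^sub>R h) < d"
    have "AE x in lborel. (v (x + t n *\<^sub>R h) - v x) / t n = seg k (t n *\<^sub>R h) x"
      using wgrad_increment[OF wg, of "t n *\<^sub>R h"]
    proof eventually_elim
      fix x assume "v (x + t n *\<^sub>R h) - v x = seg (\<lambda>x. G x \<bullet> (t n *\<^sub>R h)) (t n *\<^sub>R h) x"
      also have "\<dots> = t n * seg k (t n *\<^sub>R h) x"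
        by (simp add: seg_def k_def mult.left_commute[of _ "t n"])
      finally show "(v (x + t n *\<^sub>R h) - v x) / t n = seg k (t n *\<^sub>R h) x"
        using t[of n] by simp
    qed
    then have "(\<integral>\<^sup>+x\<in>cball 0 R. ennreal \<bar>(v (x + t n *\<^sub>R h) - v x) / t n - G x \<bullet> h\<bar> \<partial>lborel)
        = (\<integral>\<^sup>+x\<in>cball 0 R. ennreal \<bar>seg k (t n *\<^sub>R h) x - k x\<bar> \<partial>lborel)"
      by (intro nn_integral_cong_AE) (auto simp: k_def)
    also have "\<dots> \<le> ennreal e" by (rule d(2)[OF n])
    finally show "(\<integral>\<^sup>+x\<in>cball 0 R. ennreal \<bar>(v (x + t n *\<^sub>R h) - v x) / t n - G x \<bullet> h\<bar> \<partial>lborel) \<le> ennreal e" .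
  qed
qed

lemma slope_tendsto:
  fixes T :: "real \<Rightarrow> real"
  assumes T: "(T has_real_derivative D) (at a)" and y: "y \<longlonglongrightarrow> a"
  shows "(\<lambda>n. if y n = a then D else (T (y n) - T a) / (y n - a)) \<longlonglongrightarrow> D"
proof -
  obtain g where g: "\<forall>z. T z - T a = g z * (z - a)" "isCont g a" "g a = D"
    using iffD1[OF CARAT_DERIV T] by auto
  have "(\<lambda>n. g (y n)) \<longlonglongrightarrow> D"
    using isCont_tendsto_compose[OF g(2) y] g(3) by simp
  moreover have "(if y n = a then D else (T (y n) - T a) / (y n - a)) = g (y n)" for n
    using g by auto
  ultimately show ?thesis by simp
qed

text \<open>The mean value inequality on the real line.\<close>

lemma slope_bound:
  fixes T :: "real \<Rightarrow> real"
  assumes T: "\<And>x. (T has_real_derivative T' x) (at x)" and L: "\<And>x. \<bar>T' x\<bar> \<le> L"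
  shows "\<bar>T b - T a\<bar> \<le> L * \<bar>b - a\<bar>"
  using field_differentiable_bound[of UNIV T T' L b a] assms by (simp add: mult.commute)

lemma test_fun_difference_quotient:
  fixes \<psi> :: "'a::euclidean_space \<Rightarrow> real"
  assumes \<psi>: "test_fun \<psi>"
  obtains C R where "0 \<le> C"
    "\<And>s x. 0 < s \<Longrightarrow> s \<le> 1 \<Longrightarrow> \<bar>(\<psi> (x - s *\<^sub>R h) - \<psi> x) / s\<bar> \<le> C * indicator (cball 0 R) x"
proof -
  obtain C1 R1 where 1: "0 \<le> C1" "\<And>x. \<bar>\<psi> x\<bar> \<le> C1 * indicator (cball 0 R1) x"
    using test_fun_bound(1)[OF \<psi>] by auto
  obtain C2 R2 where 2: "0 \<le> C2" "\<And>x. \<bar>frechet_derivative \<psi> (at x) h\<bar> \<le> C2 * indicator (cball 0 R2) x"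
    using test_fun_bound(2)[OF \<psi>, of h] by auto
  have 3: "\<bar>frechet_derivative \<psi> (at x) h\<bar> \<le> C2" for x
    using 2(1) order_trans[OF 2(2)[of x], of C2] by (auto simp: indicator_def)
  have "\<bar>(\<psi> (x - s *\<^sub>R h) - \<psi> x) / s\<bar> \<le> C2 * indicator (cball 0 (R1 + norm h)) x"
    if s: "0 < s" "s \<le> 1" for s x
  proof (cases "norm x \<le> R1 + norm h")
    case True
    obtain z where "\<psi> (x + s *\<^sub>R (- h)) - \<psi> (x + 0 *\<^sub>R (- h)) = (s - 0) * (- frechet_derivative \<psi> (at (x + z *\<^sub>R (- h))) h)"
      using MVT2[OF s(1), of "\<lambda>s. \<psi> (x + s *\<^sub>R (- h))", OF test_fun_line_derivative[OF \<psi>]] by blast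
    with s True show ?thesis using 3 by simp
  next
    case False
    have "norm (s *\<^sub>R h) \<le> norm h" using s by (simp add: mult_left_le_one_le)
    then have "\<not> norm (x - s *\<^sub>R h) \<le> R1" "\<not> norm x \<le> R1"
      using False norm_triangle_ineq[of "x - s *\<^sub>R h" "s *\<^sub>R h"] norm_ge_zero[of h]
      unfolding diff_add_cancel by linarith+
    then show ?thesis using 1(2)[of x] 1(2)[of "x - s *\<^sub>R h"] False by auto
  qed
  then show ?thesis using 2(1) that by blast
qed

text \<open>The difference quotient of \<open>T \<circ> v\<close> is that of \<open>v\<close>
  times a slope of \<open>T\<close>. The former converges in the mean on balls; along a subsequence
  \<open>v (x + t *\<^sub>R h)\<close> tends to \<open>v x\<close> almost everywhere, so the
  slopes, which are bounded by \<open>L\<close>, tend to \<open>T' (v x)\<close>. Shifting the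
  difference quotient onto the test function identifies the limit as a weak derivative.\<close>

lemma wgrad_chain_C1:
  fixes v :: "'a::euclidean_space \<Rightarrow> real"
  assumes wg: "wgrad v G"
    and T: "\<And>x. (T has_real_derivative T' x) (at x)" and T': "continuous_on UNIV T'"
    and L: "\<And>x. \<bar>T' x\<bar> \<le> L"
  shows "wgrad (\<lambda>x. T (v x)) (\<lambda>x. T' (v x) *\<^sub>R G x)"
proof -
  have v: "locint v" and G: "locint G" using wg by (auto simp: wgrad_def)
  have "0 \<le> L" using L[of 0] by simp
  have [measurable]: "T \<in> borel_measurable borel" "T' \<in> borel_measurable borel"
    using T' DERIV_isCont[OF T] by (auto intro!: borel_measurable_continuous_onI continuous_at_imp_continuous_on)
  note [measurable] = locint_measurable[OF v] locint_measurable[OF G]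
  have [measurable]: "cball (0::'a) r \<in> sets borel" for r :: real by simp
  have "locint (\<lambda>x. norm (v x))"
    by (rule locint_bound[OF v]) auto
  from locint_add[OF locint_const locint_cmult[OF this], of "\<bar>T 0\<bar>" L]
  have Tv: "locint (\<lambda>x. T (v x))"
  proof (rule locint_bound)
    show "norm (T (v x)) \<le> norm (\<bar>T 0\<bar> + L * norm (v x))" for x
      using slope_bound[OF T L, of "v x" 0] \<open>0 \<le> L\<close> by simp
  qed measurable
  have TG: "locint (\<lambda>x. T' (v x) *\<^sub>R G x)"
  proof -
    have "integrable lborel (\<lambda>x. indicator (cball 0 R) x *\<^sub>R (T' (v x) *\<^sub>R G x))" for R
    proof (rule Bochner_Integration.integrable_bound)
      show "integrable lborel (\<lambda>x. L *\<^sub>R (indicator (cball 0 R) x *\<^sub>R G x))"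
        using G unfolding locint_def by (intro integrable_scaleR_right) auto
    qed (use L \<open>0 \<le> L\<close> in \<open>auto simp: indicator_def intro!: mult_right_mono\<close>)
    then show ?thesis by (simp add: locint_def)
  qed
  have "(LBINT x. T (v x) * frechet_derivative \<psi> (at x) h) = - (LBINT x. (T' (v x) *\<^sub>R G x \<bullet> h) * \<psi> x)"
    if \<psi>: "test_fun \<psi>" for \<psi> h
  proof -
    define k where "k x = G x \<bullet> h" for x
    have k: "locint k" unfolding k_def[abs_def] by (rule locint_inner[OF G])
    define \<eta> where "\<eta> x = frechet_derivative \<psi> (at x) h" for x
    have cont: "continuous_on UNIV \<psi>" "continuous_on UNIV \<eta>"
      using test_fun_continuous[OF \<psi>] by (auto simp: \<eta>_def[abs_def])
    then have [measurable]: "\<psi> \<in> borel_measurable borel" "\<eta> \<in> borel_measurable borel"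
      by (auto intro: borel_measurable_continuous_onI)
    obtain C R where \<psi>_bd: "0 \<le> C" "\<And>x. \<bar>\<psi> x\<bar> \<le> C * indicator (cball 0 R) x"
      using test_fun_bound(1)[OF \<psi>] by auto
    have \<psi>_le: "\<bar>\<psi> x\<bar> \<le> C" for x
      using \<psi>_bd(1) order_trans[OF \<psi>_bd(2)[of x], of C] by (auto simp: indicator_def)
    have \<psi>_out: "\<psi> x = 0" if "x \<notin> cball 0 R" for x
      using \<psi>_bd(2)[of x] that by simp
    define t where "t n = inverse (real (Suc n))" for n
    have t: "t \<longlonglongrightarrow> 0" "t n > 0" "t n \<le> 1" for n
      using LIMSEQ_inverse_real_of_nat by (auto simp: t_def[abs_def] inverse_le_1_iff)
    define F where "F n x = (v (x + t n *\<^sub>R h) - v x) / t n - k x" for n x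
    have F_loc: "locint (F n)" for n
      using locint_diff[OF locint_cmult[OF locint_diff[OF locint_translate[OF v, of "t n *\<^sub>R h"] v], of "inverse (t n)"] k]
      by (simp add: F_def[abs_def] divide_inverse mult.commute)
    note [measurable] = locint_measurable[OF k] locint_measurable[OF F_loc]
    define f where "f n x = indicat_real (cball 0 R) x *\<^sub>R F n x" for n x
    have f_int: "integrable lborel (f n)" for n
      using F_loc[of n] by (simp add: locint_def f_def[abs_def])
    have "(\<lambda>n. ennreal (LBINT x. norm (f n x))) \<longlonglongrightarrow> ennreal 0"
    proof -
      have "ennreal (LBINT x. norm (f n x)) = (\<integral>\<^sup>+x. ennreal (norm (f n x)) \<partial>lborel)" for n
        using f_int[of n] by (subst nn_integral_eq_integral) auto
      also have "\<dots> n = (\<integral>\<^sup>+x\<in>cball 0 R. ennreal \<bar>(v (x + t n *\<^sub>R h) - v x) / t n - G x \<bullet> h\<bar> \<partial>lborel)" for n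
        by (intro nn_integral_cong) (auto simp: f_def F_def k_def indicator_def)
      finally show ?thesis
        using wgrad_difference_quotient_L1[OF wg t(1,2), where R = R and h = h] by simp
    qed
    then have f_lim: "(\<lambda>n. LBINT x. norm (f n x)) \<longlonglongrightarrow> 0"
      by (subst (asm) tendsto_ennreal_iff) auto
    from tendsto_L1_AE_subseq[of lborel f, OF f_int this]
    obtain r :: "nat \<Rightarrow> nat" where r: "strict_mono r" and ae: "AE x in lborel. (\<lambda>n. f (r n) x) \<longlonglongrightarrow> 0"
      by blast
    \<comment> \<open>The slope of \<open>T\<close> between the two values of \<open>v\<close>;
      where they agree, the derivative makes the factorisation below and the convergence of the
      slopes true without exception.\<close>
    define q where "q n x = (if v (x + t n *\<^sub>R h) = v x then T' (v x)
        else (T (v (x + t n *\<^sub>R h)) - T (v x)) / (v (x + t n *\<^sub>R h) - v x))" for n x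
    have [measurable]: "q n \<in> borel_measurable borel" for n
      unfolding q_def[abs_def] by measurable
    have q_le: "\<bar>q n x\<bar> \<le> L" for n x
      using L[of "v x"] slope_bound[OF T L, of "v (x + t n *\<^sub>R h)" "v x"]
      by (auto simp: q_def abs_divide divide_le_eq)
    have q_eq: "(T (v (x + t n *\<^sub>R h)) - T (v x)) / t n = q n x * (F n x + k x)" for n x
      using t(2)[of n] by (auto simp: q_def F_def)
    have q_lim: "(\<lambda>n. q (r n) x) \<longlonglongrightarrow> T' (v x)" if x: "x \<in> cball 0 R" "(\<lambda>n. f (r n) x) \<longlonglongrightarrow> 0" for x
    proof -
      have "(\<lambda>n. t (r n) * (f (r n) x + k x) + v x) \<longlonglongrightarrow> 0 * (0 + k x) + v x"
        by (intro tendsto_intros x(2) LIMSEQ_subseq_LIMSEQ[OF t(1) r, unfolded o_def])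
      moreover have "t (r n) * (f (r n) x + k x) + v x = v (x + t (r n) *\<^sub>R h)" for n
        using x(1) t(2)[of "r n"] by (simp add: f_def F_def)
      ultimately have "(\<lambda>n. v (x + t (r n) *\<^sub>R h)) \<longlonglongrightarrow> v x" by simp
      from slope_tendsto[OF T this] show ?thesis by (simp add: q_def)
    qed
    have \<psi>q: "\<bar>\<psi> x * q n x\<bar> \<le> (C * L) * indicator (cball 0 R) x" for n x
      using mult_mono[OF \<psi>_le[of x] q_le[of n x] \<psi>_bd(1)] \<psi>_out[of x]
      by (cases "x \<in> cball 0 R") (auto simp: abs_mult)
    have i_F: "integrable lborel (\<lambda>x. \<psi> x * q n x * F n x)" for n
      using locint_integrable_mult[OF F_loc _ \<psi>q] by simp
    have i_k: "integrable lborel (\<lambda>x. \<psi> x * q n x * k x)" for n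
      using locint_integrable_mult[OF k _ \<psi>q] by simp
    \<comment> \<open>The error of the difference quotient of \<open>v\<close>, weighted by bounded
      factors, vanishes in the mean.\<close>
    have lim_F: "(\<lambda>n. LBINT x. \<psi> x * q n x * F n x) \<longlonglongrightarrow> 0"
    proof (rule Lim_null_comparison)
      show "\<forall>\<^sub>F n in sequentially. norm (LBINT x. \<psi> x * q n x * F n x) \<le> (C * L) * (LBINT x. norm (f n x))"
      proof (intro always_eventually allI)
        fix n
        have "norm (LBINT x. \<psi> x * q n x * F n x) \<le> (LBINT x. norm (\<psi> x * q n x * F n x))"
          by (rule integral_norm_bound)
        also have "\<dots> \<le> (LBINT x. (C * L) * norm (f n x))"
        proof (rule integral_mono)
          fix x
          have "\<bar>\<psi> x\<bar> * \<bar>q n x\<bar> * \<bar>F n x\<bar> \<le> (C * L) * \<bar>F n x\<bar>"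
            by (intro mult_right_mono mult_mono \<psi>_le q_le \<psi>_bd) auto
          then show "norm (\<psi> x * q n x * F n x) \<le> (C * L) * norm (f n x)"
            using \<psi>_out[of x] \<psi>_bd(1) \<open>0 \<le> L\<close> by (cases "x \<in> cball 0 R") (auto simp: f_def abs_mult)
        qed (use i_F f_int in auto)
        finally show "norm (LBINT x. \<psi> x * q n x * F n x) \<le> (C * L) * (LBINT x. norm (f n x))"
          by simp
      qed
      show "(\<lambda>n. (C * L) * (LBINT x. norm (f n x))) \<longlonglongrightarrow> 0"
        using tendsto_mult[OF tendsto_const f_lim] by simp
    qed
    have lim_k: "(\<lambda>n. LBINT x. \<psi> x * q (r n) x * k x) \<longlonglongrightarrow> (LBINT x. \<psi> x * T' (v x) * k x)"
    proof (rule integral_dominated_convergence)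
      show "integrable lborel (\<lambda>x. (C * L) * norm (indicator (cball 0 R) x *\<^sub>R k x))"
        using k unfolding locint_def by (intro integrable_mult_right integrable_norm) auto
      show "AE x in lborel. (\<lambda>n. \<psi> x * q (r n) x * k x) \<longlonglongrightarrow> \<psi> x * T' (v x) * k x"
        using ae
      proof eventually_elim
        fix x assume "(\<lambda>n. f (r n) x) \<longlonglongrightarrow> 0"
        then show "(\<lambda>n. \<psi> x * q (r n) x * k x) \<longlonglongrightarrow> \<psi> x * T' (v x) * k x"
          using \<psi>_out[of x] by (cases "x \<in> cball 0 R") (auto intro!: tendsto_intros q_lim)
      qed
      show "AE x in lborel. norm (\<psi> x * q (r n) x * k x) \<le> (C * L) * norm (indicator (cball 0 R) x *\<^sub>R k x)" for n
      proof (intro AE_I2)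
        fix x
        have "\<bar>\<psi> x\<bar> * \<bar>q (r n) x\<bar> * \<bar>k x\<bar> \<le> (C * L) * \<bar>k x\<bar>"
          by (intro mult_right_mono mult_mono \<psi>_le q_le \<psi>_bd) auto
        then show "norm (\<psi> x * q (r n) x * k x) \<le> (C * L) * norm (indicator (cball 0 R) x *\<^sub>R k x)"
          using \<psi>_out[of x] by (cases "x \<in> cball 0 R") (auto simp: abs_mult)
      qed
    qed measurable
    have eq: "(LBINT x. T (v x) * ((\<psi> (x - t n *\<^sub>R h) - \<psi> x) / t n))
        = (LBINT x. \<psi> x * q n x * F n x) + (LBINT x. \<psi> x * q n x * k x)" for n
    proof -
      obtain C1 R1 where \<psi>h_bd: "\<And>x. \<bar>\<psi> (x - t n *\<^sub>R h)\<bar> \<le> C1 * indicator (cball 0 R1) x"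
        using test_fun_bound(1)[OF test_fun_translate[OF \<psi>, of "t n *\<^sub>R h"]] by auto
      have i: "integrable lborel (\<lambda>x. T (v x) * \<psi> (x - t n *\<^sub>R h))" "integrable lborel (\<lambda>x. T (v x) * \<psi> x)"
        "integrable lborel (\<lambda>x. T (v (x + t n *\<^sub>R h)) * \<psi> x)"
        using locint_integrable_mult[OF Tv _ \<psi>h_bd] locint_integrable_mult[OF Tv _ \<psi>_bd(2)]
          locint_integrable_mult[OF locint_translate[OF Tv, of "t n *\<^sub>R h"] _ \<psi>_bd(2)]
        by (auto simp: mult.commute)
      have "(LBINT x. T (v x) * ((\<psi> (x - t n *\<^sub>R h) - \<psi> x) / t n))
        = ((LBINT x. T (v x) * \<psi> (x - t n *\<^sub>R h)) - (LBINT x. T (v x) * \<psi> x)) / t n"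
        using i by (simp add: right_diff_distrib diff_divide_distrib)
      also have "(LBINT x. T (v x) * \<psi> (x - t n *\<^sub>R h)) = (LBINT x. T (v (x + t n *\<^sub>R h)) * \<psi> x)"
        using integral_translate[of "\<lambda>x. T (v x) * \<psi> (x - t n *\<^sub>R h)" "t n *\<^sub>R h"] by simp
      also have "((LBINT x. T (v (x + t n *\<^sub>R h)) * \<psi> x) - (LBINT x. T (v x) * \<psi> x)) / t n
          = (LBINT x. (T (v (x + t n *\<^sub>R h)) - T (v x)) / t n * \<psi> x)"
        using i by (simp add: left_diff_distrib diff_divide_distrib)
      also have "\<dots> = (LBINT x. \<psi> x * q n x * F n x + \<psi> x * q n x * k x)"
        unfolding q_eq by (simp add: algebra_simps)
      finally show ?thesis using i_F i_k by simp
    qed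
    have lim1: "(\<lambda>n. LBINT x. T (v x) * ((\<psi> (x - t (r n) *\<^sub>R h) - \<psi> x) / t (r n)))
        \<longlonglongrightarrow> 0 + (LBINT x. \<psi> x * T' (v x) * k x)"
      unfolding eq by (intro tendsto_add lim_k LIMSEQ_subseq_LIMSEQ[OF lim_F r, unfolded o_def])
    \<comment> \<open>The same integrals with the difference quotient on the test function.\<close>
    have lim2: "(\<lambda>n. LBINT x. T (v x) * ((\<psi> (x - t (r n) *\<^sub>R h) - \<psi> x) / t (r n)))
        \<longlonglongrightarrow> (LBINT x. T (v x) * - \<eta> x)"
    proof -
      obtain C' R' where \<eta>_bd: "0 \<le> C'"
        "\<And>s x. 0 < s \<Longrightarrow> s \<le> 1 \<Longrightarrow> \<bar>(\<psi> (x - s *\<^sub>R h) - \<psi> x) / s\<bar> \<le> C' * indicator (cball 0 R') x"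
        using test_fun_difference_quotient[OF \<psi>] by blast
      show ?thesis
      proof (rule integral_dominated_convergence)
        show "integrable lborel (\<lambda>x. C' * norm (indicator (cball 0 R') x *\<^sub>R T (v x)))"
          using Tv unfolding locint_def by (intro integrable_mult_right integrable_norm) auto
        show "AE x in lborel. (\<lambda>n. T (v x) * ((\<psi> (x - t (r n) *\<^sub>R h) - \<psi> x) / t (r n))) \<longlonglongrightarrow> T (v x) * - \<eta> x"
        proof (intro AE_I2 tendsto_mult tendsto_const)
          fix x
          have "(\<lambda>n. if t (r n) = 0 then - \<eta> x else (\<psi> (x + t (r n) *\<^sub>R (- h)) - \<psi> (x + 0 *\<^sub>R (- h))) / (t (r n) - 0)) \<longlonglongrightarrow> - \<eta> x"
            using test_fun_line_derivative[OF \<psi>, of x h 0] LIMSEQ_subseq_LIMSEQ[OF t(1) r, unfolded o_def]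
            by (intro slope_tendsto) (auto simp: \<eta>_def)
          moreover have "t n \<noteq> 0" for n using t(2)[of n] by simp
          ultimately show "(\<lambda>n. (\<psi> (x - t (r n) *\<^sub>R h) - \<psi> x) / t (r n)) \<longlonglongrightarrow> - \<eta> x"
            by simp
        qed
        show "AE x in lborel. norm (T (v x) * ((\<psi> (x - t (r n) *\<^sub>R h) - \<psi> x) / t (r n)))
            \<le> C' * norm (indicator (cball 0 R') x *\<^sub>R T (v x))" for n
        proof (intro AE_I2)
          fix x
          from mult_left_mono[OF \<eta>_bd(2)[OF t(2,3), of x "r n"] abs_ge_zero[of "T (v x)"]]
          show "norm (T (v x) * ((\<psi> (x - t (r n) *\<^sub>R h) - \<psi> x) / t (r n)))
            \<le> C' * norm (indicator (cball 0 R') x *\<^sub>R T (v x))"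
            by (simp add: abs_mult mult_ac)
        qed
      qed measurable
    qed
    from LIMSEQ_unique[OF lim1 lim2]
    show ?thesis by (simp add: k_def \<eta>_def mult_ac)
  qed
  with Tv TG show ?thesis by (auto simp: wgrad_def)
qed

section \<open>Positive parts and truncation\<close>

text \<open>A continuously differentiable approximation of the positive part. It is rational on the
  positive axis, tends to \<open>max t 0\<close> as \<open>c\<close> tends to 0, and its
  derivative \<open>soft_step c\<close> increases to the indicator function of the positive axis,
  with value 0 at 0.\<close>

definition soft_pos :: "real \<Rightarrow> real \<Rightarrow> real" where
  "soft_pos c t = (max t 0)\<^sup>2 / (max t 0 + c)"

definition soft_step :: "real \<Rightarrow> real \<Rightarrow> real" where
  "soft_step c t = 1 - (c / (max t 0 + c))\<^sup>2"

lemma soft_pos_deriv: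
  assumes c: "c > 0"
  shows "(soft_pos c has_real_derivative soft_step c t) (at t)"
proof (cases t "0::real" rule: linorder_cases)
  case less
  have "((\<lambda>t. 0) has_real_derivative 0) (at t)" by simp
  then have "(soft_pos c has_real_derivative 0) (at t)"
    by (rule DERIV_cong_ev[THEN iffD1, rotated -1])
       (use less eventually_nhds_in_open[of "{..<0}" t] in
         \<open>auto simp: soft_pos_def elim!: eventually_mono\<close>)
  then show ?thesis using less c by (simp add: soft_step_def)
next
  case equal
  have "\<bar>soft_pos c t\<bar> \<le> inverse c * t\<^sup>2" for t
  proof -
    have "(max t 0)\<^sup>2 / (max t 0 + c) \<le> t\<^sup>2 / c"
      using c by (intro frac_le) (auto simp: max_def)
    then show ?thesis using c by (simp add: soft_pos_def divide_inverse mult.commute)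
  qed
  then have "(soft_pos c has_real_derivative 0) (at 0)"
    by (rule DERIV_zero_if_quadratic_bound)
  then show ?thesis using equal c by (simp add: soft_step_def)
next
  case greater
  have nz: "t + c \<noteq> 0" using greater c by simp
  then have eq: "1 - (c / (t + c))\<^sup>2 = (2 * t * (t + c) - t\<^sup>2) / (t + c)\<^sup>2"
    by (simp add: divide_simps) (simp add: algebra_simps power2_eq_square)
  have "((\<lambda>t. t\<^sup>2 / (t + c)) has_real_derivative (1 - (c / (t + c))\<^sup>2)) (at t)"
    unfolding eq using nz
    by (auto intro!: derivative_eq_intros simp: power2_eq_square)
  then have "(soft_pos c has_real_derivative (1 - (c / (t + c))\<^sup>2)) (at t)"
    by (rule DERIV_cong_ev[THEN iffD1, rotated -1])
       (use greater eventually_nhds_in_open[of "{0<..}" t] in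
         \<open>auto simp: soft_pos_def elim!: eventually_mono\<close>)
  then show ?thesis using greater by (simp add: soft_step_def)
qed

lemma soft_pos_bounds:
  assumes c: "c > 0"
  shows "\<bar>soft_pos c t\<bar> \<le> \<bar>t\<bar>" "\<bar>soft_step c t\<bar> \<le> 1"
proof -
  have "(max t 0)\<^sup>2 / (max t 0 + c) \<le> max t 0"
    using c by (simp add: divide_le_eq power2_eq_square max_def)
  moreover have "0 \<le> (max t 0)\<^sup>2 / (max t 0 + c)" using c by simp
  ultimately show "\<bar>soft_pos c t\<bar> \<le> \<bar>t\<bar>" unfolding soft_pos_def by linarith
  have "0 \<le> c / (max t 0 + c)" "c / (max t 0 + c) \<le> 1"
    using c by (auto simp: divide_le_eq)
  then have "(c / (max t 0 + c))\<^sup>2 \<le> 1" by (simp add: power_le_one)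
  moreover have "0 \<le> (c / (max t 0 + c))\<^sup>2" by simp
  ultimately show "\<bar>soft_step c t\<bar> \<le> 1" unfolding soft_step_def by linarith
qed

lemma soft_pos_tendsto:
  assumes c: "c \<longlonglongrightarrow> 0" "\<And>n::nat. c n > 0"
  shows "(\<lambda>n. soft_pos (c n) t) \<longlonglongrightarrow> max t 0"
    and "(\<lambda>n. soft_step (c n) t) \<longlonglongrightarrow> (if t > 0 then 1 else 0)"
proof -
  show "(\<lambda>n. soft_pos (c n) t) \<longlonglongrightarrow> max t 0"
  proof (cases "t > 0")
    case True
    have "(\<lambda>n. (max t 0)\<^sup>2 / (max t 0 + c n)) \<longlonglongrightarrow> (max t 0)\<^sup>2 / (max t 0 + 0)"
      using True by (intro tendsto_intros c(1)) auto
    then show ?thesis using True by (simp add: soft_pos_def power2_eq_square)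
  qed (simp add: soft_pos_def)
  show "(\<lambda>n. soft_step (c n) t) \<longlonglongrightarrow> (if t > 0 then 1 else 0)"
  proof (cases "t > 0")
    case True
    have "(\<lambda>n. 1 - (c n / (max t 0 + c n))\<^sup>2) \<longlonglongrightarrow> 1 - (0 / (max t 0 + 0))\<^sup>2"
      using True by (intro tendsto_intros c(1)) auto
    then show ?thesis using True by (simp add: soft_step_def)
  next
    case False
    have "soft_step (c n) t = 0" for n using c(2)[of n] False by (simp add: soft_step_def)
    then show ?thesis using False by simp
  qed
qed

lemma integrable_locint_test:
  fixes f :: "'a::euclidean_space \<Rightarrow> real"
  assumes "locint f" "test_fun \<psi>"
  shows "integrable lborel (\<lambda>x. f x * \<psi> x)"
    "integrable lborel (\<lambda>x. f x * frechet_derivative \<psi> (at x) h)"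
proof -
  note [measurable] = test_fun_borel[OF assms(2)]
  obtain C R where "\<And>x. \<bar>\<psi> x\<bar> \<le> C * indicator (cball 0 R) x"
    using test_fun_bound(1)[OF assms(2)] by auto
  from locint_integrable_mult[OF assms(1) _ this]
  show "integrable lborel (\<lambda>x. f x * \<psi> x)" by (simp add: mult.commute)
  obtain C R where "\<And>x. \<bar>frechet_derivative \<psi> (at x) h\<bar> \<le> C * indicator (cball 0 R) x"
    using test_fun_bound(2)[OF assms(2), of h] by auto
  from locint_integrable_mult[OF assms(1) _ this]
  show "integrable lborel (\<lambda>x. f x * frechet_derivative \<psi> (at x) h)" by (simp add: mult.commute)
qed

text \<open>Passing to the limit in the chain rule for \<open>soft_pos c\<close>. As the
  derivatives \<open>soft_step c\<close> vanish at 0, the limit contains no contribution of the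
  level set \<open>v = 0\<close>.\<close>

lemma wgrad_pos_part:
  fixes v :: "'a::euclidean_space \<Rightarrow> real"
  assumes wg: "wgrad v G"
  shows "wgrad (\<lambda>x. max (v x) 0) (\<lambda>x. (if v x > 0 then 1 else 0) *\<^sub>R G x)"
proof -
  have v: "locint v" and G: "locint G" using wg by (auto simp: wgrad_def)
  note [measurable] = locint_measurable[OF v] locint_measurable[OF G]
  have v': "locint (\<lambda>x. max (v x) 0)" by (rule locint_bound[OF v]) auto
  have G': "locint (\<lambda>x. (if v x > 0 then 1 else 0) *\<^sub>R G x)" by (rule locint_bound[OF G]) auto
  define c where "c n = inverse (real (Suc n))" for n
  have c: "c \<longlonglongrightarrow> 0" "\<And>n. c n > 0"
    using LIMSEQ_inverse_real_of_nat by (auto simp: c_def[abs_def])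
  have "continuous_on UNIV (soft_step (c n))" for n
    unfolding soft_step_def[abs_def] using c(2)[of n]
    by (intro continuous_intros) (auto simp: add_nonneg_eq_0_iff)
  from wgrad_chain_C1[OF wg soft_pos_deriv[OF c(2)] this soft_pos_bounds(2)[OF c(2)]]
  have wgn: "wgrad (\<lambda>x. soft_pos (c n) (v x)) (\<lambda>x. soft_step (c n) (v x) *\<^sub>R G x)" for n .
  then have [measurable]: "(\<lambda>x. soft_pos (c n) (v x)) \<in> borel_measurable borel"
    "(\<lambda>x. soft_step (c n) (v x)) \<in> borel_measurable borel" for n
    by (auto simp: wgrad_def locint_def soft_step_def)
  have "(LBINT x. max (v x) 0 * frechet_derivative \<psi> (at x) h)
      = - (LBINT x. (((if v x > 0 then 1 else 0) *\<^sub>R G x) \<bullet> h) * \<psi> x)"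
    if \<psi>: "test_fun \<psi>" for \<psi> h
  proof -
    note [measurable] = test_fun_borel[OF \<psi>]
    have 1: "(\<lambda>n. LBINT x. soft_pos (c n) (v x) * frechet_derivative \<psi> (at x) h)
        \<longlonglongrightarrow> (LBINT x. max (v x) 0 * frechet_derivative \<psi> (at x) h)"
    proof (rule integral_dominated_convergence)
      show "integrable lborel (\<lambda>x. norm (v x * frechet_derivative \<psi> (at x) h))"
        by (intro integrable_norm integrable_locint_test v \<psi>)
    qed (auto simp: abs_mult intro!: mult_right_mono soft_pos_bounds c(2) tendsto_intros soft_pos_tendsto[OF c])
    have 2: "(\<lambda>n. LBINT x. ((soft_step (c n) (v x) *\<^sub>R G x) \<bullet> h) * \<psi> x)
        \<longlonglongrightarrow> (LBINT x. (((if v x > 0 then 1 else 0) *\<^sub>R G x) \<bullet> h) * \<psi> x)"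
    proof (rule integral_dominated_convergence)
      show "integrable lborel (\<lambda>x. norm ((G x \<bullet> h) * \<psi> x))"
        by (intro integrable_norm integrable_locint_test locint_inner G \<psi>)
      show "AE x in lborel. (\<lambda>n. ((soft_step (c n) (v x) *\<^sub>R G x) \<bullet> h) * \<psi> x)
          \<longlonglongrightarrow> (((if v x > 0 then 1 else 0) *\<^sub>R G x) \<bullet> h) * \<psi> x"
        by (intro AE_I2 tendsto_intros soft_pos_tendsto(2)[OF c])
      show "AE x in lborel. norm (((soft_step (c n) (v x) *\<^sub>R G x) \<bullet> h) * \<psi> x) \<le> norm ((G x \<bullet> h) * \<psi> x)" for n
      proof (intro AE_I2)
        fix x
        show "norm (((soft_step (c n) (v x) *\<^sub>R G x) \<bullet> h) * \<psi> x) \<le> norm ((G x \<bullet> h) * \<psi> x)"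
          using mult_right_mono[OF soft_pos_bounds(2)[OF c(2)[of n], of "v x"], of "norm ((G x \<bullet> h) * \<psi> x)"]
          by (simp add: abs_mult mult.assoc)
      qed
    qed measurable
    have "(LBINT x. soft_pos (c n) (v x) * frechet_derivative \<psi> (at x) h)
        = - (LBINT x. ((soft_step (c n) (v x) *\<^sub>R G x) \<bullet> h) * \<psi> x)" for n
      using wgn[of n] \<psi> by (simp add: wgrad_def)
    with LIMSEQ_unique[OF 1] tendsto_minus[OF 2] show ?thesis by simp
  qed
  with v' G' show ?thesis by (simp add: wgrad_def)
qed

lemma wgrad_affine:
  assumes "wgrad v G"
  shows "wgrad (\<lambda>x. a + b * v x) (\<lambda>x. b *\<^sub>R G x)"
  by (rule wgrad_chain_C1[OF assms, where L = "\<bar>b\<bar>"]) (auto intro!: derivative_eq_intros)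

text \<open>Truncation at \<open>M\<close> is a second positive part:
  \<open>min w M = M - max (M - w) 0\<close>.\<close>

lemma wgrad_truncate:
  assumes wg: "wgrad v G"
  shows "wgrad (\<lambda>x. min (max (v x) 0) M) (\<lambda>x. (if 0 < v x \<and> v x < M then 1 else 0) *\<^sub>R G x)"
proof -
  have "wgrad (\<lambda>x. M + - 1 * max (M + - 1 * max (v x) 0) 0)
     (\<lambda>x. - 1 *\<^sub>R ((if M + - 1 * max (v x) 0 > 0 then 1 else 0) *\<^sub>R (- 1 *\<^sub>R ((if v x > 0 then 1 else 0) *\<^sub>R G x))))"
    by (intro wgrad_affine wgrad_pos_part wg)
  moreover have "(\<lambda>x. M + - 1 * max (M + - 1 * max (v x) 0) 0) = (\<lambda>x. min (max (v x) 0) M)"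
    by (auto simp: min_def max_def)
  moreover have "(\<lambda>x. - 1 *\<^sub>R ((if M + - 1 * max (v x) 0 > 0 then 1 else 0) *\<^sub>R (- 1 *\<^sub>R ((if v x > 0 then 1 else 0) *\<^sub>R G x))))
      = (\<lambda>x. (if 0 < v x \<and> v x < M then 1 else 0) *\<^sub>R G x)"
    by (auto simp: fun_eq_iff)
  ultimately show ?thesis by simp
qed

section \<open>Uniqueness of gradients and vanishing gradients\<close>

lemma wgrad_cong_AE:
  assumes wg: "wgrad v G" and "AE x in lborel. v x = v' x" "AE x in lborel. G x = G' x"
    and [measurable]: "v' \<in> borel_measurable borel" "G' \<in> borel_measurable borel"
  shows "wgrad v' G'"
proof -
  have v: "locint v" and G: "locint G" using wg by (auto simp: wgrad_def)
  note [measurable] = locint_measurable[OF v] locint_measurable[OF G]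
  have [measurable]: "cball (0::'a) r \<in> sets borel" for r :: real by simp
  have "locint v'" unfolding locint_def
  proof (intro conjI allI)
    fix R
    have "integrable lborel (\<lambda>x. indicat_real (cball 0 R) x *\<^sub>R v x)" using v by (simp add: locint_def)
    then show "integrable lborel (\<lambda>x. indicat_real (cball 0 R) x *\<^sub>R v' x)"
      by (rule integrable_cong_AE_imp) (use assms(2) in auto)
  qed measurable
  moreover have "locint G'" unfolding locint_def
  proof (intro conjI allI)
    fix R
    have "integrable lborel (\<lambda>x. indicat_real (cball 0 R) x *\<^sub>R G x)" using G by (simp add: locint_def)
    then show "integrable lborel (\<lambda>x. indicat_real (cball 0 R) x *\<^sub>R G' x)"
      by (rule integrable_cong_AE_imp) (use assms(3) in auto)
  qed measurable
  moreover have "(LBINT x. v' x * frechet_derivative \<psi> (at x) h) = - (LBINT x. (G' x \<bullet> h) * \<psi> x)"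
    if \<psi>: "test_fun \<psi>" for \<psi> h
  proof -
    note [measurable] = test_fun_borel[OF \<psi>]
    have "(LBINT x. v' x * frechet_derivative \<psi> (at x) h) = (LBINT x. v x * frechet_derivative \<psi> (at x) h)"
      by (rule integral_cong_AE) (use assms(2) in auto)
    moreover have "(LBINT x. (G' x \<bullet> h) * \<psi> x) = (LBINT x. (G x \<bullet> h) * \<psi> x)"
      by (rule integral_cong_AE) (use assms(3) in auto)
    ultimately show ?thesis using wg \<psi> by (simp add: wgrad_def)
  qed
  ultimately show ?thesis by (simp add: wgrad_def)
qed

lemma wgrad_unique:
  fixes v :: "'a::euclidean_space \<Rightarrow> real"
  assumes "wgrad v G" "wgrad v G'"
  shows "AE x in lborel. G x = G' x"
proof -
  have G: "locint G" "locint G'" using assms by (auto simp: wgrad_def)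
  have "AE x in lborel. G x \<bullet> b - G' x \<bullet> b = 0" for b
  proof (rule fundamental_lemma)
    show "locint (\<lambda>x. G x \<bullet> b - G' x \<bullet> b)" by (intro locint_diff locint_inner G)
    show "(LBINT x. (G x \<bullet> b - G' x \<bullet> b) * \<psi> x) = 0" if "test_fun \<psi>" for \<psi>
    proof -
      have "(LBINT x. (G x \<bullet> b) * \<psi> x) = (LBINT x. (G' x \<bullet> b) * \<psi> x)"
        using assms that unfolding wgrad_def by (metis neg_equal_iff_equal)
      then show ?thesis
        using integrable_locint_test(1)[OF locint_inner[OF G(1)] that, of b]
          integrable_locint_test(1)[OF locint_inner[OF G(2)] that, of b]
        by (simp add: left_diff_distrib)
    qed
  qed
  then have "AE x in lborel. \<forall>b\<in>Basis. G x \<bullet> b - G' x \<bullet> b = 0"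
    by (intro AE_finite_allI) auto
  then show ?thesis by eventually_elim (auto intro: euclidean_eqI)
qed

text \<open>The Sobolev estimate behind local compactness: translations move a function in the mean
  by at most the length of the translation times the mean of the gradient.\<close>

lemma wgrad_translation_estimate:
  assumes wg: "wgrad v G"
  shows "(\<integral>\<^sup>+x\<in>cball 0 R. ennreal \<bar>v (x + h) - v x\<bar> \<partial>lborel)
    \<le> ennreal (norm h) * (\<integral>\<^sup>+x\<in>cball 0 (R + norm h). ennreal (norm (G x)) \<partial>lborel)"
proof -
  have G: "locint G" using wg by (auto simp: wgrad_def)
  have k: "locint (\<lambda>x. G x \<bullet> h)" by (rule locint_inner[OF G])
  note [measurable] = locint_measurable[OF G] locint_measurable[OF k]
  have [measurable]: "cball (0::'a) r \<in> sets borel" for r :: real by simp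
  have "(\<integral>\<^sup>+x\<in>cball 0 R. ennreal \<bar>v (x + h) - v x\<bar> \<partial>lborel)
      = (\<integral>\<^sup>+x\<in>cball 0 R. ennreal \<bar>seg (\<lambda>x. G x \<bullet> h) h x\<bar> \<partial>lborel)"
    using wgrad_increment[OF wg, of h] by (intro nn_integral_cong_AE) auto
  also have "\<dots> \<le> (\<integral>\<^sup>+x\<in>cball 0 (R + norm h). ennreal \<bar>G x \<bullet> h\<bar> \<partial>lborel)"
    by (rule seg_L1_bound) measurable
  also have "\<dots> \<le> (\<integral>\<^sup>+x. ennreal (norm h) * (ennreal (norm (G x)) * indicator (cball 0 (R + norm h)) x) \<partial>lborel)"
  proof (rule nn_integral_mono)
    fix x
    have "ennreal \<bar>G x \<bullet> h\<bar> \<le> ennreal (norm h) * ennreal (norm (G x))"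
      using Cauchy_Schwarz_ineq2[of "G x" h]
      by (simp add: ennreal_mult[symmetric] mult.commute ennreal_leI)
    then show "ennreal \<bar>G x \<bullet> h\<bar> * indicator (cball 0 (R + norm h)) x
        \<le> ennreal (norm h) * (ennreal (norm (G x)) * indicator (cball 0 (R + norm h)) x)"
      by (auto simp: indicator_def)
  qed
  also have "\<dots> = ennreal (norm h) * (\<integral>\<^sup>+x\<in>cball 0 (R + norm h). ennreal (norm (G x)) \<partial>lborel)"
    by (rule nn_integral_cmult) measurable
  finally show ?thesis .
qed

lemma AE_zero_if_null_on_cballs:
  fixes f :: "'a::euclidean_space \<Rightarrow> ennreal"
  assumes [measurable]: "f \<in> borel_measurable borel"
    and 0: "\<And>R. (\<integral>\<^sup>+x\<in>cball 0 R. f x \<partial>lborel) = 0"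
  shows "AE x in lborel. f x = 0"
proof -
  have [measurable]: "cball (0::'a) r \<in> sets borel" for r :: real by simp
  have "AE x in lborel. f x * indicator (cball 0 (real n)) x = 0" for n :: nat
    using 0[of "real n"] by (subst (asm) nn_integral_0_iff_AE) auto
  then have "AE x in lborel. \<forall>n. f x * indicator (cball 0 (real n)) x = 0"
    by (subst AE_all_countable) blast
  then show ?thesis
  proof eventually_elim
    fix x assume *: "\<forall>n. f x * indicator (cball 0 (real n)) x = 0"
    obtain n where "norm x \<le> real n" using real_arch_simple by blast
    then show "f x = 0" using *[rule_format, of n] by simp
  qed
qed

text \<open>A function with vanishing gradient is invariant under all translations by the
  translation estimate, and so is the integral of its \<open>p\<close>-th power over balls.
  Translating a ball to infinity makes that integral small, because the \<open>p\<close>-th power is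
  integrable on the whole space.\<close>

lemma wgrad_zero_imp_zero:
  fixes w :: "'a::euclidean_space \<Rightarrow> real"
  assumes wg: "wgrad w G" and G0: "AE x in lborel. G x = 0"
    and fin: "integrable lborel (\<lambda>x. \<bar>w x\<bar> powr p)"
  shows "AE x in lborel. w x = 0"
proof -
  have w: "locint w" "locint G" using wg by (auto simp: wgrad_def)
  note [measurable] = locint_measurable[OF w(1)] locint_measurable[OF w(2)]
  have [measurable]: "cball (0::'a) r \<in> sets borel" for r :: real by simp
  have shift: "AE x in lborel. w (x + h) = w x" for h
  proof -
    have "(\<integral>\<^sup>+x\<in>cball 0 R. ennreal (norm (G x)) \<partial>lborel) = 0" for R
      using G0 by (subst nn_integral_0_iff_AE) auto
    then have "(\<integral>\<^sup>+x\<in>cball 0 R. ennreal \<bar>w (x + h) - w x\<bar> \<partial>lborel) = 0" for R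
      using wgrad_translation_estimate[OF wg, where R = R and h = h] by simp
    then have "AE x in lborel. ennreal \<bar>w (x + h) - w x\<bar> = 0"
      by (intro AE_zero_if_null_on_cballs) auto
    then show ?thesis by eventually_elim simp
  qed
  define f where "f x = ennreal (\<bar>w x\<bar> powr p)" for x
  have [measurable]: "f \<in> borel_measurable borel" unfolding f_def[abs_def] by measurable
  have f_fin: "(\<integral>\<^sup>+x. f x \<partial>lborel) < \<infinity>"
    using fin unfolding integrable_iff_bounded f_def by simp
  obtain e :: 'a where e: "e \<in> Basis" using nonempty_Basis by blast
  have "(\<integral>\<^sup>+x\<in>cball 0 R. f x \<partial>lborel) = 0" for R
  proof -
    have eq: "(\<integral>\<^sup>+x. f x * indicator (cball 0 R) (x - real n *\<^sub>R e) \<partial>lborel) = (\<integral>\<^sup>+x\<in>cball 0 R. f x \<partial>lborel)" for n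
    proof -
      have "(\<integral>\<^sup>+x. f x * indicator (cball 0 R) (x - real n *\<^sub>R e) \<partial>lborel)
          = (\<integral>\<^sup>+x. f (x + real n *\<^sub>R e) * indicator (cball 0 R) x \<partial>lborel)"
        using nn_integral_translate[of "\<lambda>x. f x * indicator (cball 0 R) (x - real n *\<^sub>R e)" "real n *\<^sub>R e"]
        by simp
      also have "\<dots> = (\<integral>\<^sup>+x\<in>cball 0 R. f x \<partial>lborel)"
        using shift[of "real n *\<^sub>R e"] by (intro nn_integral_cong_AE) (auto simp: f_def)
      finally show ?thesis .
    qed
    have "(\<lambda>n. \<integral>\<^sup>+x. f x * indicator (cball 0 R) (x - real n *\<^sub>R e) \<partial>lborel) \<longlonglongrightarrow> (\<integral>\<^sup>+(x::'a). 0 \<partial>lborel)"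
    proof (rule nn_integral_dominated_convergence[OF _ _ _ _ f_fin])
      show "AE x in lborel. (\<lambda>n. f x * indicator (cball 0 R) (x - real n *\<^sub>R e)) \<longlonglongrightarrow> 0"
      proof (intro AE_I2 tendsto_eventually)
        fix x :: 'a
        obtain N :: nat where N: "norm x + R < real N" using reals_Archimedean2 by blast
        show "\<forall>\<^sub>F n in sequentially. f x * indicator (cball 0 R) (x - real n *\<^sub>R e) = 0"
          using eventually_ge_at_top[of N]
        proof eventually_elim
          fix n assume "n \<ge> N"
          then have "norm x + R < norm (real n *\<^sub>R e)" using N e by simp
          then have "x - real n *\<^sub>R e \<notin> cball 0 R"
            using norm_triangle_ineq2[of "real n *\<^sub>R e" x] by (simp add: norm_minus_commute)
          then show "f x * indicator (cball 0 R) (x - real n *\<^sub>R e) = 0" by simp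
        qed
      qed
      show "AE x in lborel. f x * indicator (cball 0 R) (x - real n *\<^sub>R e) \<le> f x" for n
        by (auto simp: indicator_def)
    qed measurable
    then show ?thesis unfolding eq by (simp add: LIMSEQ_const_iff)
  qed
  then have "AE x in lborel. f x = 0" by (intro AE_zero_if_null_on_cballs) auto
  then show ?thesis by eventually_elim (auto simp: f_def)
qed

section \<open>Local compactness\<close>

definition ball_avg :: "real \<Rightarrow> ('a::euclidean_space \<Rightarrow> real) \<Rightarrow> 'a \<Rightarrow> real" where
  "ball_avg r v x = (LBINT z. indicator (ball 0 r) z * v (x + z)) / measure lborel (ball (0::'a) r)"

lemma ball_avg_measurable [measurable]:
  fixes v :: "'a::euclidean_space \<Rightarrow> real"
  assumes [measurable]: "v \<in> borel_measurable borel"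
  shows "ball_avg r v \<in> borel_measurable borel"
proof -
  have [measurable]: "ball (0::'a) r \<in> sets borel" by simp
  show ?thesis unfolding ball_avg_def[abs_def] by measurable
qed

lemma integrable_indicator_ball: "integrable lborel (indicat_real (ball (x::'a::euclidean_space) r))"
  using emeasure_bounded_finite[OF bounded_ball, of x r] by auto

lemma integrable_ball_bounded:
  fixes v :: "'a::euclidean_space \<Rightarrow> real"
  assumes [measurable]: "v \<in> borel_measurable borel" and M: "\<And>x. \<bar>v x\<bar> \<le> M"
  shows "integrable lborel (\<lambda>z. indicator (ball y r) z * v (x + z))"
proof (rule Bochner_Integration.integrable_bound)
  show "integrable lborel (\<lambda>z. M * indicat_real (ball y r) z)"
    by (intro integrable_mult_right integrable_indicator_ball)
qed (use order_trans[OF M abs_ge_self] in \<open>auto simp: indicator_def\<close>)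

lemma ball_avg_bound:
  fixes v :: "'a::euclidean_space \<Rightarrow> real"
  assumes [measurable]: "v \<in> borel_measurable borel" and M: "\<And>x. \<bar>v x\<bar> \<le> M" and r: "r > 0"
  shows "\<bar>ball_avg r v x\<bar> \<le> M"
proof -
  have b: "measure lborel (ball (0::'a) r) > 0" using r by (simp add: content_ball_pos)
  have "\<bar>LBINT z. indicator (ball 0 r) z * v (x + z)\<bar> \<le> (LBINT z. \<bar>indicator (ball 0 r) z * v (x + z)\<bar>)"
    by (rule integral_abs_bound)
  also have "\<dots> \<le> (LBINT z. M * indicat_real (ball (0::'a) r) z)"
    using integrable_ball_bounded[OF assms(1) M, of 0 r x] M
    by (intro integral_mono integrable_mult_right integrable_indicator_ball integrable_abs)
       (auto simp: indicator_def)
  also have "\<dots> = M * measure lborel (ball (0::'a) r)" by simp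
  finally show ?thesis using b by (simp add: ball_avg_def abs_divide divide_le_eq)
qed

text \<open>Moving the centre moves the indicator function of the ball continuously in the mean, and
  \<open>v\<close> is bounded by \<open>M\<close>; hence the modulus of continuity is the same for
  all such \<open>v\<close>.\<close>

lemma ball_avg_equicontinuous:
  fixes M :: real
  assumes r: "r > 0" and "e > 0"
  shows "\<exists>d>0. \<forall>v (x::'a::euclidean_space) x'. v \<in> borel_measurable borel \<longrightarrow> (\<forall>x. \<bar>v x\<bar> \<le> M) \<longrightarrow>
    dist x x' < d \<longrightarrow> \<bar>ball_avg r v x - ball_avg r v x'\<bar> \<le> e"
proof -
  define b where "b = measure lborel (ball (0::'a) r)"
  have b: "b > 0" using r by (simp add: b_def content_ball_pos)
  have [measurable]: "ball (0::'a) r \<in> sets borel" by simp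
  define e' where "e' = e * b / (\<bar>M\<bar> + 1)"
  have "e' > 0" using b \<open>e > 0\<close> by (simp add: e'_def)
  have "isCont (\<lambda>h::'a. LBINT x. norm (indicat_real (ball 0 r) (x + h) - indicat_real (ball 0 r) x)) 0"
    by (rule L1_translation_isCont[OF integrable_indicator_ball])
  then obtain d where d: "d > 0"
    "\<And>h::'a. norm h < d \<Longrightarrow> \<bar>LBINT x. norm (indicat_real (ball 0 r) (x + h) - indicat_real (ball 0 r) x)\<bar> < e'"
    using \<open>e' > 0\<close> unfolding continuous_at_eps_delta by (auto simp: dist_norm)
  have "\<bar>ball_avg r v x - ball_avg r v x'\<bar> \<le> e"
    if [measurable]: "v \<in> borel_measurable borel" and M: "\<forall>x. \<bar>v x\<bar> \<le> M" and xx: "dist x x' < d"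
    for v and x x' :: 'a
  proof -
    define D where "D y = indicat_real (ball 0 r) (y - x) - indicat_real (ball 0 r) (y - x')" for y
    have iD: "integrable lborel D"
      unfolding D_def[abs_def] using integrable_translate[OF integrable_indicator_ball[of 0 r], of "-x"]
        integrable_translate[OF integrable_indicator_ball[of 0 r], of "-x'"] by simp
    have avg: "(LBINT z. indicat_real (ball 0 r) z * v (y + z)) = (LBINT z. indicat_real (ball 0 r) (z - y) * v z)" for y
    proof -
      have "(\<lambda>z. indicat_real (ball 0 r) (z - y) * v z) \<in> borel_measurable borel" by measurable
      from integral_translate[OF this, of y] show ?thesis by (simp add: add.commute)
    qed
    have i: "integrable lborel (\<lambda>z. indicat_real (ball 0 r) (z - y) * v z)" for y
      using integrable_ball_bounded[OF that(1), of M y r 0] M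
      by (simp add: indicator_def dist_norm norm_minus_commute)
    have "b * (ball_avg r v x - ball_avg r v x') = (LBINT y. D y * v y)"
      unfolding ball_avg_def b_def[symmetric] avg using b i
      by (simp add: right_diff_distrib left_diff_distrib D_def)
    also have "\<bar>\<dots>\<bar> \<le> (LBINT y. \<bar>D y * v y\<bar>)" by (rule integral_abs_bound)
    also have "\<dots> \<le> (LBINT y. M * \<bar>D y\<bar>)"
    proof (rule integral_mono)
      show "integrable lborel (\<lambda>y. \<bar>D y * v y\<bar>)"
        using i unfolding D_def by (simp add: left_diff_distrib)
      show "\<bar>D y * v y\<bar> \<le> M * \<bar>D y\<bar>" for y
        using mult_right_mono[OF M[rule_format, of y], of "\<bar>D y\<bar>"] by (simp add: abs_mult mult.commute)
    qed (use iD in auto)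
    also have "\<dots> = M * (LBINT y. \<bar>D y\<bar>)" by simp
    also have "(LBINT y. \<bar>D y\<bar>) = (LBINT y. norm (indicat_real (ball 0 r) (y + (x' - x)) - indicat_real (ball 0 r) y))"
      using integral_translate[of "\<lambda>y. \<bar>D y\<bar>" x'] iD by (simp add: D_def algebra_simps)
    also have "M * \<dots> \<le> (\<bar>M\<bar> + 1) * e'"
      using d(2)[of "x' - x"] xx by (intro mult_mono) (auto simp: dist_norm norm_minus_commute)
    also have "\<dots> = b * e" by (simp add: e'_def)
    finally have "b * \<bar>ball_avg r v x - ball_avg r v x'\<bar> \<le> b * e" using b by (simp add: abs_mult)
    then show ?thesis using b by simp
  qed
  then show ?thesis using d(1) by blast
qed

text \<open>The difference between a function and its average is an average of translation
  differences; Tonelli reduces the claim to the assumed estimate for a single translation.\<close>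

lemma ball_avg_close:
  fixes v :: "'a::euclidean_space \<Rightarrow> real"
  assumes [measurable]: "v \<in> borel_measurable borel" and M: "\<And>x. \<bar>v x\<bar> \<le> M" and r: "r > 0" and "0 \<le> K"
    and est: "\<And>h. norm h \<le> r \<Longrightarrow> (\<integral>\<^sup>+x\<in>cball 0 R. ennreal \<bar>v (x + h) - v x\<bar> \<partial>lborel) \<le> ennreal (r * K)"
  shows "(\<integral>\<^sup>+x\<in>cball 0 R. ennreal \<bar>v x - ball_avg r v x\<bar> \<partial>lborel) \<le> ennreal (r * K)"
proof -
  have [measurable]: "cball (0::'a) s \<in> sets borel" "ball (0::'a) s \<in> sets borel" for s :: real by simp_all
  define b where "b = measure lborel (ball (0::'a) r)"
  have b: "b > 0" using r by (simp add: b_def content_ball_pos)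
  have eb: "emeasure lborel (ball (0::'a) r) = ennreal b"
    unfolding b_def using emeasure_bounded_finite[OF bounded_ball, of "0::'a" r]
    by (intro emeasure_eq_ennreal_measure) auto
  have 1: "ennreal b * ennreal \<bar>v x - ball_avg r v x\<bar> \<le> (\<integral>\<^sup>+z. indicator (ball 0 r) z * ennreal \<bar>v (x + z) - v x\<bar> \<partial>lborel)" for x
  proof -
    have i: "integrable lborel (\<lambda>z. indicat_real (ball 0 r) z * v (x + z))"
      "integrable lborel (\<lambda>z::'a. indicat_real (ball 0 r) z * v x)"
      using integrable_ball_bounded[OF assms(1) M] integrable_indicator_ball[of "0::'a" r] by auto
    have "b * (ball_avg r v x - v x) = (LBINT z. indicator (ball 0 r) z * (v (x + z) - v x))"
      unfolding right_diff_distrib Bochner_Integration.integral_diff[OF i]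
      using b by (simp add: ball_avg_def b_def[symmetric])
    then have "ennreal b * ennreal \<bar>v x - ball_avg r v x\<bar> = ennreal (norm (LBINT z. indicator (ball 0 r) z * (v (x + z) - v x)))"
      using b by (simp add: ennreal_mult[symmetric] abs_mult abs_minus_commute flip: \<open>_ = integral\<^sup>L _ _\<close>)
    also have "\<dots> \<le> (\<integral>\<^sup>+z. ennreal (norm (indicator (ball 0 r) z * (v (x + z) - v x))) \<partial>lborel)"
      using i by (intro integral_norm_bound_ennreal) (simp add: right_diff_distrib)
    also have "\<dots> = (\<integral>\<^sup>+z. indicator (ball 0 r) z * ennreal \<bar>v (x + z) - v x\<bar> \<partial>lborel)"
      by (intro nn_integral_cong) (auto simp: indicator_def)
    finally show ?thesis .
  qed
  have "ennreal b * (\<integral>\<^sup>+x\<in>cball 0 R. ennreal \<bar>v x - ball_avg r v x\<bar> \<partial>lborel)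
      = (\<integral>\<^sup>+x\<in>cball 0 R. ennreal b * ennreal \<bar>v x - ball_avg r v x\<bar> \<partial>lborel)"
    by (subst nn_integral_cmult[symmetric]) (auto simp: mult.assoc)
  also have "\<dots> \<le> (\<integral>\<^sup>+x\<in>cball 0 R. (\<integral>\<^sup>+z. indicator (ball 0 r) z * ennreal \<bar>v (x + z) - v x\<bar> \<partial>lborel) \<partial>lborel)"
    by (intro nn_integral_mono mult_right_mono 1) auto
  also have "\<dots> = (\<integral>\<^sup>+x. (\<integral>\<^sup>+z. indicator (ball 0 r) z * (ennreal \<bar>v (x + z) - v x\<bar> * indicator (cball 0 R) x) \<partial>lborel) \<partial>lborel)"
    by (intro nn_integral_cong) (simp add: nn_integral_cmult[symmetric] mult_ac)
  also have "\<dots> = (\<integral>\<^sup>+z. (\<integral>\<^sup>+x. indicator (ball 0 r) z * (ennreal \<bar>v (x + z) - v x\<bar> * indicator (cball 0 R) x) \<partial>lborel) \<partial>lborel)"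
    by (rule lborel_pair.Fubini') measurable
  also have "\<dots> \<le> (\<integral>\<^sup>+z. indicator (ball (0::'a) r) z * ennreal (r * K) \<partial>lborel)"
  proof (rule nn_integral_mono)
    fix z :: 'a
    show "(\<integral>\<^sup>+x. indicator (ball 0 r) z * (ennreal \<bar>v (x + z) - v x\<bar> * indicator (cball 0 R) x) \<partial>lborel)
        \<le> indicator (ball (0::'a) r) z * ennreal (r * K)"
      using est[of z] by (cases "z \<in> ball 0 r") auto
  qed
  also have "\<dots> = ennreal b * ennreal (r * K)"
    by (subst nn_integral_multc) (auto simp: eb)
  finally show ?thesis
    using b by (simp add: ennreal_mult_le_mult_iff)
qed

text \<open>A diagonal sequence makes the averages converge for countably many radii and for centres
  in a countable dense set. Equicontinuity extends the convergence to all centres.\<close>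

lemma Rellich_averages:
  fixes u :: "nat \<Rightarrow> 'a::euclidean_space \<Rightarrow> real" and \<rho> :: "nat \<Rightarrow> real"
  assumes [measurable]: "\<And>n. u n \<in> borel_measurable borel" and M: "\<And>n x. \<bar>u n x\<bar> \<le> M"
    and \<rho>: "\<And>j. \<rho> j > 0"
  shows "\<exists>r. strict_mono (r :: nat \<Rightarrow> nat) \<and> (\<forall>j x. convergent (\<lambda>n. ball_avg (\<rho> j) (u (r n)) x))"
proof -
  obtain D :: "'a set" where D: "countable D" "\<And>X. open X \<Longrightarrow> X \<noteq> {} \<Longrightarrow> \<exists>d\<in>D. d \<in> X"
    using countable_dense_setE by blast
  have bd: "\<bar>ball_avg (\<rho> j) (u n) x\<bar> \<le> M" for n j x
    by (rule ball_avg_bound[OF assms(1) M \<rho>])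
  have "countable (D \<times> (UNIV :: nat set))" using D(1) by auto
  then obtain r :: "nat \<Rightarrow> nat" where r: "strict_mono r"
    and conv: "\<And>x. x \<in> D \<times> UNIV \<Longrightarrow> \<exists>l. (\<lambda>n. (\<lambda>n (x, j). ball_avg (\<rho> j) (u n) x) (r n) x) \<longlonglongrightarrow> l"
    by (rule function_convergent_subsequence[where M = M and f = "\<lambda>n (x, j). ball_avg (\<rho> j) (u n) x"])
       (use bd in auto)
  have "convergent (\<lambda>n. ball_avg (\<rho> j) (u (r n)) x)" for j x
    unfolding Cauchy_convergent_iff[symmetric]
  proof (rule metric_CauchyI)
    fix e :: real assume e: "e > 0"
    then have "e / 4 > 0" by simp
    then obtain d where d: "d > 0" "\<And>v x x'. v \<in> borel_measurable borel \<Longrightarrow> (\<forall>x. \<bar>v x\<bar> \<le> M) \<Longrightarrow>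
        dist (x::'a) x' < d \<Longrightarrow> \<bar>ball_avg (\<rho> j) v x - ball_avg (\<rho> j) v x'\<bar> \<le> e / 4"
      using ball_avg_equicontinuous[OF \<rho>[of j]] by blast
    obtain x' where x': "x' \<in> D" "dist x x' < d"
      using D(2)[of "ball x d"] d(1) by auto
    have "Cauchy (\<lambda>n. ball_avg (\<rho> j) (u (r n)) x')"
      using conv[of "(x', j)"] x'(1) by (auto intro: LIMSEQ_imp_Cauchy)
    from metric_CauchyD[OF this, of "e / 4"] e
    obtain N where N: "\<And>m n. m \<ge> N \<Longrightarrow> n \<ge> N \<Longrightarrow> \<bar>ball_avg (\<rho> j) (u (r m)) x' - ball_avg (\<rho> j) (u (r n)) x'\<bar> < e / 4"
      by (auto simp: dist_real_def)
    have "dist (ball_avg (\<rho> j) (u (r m)) x) (ball_avg (\<rho> j) (u (r n)) x) < e" if "m \<ge> N" "n \<ge> N" for m n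
    proof -
      have "\<bar>ball_avg (\<rho> j) (u (r i)) x - ball_avg (\<rho> j) (u (r i)) x'\<bar> \<le> e / 4" for i
        using M by (intro d(2) x'(2)) auto
      from N[OF that] this[of m] this[of n] e show ?thesis
        unfolding dist_real_def by linarith
    qed
    then show "\<exists>N. \<forall>m\<ge>N. \<forall>n\<ge>N. dist (ball_avg (\<rho> j) (u (r m)) x) (ball_avg (\<rho> j) (u (r n)) x) < e"
      by blast
  qed
  with r show ?thesis by blast
qed

text \<open>The Rellich compactness theorem for bounded functions, in the form of almost everywhere
  convergence. A translation estimate that is uniform in \<open>n\<close> makes all functions
  uniformly close to their averages over small balls, and the averages of a subsequence converge
  pointwise. To work on the whole space at once the functions are multiplied by a positive
  integrable weight: the weighted functions form a Cauchy sequence in the mean, so that a further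
  subsequence is Cauchy almost everywhere.\<close>

theorem Rellich:
  fixes u :: "nat \<Rightarrow> 'a::euclidean_space \<Rightarrow> real"
  assumes u[measurable]: "\<And>n. u n \<in> borel_measurable borel" and M: "\<And>n x. \<bar>u n x\<bar> \<le> M"
    and K: "\<And>R. 0 \<le> K R"
    and est: "\<And>n h R. norm h \<le> 1 \<Longrightarrow>
      (\<integral>\<^sup>+x\<in>cball 0 R. ennreal \<bar>u n (x + h) - u n x\<bar> \<partial>lborel) \<le> ennreal (norm h * K R)"
  shows "\<exists>r. strict_mono (r :: nat \<Rightarrow> nat) \<and> (AE x in lborel. convergent (\<lambda>n. u (r n) x))"
proof -
  have [measurable]: "cball (0::'a) s \<in> sets borel" for s :: real by simp
  have M0: "0 \<le> M" using M[of 0 0] by simp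
  define \<rho> where "\<rho> j = inverse (real (Suc j))" for j
  have \<rho>: "\<rho> j > 0" "\<rho> j \<le> 1" for j by (auto simp: \<rho>_def inverse_le_1_iff)
  obtain r :: "nat \<Rightarrow> nat" where r: "strict_mono r"
    and conv: "\<And>j x. convergent (\<lambda>n. ball_avg (\<rho> j) (u (r n)) x)"
    using Rellich_averages[of u M \<rho>, OF u M \<rho>(1)] by blast
  define U where "U n = u (r n)" for n
  have [measurable]: "U n \<in> borel_measurable borel" for n by (simp add: U_def)
  have MU: "\<bar>U n x\<bar> \<le> M" for n x by (simp add: U_def M)
  obtain w :: "'a \<Rightarrow> real" where w: "w \<in> borel_measurable lborel" "\<And>x. w x > 0" "\<And>x. w x \<le> 1" "integrable lborel w"
    using sigma_finite_measure.obtain_positive_integrable_function[OF sigma_finite_lborel] by blast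
  note [measurable] = w(1)
  have i_w: "integrable lborel (\<lambda>x. w x * f x)"
    if [measurable]: "f \<in> borel_measurable borel" and "\<And>x. \<bar>f x\<bar> \<le> C" for f C
  proof (rule Bochner_Integration.integrable_bound)
    show "integrable lborel (\<lambda>x. w x * C)" using w(4) by simp
    show "AE x in lborel. norm (w x * f x) \<le> norm (w x * C)"
      using order_trans[OF that(2) abs_ge_self]
      by (intro AE_I2) (auto simp: abs_mult intro!: mult_left_mono)
  qed measurable
  have A_bd: "\<bar>ball_avg (\<rho> j) (U n) x\<bar> \<le> M" for j n x
    by (rule ball_avg_bound[OF _ MU \<rho>(1)]) measurable
  have tail: "(\<lambda>R. LBINT x. w x * (1 - indicator (cball 0 (real R)) x)) \<longlonglongrightarrow> (\<integral>(x::'a). 0 \<partial>lborel)"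
  proof (rule integral_dominated_convergence[OF _ _ w(4)])
    show "AE x in lborel. (\<lambda>R. w x * (1 - indicator (cball 0 (real R)) x)) \<longlonglongrightarrow> 0"
    proof (intro AE_I2 tendsto_eventually)
      fix x :: 'a
      obtain N :: nat where N: "norm x \<le> real N" using real_arch_simple by blast
      show "\<forall>\<^sub>F R in sequentially. w x * (1 - indicator (cball 0 (real R)) x) = 0"
        using eventually_ge_at_top[of N] by eventually_elim (use N in auto)
    qed
    show "AE x in lborel. norm (w x * (1 - indicator (cball 0 (real R)) x)) \<le> w x" for R
      using w(2) by (auto simp: indicator_def less_imp_le)
  qed measurable
  have Cauchy: "\<exists>N. \<forall>i\<ge>N. \<forall>k\<ge>N. (LBINT x. norm (w x * U i x - w x * U k x)) < e" if "e > 0" for e :: real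
  proof -
    \<comment> \<open>The weight has small mass outside a large ball, where the functions are only
      known to be bounded; inside, averages over balls of radius \<open>\<rho> j\<close> are
      close.\<close>
    obtain R :: nat where R: "(LBINT x. w x * (1 - indicator (cball 0 (real R)) x)) < e / (8 * (M + 1))"
      using order_tendstoD(2)[OF tail, of "e / (8 * (M + 1))"] \<open>e > 0\<close> M0
      by (auto simp: eventually_sequentially)
    obtain j where j: "\<rho> j < e / (8 * (K (real R) + 1))"
      using reals_Archimedean[of "e / (8 * (K (real R) + 1))"] \<open>e > 0\<close> K[of "real R"]
      by (auto simp: \<rho>_def)
    define A where "A n = ball_avg (\<rho> j) (U n)" for n
    have [measurable]: "A n \<in> borel_measurable borel" for n unfolding A_def by measurable
    have Abd: "\<bar>A n x\<bar> \<le> M" for n x unfolding A_def by (rule A_bd)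
    have UA: "\<bar>U n x - A n x\<bar> \<le> 2 * M" for n x
      using MU[of n x] Abd[of n x] by linarith
    have near: "(LBINT x. w x * \<bar>U n x - A n x\<bar>) < 3 * e / 8" for n
    proof -
      have i: "integrable lborel (\<lambda>x. indicator (cball 0 (real R)) x * \<bar>U n x - A n x\<bar>)"
        and le: "(LBINT x. indicator (cball 0 (real R)) x * \<bar>U n x - A n x\<bar>) \<le> \<rho> j * K (real R)"
      proof -
        have "(\<integral>\<^sup>+x\<in>cball 0 (real R). ennreal \<bar>U n x - A n x\<bar> \<partial>lborel) \<le> ennreal (\<rho> j * K (real R))"
          unfolding A_def
        proof (rule ball_avg_close[OF _ MU \<rho>(1) K])
          fix h :: 'a assume h: "norm h \<le> \<rho> j"
          have "(\<integral>\<^sup>+x\<in>cball 0 (real R). ennreal \<bar>U n (x + h) - U n x\<bar> \<partial>lborel) \<le> ennreal (norm h * K (real R))"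
            unfolding U_def using h \<rho>(2)[of j] by (intro est) auto
          also have "\<dots> \<le> ennreal (\<rho> j * K (real R))"
            using h K by (intro ennreal_leI mult_right_mono) auto
          finally show "(\<integral>\<^sup>+x\<in>cball 0 (real R). ennreal \<bar>U n (x + h) - U n x\<bar> \<partial>lborel) \<le> ennreal (\<rho> j * K (real R))" .
        qed measurable
        also have "(\<integral>\<^sup>+x\<in>cball 0 (real R). ennreal \<bar>U n x - A n x\<bar> \<partial>lborel)
            = (\<integral>\<^sup>+x. ennreal (indicator (cball 0 (real R)) x * \<bar>U n x - A n x\<bar>) \<partial>lborel)"
          by (intro nn_integral_cong) (auto simp: indicator_def)
        finally have nn: "(\<integral>\<^sup>+x. ennreal (indicator (cball 0 (real R)) x * \<bar>U n x - A n x\<bar>) \<partial>lborel) \<le> ennreal (\<rho> j * K (real R))" .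
        then show i: "integrable lborel (\<lambda>x. indicator (cball 0 (real R)) x * \<bar>U n x - A n x\<bar>)"
          by (intro integrableI_nonneg) (auto simp: less_top[symmetric] top_unique le_less_trans)
        show "(LBINT x. indicator (cball 0 (real R)) x * \<bar>U n x - A n x\<bar>) \<le> \<rho> j * K (real R)"
          using nn \<rho>(1)[of j] K[of "real R"] by (subst (asm) nn_integral_eq_integral[OF i]) (auto simp: less_imp_le)
      qed
      have "(LBINT x. w x * \<bar>U n x - A n x\<bar>)
          \<le> (LBINT x. indicator (cball 0 (real R)) x * \<bar>U n x - A n x\<bar> + (2 * M) * (w x * (1 - indicator (cball 0 (real R)) x)))"
      proof (rule integral_mono)
        show "integrable lborel (\<lambda>x. w x * \<bar>U n x - A n x\<bar>)"
          by (rule i_w[where C = "2 * M"]) (use UA in auto)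
        show "integrable lborel (\<lambda>x. indicator (cball 0 (real R)) x * \<bar>U n x - A n x\<bar> + (2 * M) * (w x * (1 - indicator (cball 0 (real R)) x)))"
          by (intro Bochner_Integration.integrable_add i integrable_mult_right i_w[where C = 1]) (auto simp: indicator_def)
        fix x
        show "w x * \<bar>U n x - A n x\<bar> \<le> indicator (cball 0 (real R)) x * \<bar>U n x - A n x\<bar> + (2 * M) * (w x * (1 - indicator (cball 0 (real R)) x))"
          using w(2,3)[of x] mult_left_mono[OF UA[of n x], of "w x"]
          by (auto simp: indicator_def mult_left_le_one_le less_imp_le mult_ac)
      qed
      also have "\<dots> = (LBINT x. indicator (cball 0 (real R)) x * \<bar>U n x - A n x\<bar>)
          + (2 * M) * (LBINT x. w x * (1 - indicator (cball 0 (real R)) x))"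
        using i i_w[of "\<lambda>x. 1 - indicat_real (cball 0 (real R)) x" 1] by (simp add: indicator_def)
      also have "\<dots> \<le> \<rho> j * K (real R) + (2 * M) * (e / (8 * (M + 1)))"
        using R M0 by (intro add_mono le mult_left_mono) auto
      also have "\<dots> < 3 * e / 8"
      proof -
        have "\<rho> j * K (real R) < e / 8"
        proof -
          have "\<rho> j * K (real R) \<le> \<rho> j * (K (real R) + 1)" using \<rho>(1)[of j] by simp
          also have "\<dots> < e / 8" using j K[of "real R"] by (simp add: field_simps)
          finally show ?thesis .
        qed
        moreover have "(2 * M) * (e / (8 * (M + 1))) \<le> e / 4"
          using M0 \<open>e > 0\<close> by (simp add: field_simps)
        ultimately show ?thesis by simp
      qed
      finally show ?thesis .
    qed
    define a where "a x = lim (\<lambda>n. A n x)" for x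
    have A_lim: "(\<lambda>n. A n x) \<longlonglongrightarrow> a x" for x
      using conv[of j x] unfolding a_def A_def U_def convergent_LIMSEQ_iff .
    have [measurable]: "a \<in> borel_measurable borel"
      by (rule borel_measurable_LIMSEQ_real[where u = A]) (use A_lim in auto)
    have a_bd: "\<bar>a x\<bar> \<le> M" for x
      by (rule tendsto_upperbound[OF tendsto_rabs[OF A_lim]]) (use Abd in auto)
    have "(\<lambda>n. LBINT x. w x * \<bar>A n x - a x\<bar>) \<longlonglongrightarrow> (\<integral>(x::'a). 0 \<partial>lborel)"
    proof (rule integral_dominated_convergence)
      show "integrable lborel (\<lambda>x. w x * (2 * M))" using w(4) by simp
      show "AE x in lborel. (\<lambda>n. w x * \<bar>A n x - a x\<bar>) \<longlonglongrightarrow> 0"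
      proof (intro AE_I2)
        fix x
        have "(\<lambda>n. w x * \<bar>A n x - a x\<bar>) \<longlonglongrightarrow> w x * \<bar>a x - a x\<bar>" by (intro tendsto_intros A_lim)
        then show "(\<lambda>n. w x * \<bar>A n x - a x\<bar>) \<longlonglongrightarrow> 0" by simp
      qed
      show "AE x in lborel. norm (w x * \<bar>A n x - a x\<bar>) \<le> w x * (2 * M)" for n
      proof (intro AE_I2)
        fix x
        have "\<bar>A n x - a x\<bar> \<le> 2 * M" using Abd[of n x] a_bd[of x] by linarith
        then show "norm (w x * \<bar>A n x - a x\<bar>) \<le> w x * (2 * M)"
          using w(2)[of x] by (simp add: abs_mult)
      qed
    qed measurable
    then have "(\<lambda>n. LBINT x. w x * \<bar>A n x - a x\<bar>) \<longlonglongrightarrow> 0" by simp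
    from order_tendstoD(2)[OF this, of "e / 8"] \<open>e > 0\<close>
    obtain N where N: "\<And>n. n \<ge> N \<Longrightarrow> (LBINT x. w x * \<bar>A n x - a x\<bar>) < e / 8"
      by (auto simp: eventually_sequentially)
    have "(LBINT x. norm (w x * U i x - w x * U k x)) < e" if "i \<ge> N" "k \<ge> N" for i k
    proof -
      have d: "\<bar>U n x - A n x\<bar> \<le> 2 * M" "\<bar>A n x - a x\<bar> \<le> 2 * M" for n x
        using MU[of n x] Abd[of n x] a_bd[of x] by linarith+
      have ii: "integrable lborel (\<lambda>x. w x * \<bar>U n x - A n x\<bar>)" "integrable lborel (\<lambda>x. w x * \<bar>A n x - a x\<bar>)" for n
        using d by (auto intro!: i_w[where C = "2 * M"])
      have "(LBINT x. norm (w x * U i x - w x * U k x))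
          \<le> (LBINT x. (w x * \<bar>U i x - A i x\<bar> + w x * \<bar>A i x - a x\<bar>) + (w x * \<bar>U k x - A k x\<bar> + w x * \<bar>A k x - a x\<bar>))"
      proof (rule integral_mono)
        show "integrable lborel (\<lambda>x. norm (w x * U i x - w x * U k x))"
          by (intro integrable_norm Bochner_Integration.integrable_diff i_w[OF _ MU]) measurable
        fix x
        have "\<bar>U i x - U k x\<bar> \<le> \<bar>U i x - A i x\<bar> + \<bar>A i x - a x\<bar> + (\<bar>U k x - A k x\<bar> + \<bar>A k x - a x\<bar>)" by linarith
        moreover have "norm (w x * U i x - w x * U k x) = w x * \<bar>U i x - U k x\<bar>"
          using w(2)[of x] unfolding right_diff_distrib[symmetric] by (simp add: abs_mult)
        moreover note mult_left_mono[OF calculation(1) less_imp_le[OF w(2)[of x]]]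
        ultimately
        show "norm (w x * U i x - w x * U k x) \<le> (w x * \<bar>U i x - A i x\<bar> + w x * \<bar>A i x - a x\<bar>) + (w x * \<bar>U k x - A k x\<bar> + w x * \<bar>A k x - a x\<bar>)"
          by (simp only: distrib_left)
      qed (use ii in auto)
      also have "\<dots> = ((LBINT x. w x * \<bar>U i x - A i x\<bar>) + (LBINT x. w x * \<bar>A i x - a x\<bar>))
          + ((LBINT x. w x * \<bar>U k x - A k x\<bar>) + (LBINT x. w x * \<bar>A k x - a x\<bar>))"
        using ii by simp
      also have "\<dots> < e" using near[of i] near[of k] N[OF that(1)] N[OF that(2)] by linarith
      finally show ?thesis .
    qed
    then show ?thesis by blast
  qed
  have i_wU: "integrable lborel (\<lambda>x. w x * U n x)" for n
    by (rule i_w[OF _ MU]) measurable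
  obtain s where s: "strict_mono (s :: nat \<Rightarrow> nat)" "AE x in lborel. Cauchy (\<lambda>i. w x * U (s i) x)"
    using cauchy_L1_AE_cauchy_subseq[of lborel "\<lambda>n x. w x * U n x", OF i_wU Cauchy] by blast
  have "AE x in lborel. convergent (\<lambda>i. u ((r \<circ> s) i) x)"
    using s(2)
  proof eventually_elim
    fix x assume "Cauchy (\<lambda>i. w x * U (s i) x)"
    then have "convergent (\<lambda>i. w x * U (s i) x)" by (simp add: Cauchy_convergent_iff)
    then have "convergent (\<lambda>i. U (s i) x)"
      using w(2)[of x] by (subst (asm) convergent_mult_const_iff) auto
    then show "convergent (\<lambda>i. u ((r \<circ> s) i) x)" by (simp add: U_def o_def)
  qed
  then show ?thesis using strict_mono_o[OF r s(1)] by blast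
qed

section \<open>Bounds for almost everywhere limits\<close>

lemma Fatou_AE:
  fixes f :: "nat \<Rightarrow> 'a \<Rightarrow> ennreal"
  assumes [measurable]: "\<And>n. f n \<in> borel_measurable M" "g \<in> borel_measurable M"
    and lim: "AE x in M. (\<lambda>n. f n x) \<longlonglongrightarrow> g x"
  shows "(\<integral>\<^sup>+x. g x \<partial>M) \<le> liminf (\<lambda>n. \<integral>\<^sup>+x. f n x \<partial>M)"
proof -
  have "(\<integral>\<^sup>+x. g x \<partial>M) = (\<integral>\<^sup>+x. liminf (\<lambda>n. f n x) \<partial>M)"
    using lim by (intro nn_integral_cong_AE) (auto simp: lim_imp_Liminf)
  also have "\<dots> \<le> liminf (\<lambda>n. \<integral>\<^sup>+x. f n x \<partial>M)"
    by (rule nn_integral_liminf) measurable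
  finally show ?thesis .
qed

lemma Fatou_bound:
  fixes f :: "nat \<Rightarrow> 'a \<Rightarrow> ennreal"
  assumes "\<And>n. f n \<in> borel_measurable M" "g \<in> borel_measurable M"
    and "AE x in M. (\<lambda>n. f n x) \<longlonglongrightarrow> g x"
    and c: "\<forall>\<^sub>F n in sequentially. (\<integral>\<^sup>+x. f n x \<partial>M) \<le> c"
  shows "(\<integral>\<^sup>+x. g x \<partial>M) \<le> c"
proof -
  have "liminf (\<lambda>n. \<integral>\<^sup>+x. f n x \<partial>M) \<le> limsup (\<lambda>n. \<integral>\<^sup>+x. f n x \<partial>M)"
    by (rule Liminf_le_Limsup) simp
  also have "\<dots> \<le> c" by (rule Limsup_bounded[OF c])
  finally show ?thesis using Fatou_AE[OF assms(1-3)] by (rule order_trans[rotated])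
qed

section \<open>Uniform convexity of powers of the norm\<close>

text \<open>Strict convexity of the power function, as the statement that its graph lies above the
  tangent at 1; the derivative exceeds \<open>p\<close> to the right of 1 and stays below
  \<open>p\<close> to the left.\<close>

lemma powr_gt_tangent:
  fixes x p :: real
  assumes p: "1 < p" and x: "0 \<le> x" "x \<noteq> 1"
  shows "1 + p * (x - 1) < x powr p"
proof (cases "x = 0")
  case False
  then have x0: "x > 0" using x by simp
  have der: "((\<lambda>y. y powr p) has_real_derivative p * y powr (p - 1)) (at y)" if "y > 0" for y
    using that by (auto intro!: derivative_eq_intros)
  show ?thesis
  proof (cases "x < 1")
    case True
    obtain z where z: "x < z" "z < 1" "1 powr p - x powr p = (1 - x) * (p * z powr (p - 1))"
      using MVT2[OF True, of "\<lambda>y. y powr p" "\<lambda>y. p * y powr (p - 1)"] der x0 by force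
    have "z powr (p - 1) < 1 powr (p - 1)"
      using z x0 p by (intro powr_less_mono2) auto
    then have "(1 - x) * (p * z powr (p - 1)) < (1 - x) * (p * 1)"
      using True p by (intro mult_strict_left_mono) auto
    then show ?thesis using z(3) by (simp add: algebra_simps)
  next
    case False
    then have "1 < x" using x by simp
    then obtain z where z: "1 < z" "z < x" "x powr p - 1 powr p = (x - 1) * (p * z powr (p - 1))"
      using MVT2[of 1 x "\<lambda>y. y powr p" "\<lambda>y. p * y powr (p - 1)"] der by force
    have "1 powr (p - 1) < z powr (p - 1)"
      using z p by (intro powr_less_mono2) auto
    then have "(x - 1) * (p * 1) < (x - 1) * (p * z powr (p - 1))"
      using \<open>1 < x\<close> p by (intro mult_strict_left_mono) auto
    then show ?thesis using z(3) by (simp add: algebra_simps)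
  qed
qed (use p in simp)

text \<open>Adding the tangent inequalities at the midpoint.\<close>

lemma powr_midpoint_strict:
  fixes s t p :: real
  assumes p: "1 < p" and st: "0 \<le> s" "0 \<le> t" "s \<noteq> t"
  shows "((s + t) / 2) powr p < (s powr p + t powr p) / 2"
proof -
  define m where "m = (s + t) / 2"
  have m: "m > 0" using st by (simp add: m_def)
  have *: "m powr p * (1 + p * (y / m - 1)) < y powr p" if "0 \<le> y" "y \<noteq> m" for y
  proof -
    have "1 + p * (y / m - 1) < (y / m) powr p"
      using that m by (intro powr_gt_tangent p) auto
    then have "m powr p * (1 + p * (y / m - 1)) < m powr p * (y / m) powr p"
      using m by (intro mult_strict_left_mono) auto
    also have "\<dots> = y powr p" using m that by (simp add: powr_divide)
    finally show ?thesis .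
  qed
  have "s \<noteq> m" "t \<noteq> m" using st by (auto simp: m_def)
  have "m powr p * (1 + p * (s / m - 1)) + m powr p * (1 + p * (t / m - 1)) = 2 * m powr p"
  proof -
    have "s + t = 2 * m" by (simp add: m_def)
    then have "(s + t) / m = 2" using m by simp
    then have "s / m + t / m = 2" by (simp only: add_divide_distrib)
    then have "t / m = 2 - s / m" by simp
    moreover have "A * (1 + p * (x - 1)) + A * (1 + p * (2 - x - 1)) = 2 * A" for A x
      by (simp add: algebra_simps)
    ultimately show ?thesis by (simp only:)
  qed
  with *[OF st(1) \<open>s \<noteq> m\<close>] *[OF st(2) \<open>t \<noteq> m\<close>] show ?thesis by (simp add: m_def)
qed

text \<open>How much the \<open>p\<close>-th power of the norm fails to be affine at the
  midpoint.\<close>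

definition convexity_gap :: "real \<Rightarrow> 'a::real_inner \<Rightarrow> 'a \<Rightarrow> real" where
  "convexity_gap p a b = (norm a powr p + norm b powr p) / 2 - norm ((a + b) /\<^sub>R 2) powr p"

text \<open>Vectors of different length are separated by strict convexity of the power function,
  distinct vectors of equal length by the parallelogram law.\<close>

lemma convexity_gap_pos:
  fixes a b :: "'a::real_inner"
  assumes p: "1 < p" and "a \<noteq> b"
  shows "0 < convexity_gap p a b"
proof (cases "norm a = norm b")
  case False
  have "norm ((a + b) /\<^sub>R 2) \<le> (norm a + norm b) / 2"
    using norm_triangle_ineq[of a b] by simp
  then have "norm ((a + b) /\<^sub>R 2) powr p \<le> ((norm a + norm b) / 2) powr p"
    using p by (intro powr_mono2) auto
  with powr_midpoint_strict[OF p _ _ False] show ?thesis by (simp add: convexity_gap_def)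
next
  case True
  have "(norm (a + b))\<^sup>2 + (norm (a - b))\<^sup>2 = 2 * (norm a)\<^sup>2 + 2 * (norm b)\<^sup>2"
    by (simp add: power2_norm_eq_inner inner_simps)
  moreover have "0 < (norm (a - b))\<^sup>2" using \<open>a \<noteq> b\<close> by simp
  moreover have "(2 * norm a)\<^sup>2 = 2 * (norm a)\<^sup>2 + 2 * (norm b)\<^sup>2"
    using True by (simp add: power_mult_distrib)
  ultimately have "(norm (a + b))\<^sup>2 < (2 * norm a)\<^sup>2" by linarith
  then have "norm (a + b) < 2 * norm a" by (rule power_less_imp_less_base) simp
  then have "norm ((a + b) /\<^sub>R 2) powr p < norm a powr p"
    using p by (intro powr_less_mono2) auto
  then show ?thesis using True by (simp add: convexity_gap_def)
qed

lemma convexity_gap_nonneg: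
  assumes "1 < p"
  shows "0 \<le> convexity_gap p a b"
proof (cases "a = b")
  case True
  have "(a + a) /\<^sub>R 2 = a" by (simp flip: scaleR_2)
  with True show ?thesis by (simp add: convexity_gap_def)
qed (use convexity_gap_pos[OF assms] in \<open>auto intro: less_imp_le\<close>)

text \<open>A substitute for the inequalities of Clarkson that treats all exponents
  \<open>p > 1\<close> alike. Both sides are homogeneous of degree \<open>p\<close>, so it
  suffices to consider the unit sphere. There the set where the inequality fails for
  \<open>C = 0\<close> is contained in a compact set on which the gap is positive, hence bounded
  below.\<close>

lemma uniform_convexity:
  fixes p \<eta> :: real
  assumes p: "1 < p" and "\<eta> > 0"
  shows "\<exists>C\<ge>0. \<forall>a b :: 'a::euclidean_space.
    norm (a - b) powr p \<le> \<eta> * (norm a powr p + norm b powr p) + C * convexity_gap p a b"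
proof -
  define S where "S = sphere (0 :: 'a \<times> 'a) 1 \<inter>
    {z. \<eta> * (norm (fst z) powr p + norm (snd z) powr p) \<le> norm (fst z - snd z) powr p}"
  have cont: "continuous_on UNIV (\<lambda>z :: 'a \<times> 'a. norm (f z) powr p)" if "continuous_on UNIV f" for f :: "'a \<times> 'a \<Rightarrow> 'a"
    using p that by (intro continuous_on_powr' continuous_intros) auto
  have c1: "continuous_on UNIV (\<lambda>z :: 'a \<times> 'a. norm (fst z) powr p)"
    "continuous_on UNIV (\<lambda>z :: 'a \<times> 'a. norm (snd z) powr p)"
    "continuous_on UNIV (\<lambda>z :: 'a \<times> 'a. norm (fst z - snd z) powr p)"
    "continuous_on UNIV (\<lambda>z :: 'a \<times> 'a. norm ((fst z + snd z) /\<^sub>R 2) powr p)"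
    by (intro cont continuous_intros)+
  have "closed {z :: 'a \<times> 'a. \<eta> * (norm (fst z) powr p + norm (snd z) powr p) \<le> norm (fst z - snd z) powr p}"
    by (intro closed_Collect_le continuous_intros c1)
  then have "compact S" unfolding S_def by (intro compact_Int_closed compact_sphere)
  have gap_cont: "continuous_on S (\<lambda>z. convexity_gap p (fst z) (snd z))"
    unfolding convexity_gap_def
    by (rule continuous_on_subset[of UNIV]) (intro continuous_intros c1, auto)
  have gap_S: "0 < convexity_gap p (fst z) (snd z)" if "z \<in> S" for z
  proof (rule convexity_gap_pos[OF p])
    show "fst z \<noteq> snd z"
    proof
      assume eq: "fst z = snd z"
      then have "\<eta> * (norm (fst z) powr p + norm (snd z) powr p) \<le> 0" using that p by (simp add: S_def)
      then have "norm (snd z) powr p \<le> 0" using \<open>\<eta> > 0\<close> eq by (simp add: mult_le_0_iff)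
      then have "z = 0" using eq by (cases z) (auto simp: zero_prod_def)
      then show False using that by (simp add: S_def)
    qed
  qed
  obtain c where c: "c > 0" "\<And>z. z \<in> S \<Longrightarrow> c \<le> convexity_gap p (fst z) (snd z)"
  proof (cases "S = {}")
    case False
    obtain z0 where "z0 \<in> S" "\<And>z. z \<in> S \<Longrightarrow> convexity_gap p (fst z0) (snd z0) \<le> convexity_gap p (fst z) (snd z)"
      using continuous_attains_inf[OF \<open>compact S\<close> False gap_cont] by auto
    then show ?thesis using gap_S that by blast
  qed (use that[of 1] in auto)
  define C where "C = 2 powr p / c"
  have unit: "norm (a - b) powr p \<le> \<eta> * (norm a powr p + norm b powr p) + C * convexity_gap p a b"
    if ab: "norm (a, b) = 1" for a b :: 'a
  proof (cases "(a, b) \<in> S")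
    case True
    have "norm (a - b) \<le> 2"
      using norm_triangle_ineq4[of a b] norm_fst_le[of a b] norm_snd_le[of b a] ab by simp
    then have "norm (a - b) powr p \<le> 2 powr p" using p by (intro powr_mono2) auto
    also have "\<dots> = C * c" using c(1) by (simp add: C_def)
    also have "\<dots> \<le> C * convexity_gap p a b"
      using c(2)[OF True] c(1) by (intro mult_left_mono) (auto simp: C_def)
    also have "\<dots> \<le> \<eta> * (norm a powr p + norm b powr p) + C * convexity_gap p a b"
      using \<open>\<eta> > 0\<close> by simp
    finally show ?thesis .
  next
    case False
    then have "norm (a - b) powr p \<le> \<eta> * (norm a powr p + norm b powr p)"
      using ab by (simp add: S_def)
    moreover have "0 \<le> C * convexity_gap p a b"
      using convexity_gap_nonneg[OF p] c(1) by (intro mult_nonneg_nonneg) (auto simp: C_def)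
    ultimately show ?thesis by simp
  qed
  have "norm (a - b) powr p \<le> \<eta> * (norm a powr p + norm b powr p) + C * convexity_gap p a b" for a b :: 'a
  proof (cases "(a, b) = 0")
    case True
    then show ?thesis using p by (auto simp: convexity_gap_def zero_prod_def)
  next
    case False
    define s where "s = norm (a, b)"
    have s: "s > 0" using False by (simp add: s_def)
    define a' b' where "a' = a /\<^sub>R s" and "b' = b /\<^sub>R s"
    have "norm (a', b') = norm ((a, b) /\<^sub>R s)" by (simp add: a'_def b'_def)
    also have "\<dots> = 1" using s by (simp only: norm_scaleR s_def) simp
    finally have 1: "norm (a', b') = 1" .
    have ab: "a = s *\<^sub>R a'" "b = s *\<^sub>R b'" using s by (auto simp: a'_def b'_def)
    have sc: "norm (s *\<^sub>R y) powr p = s powr p * norm y powr p" for y :: 'a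
      using s by (simp add: powr_mult)
    have e1: "norm (a - b) powr p = s powr p * norm (a' - b') powr p"
      unfolding ab sc[symmetric] by (simp add: scaleR_diff_right)
    have "(a + b) /\<^sub>R 2 = s *\<^sub>R ((a' + b') /\<^sub>R 2)"
      unfolding ab by (simp add: scaleR_add_right[symmetric])
    then have e2: "norm ((a + b) /\<^sub>R 2) powr p = s powr p * norm ((a' + b') /\<^sub>R 2) powr p"
      by (simp only: sc)
    have "norm (a - b) powr p \<le> s powr p * (\<eta> * (norm a' powr p + norm b' powr p) + C * convexity_gap p a' b')"
      unfolding e1 by (intro mult_left_mono unit 1) auto
    also have "\<dots> = \<eta> * (norm a powr p + norm b powr p) + C * convexity_gap p a b"
      unfolding convexity_gap_def e2 by (simp only: ab sc) (simp add: algebra_simps diff_divide_distrib add_divide_distrib)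
    finally show ?thesis .
  qed
  moreover have "0 \<le> C" using c(1) by (simp add: C_def)
  ultimately show ?thesis by blast
qed

section \<open>Convergence in the mean of order p\<close>

text \<open>Replaces the inequality of Hoelder: control in \<open>L\<^sup>p\<close> gives control in
  \<open>L\<^sup>1\<close> on sets of finite measure, up to an arbitrarily small multiple of that
  measure.\<close>

lemma le_eta_plus_powr:
  fixes y \<eta> p :: real
  assumes "1 < p" "\<eta> > 0" "0 \<le> y"
  shows "y \<le> \<eta> + \<eta> powr (1 - p) * y powr p"
proof (cases "y \<le> \<eta>")
  case True
  then show ?thesis by (simp add: add_increasing2)
next
  case False
  then have "y = y powr (1 - p) * y powr p" using assms by (simp flip: powr_add)
  also have "\<dots> \<le> \<eta> powr (1 - p) * y powr p"
    using assms False by (intro mult_right_mono powr_mono2') auto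
  finally show ?thesis using assms by simp
qed

text \<open>Completeness of \<open>L\<^sup>p\<close>. A positive integrable weight turns a Cauchy
  sequence in \<open>L\<^sup>p\<close> into one in \<open>L\<^sup>1\<close>, which has an almost
  everywhere convergent subsequence; Fatou shows that its limit is the limit in
  \<open>L\<^sup>p\<close>.\<close>

lemma Lp_complete:
  fixes F :: "nat \<Rightarrow> 'a::euclidean_space \<Rightarrow> 'b::euclidean_space"
  assumes p: "1 < p" and F[measurable]: "\<And>n. F n \<in> borel_measurable borel"
    and fin: "\<And>n. integrable lborel (\<lambda>x. norm (F n x) powr p)"
    and Cauchy: "\<And>e. e > 0 \<Longrightarrow> \<exists>N. \<forall>i\<ge>N. \<forall>j\<ge>N. (\<integral>\<^sup>+x. ennreal (norm (F i x - F j x) powr p) \<partial>lborel) \<le> ennreal e"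
  shows "\<exists>r H. strict_mono (r :: nat \<Rightarrow> nat) \<and> H \<in> borel_measurable borel \<and> (AE x in lborel. (\<lambda>i. F (r i) x) \<longlonglongrightarrow> H x) \<and>
    (\<forall>e>0. \<exists>N. \<forall>i\<ge>N. (\<integral>\<^sup>+x. ennreal (norm (F i x - H x) powr p) \<partial>lborel) \<le> ennreal e)"
proof -
  obtain w :: "'a \<Rightarrow> real" where w: "w \<in> borel_measurable lborel" "\<And>x. w x > 0" "\<And>x. w x \<le> 1" "integrable lborel w"
    using sigma_finite_measure.obtain_positive_integrable_function[OF sigma_finite_lborel] by blast
  note [measurable] = w(1)
  have i_w: "integrable lborel (\<lambda>x. w x *\<^sub>R F n x)" for n
  proof (rule Bochner_Integration.integrable_bound)
    show "integrable lborel (\<lambda>x. w x + norm (F n x) powr p)" using w(4) fin by simp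
    show "AE x in lborel. norm (w x *\<^sub>R F n x) \<le> norm (w x + norm (F n x) powr p)"
    proof (intro AE_I2)
      fix x
      have "w x * norm (F n x) \<le> w x * (1 + norm (F n x) powr p)"
        using le_eta_plus_powr[OF p, of 1 "norm (F n x)"] w(2)[of x] by (intro mult_left_mono) auto
      also have "\<dots> \<le> w x + 1 * norm (F n x) powr p"
        using mult_right_mono[OF w(3)[of x], of "norm (F n x) powr p"] by (simp add: distrib_left)
      finally show "norm (w x *\<^sub>R F n x) \<le> norm (w x + norm (F n x) powr p)"
        using w(2)[of x] by simp
    qed
  qed measurable
  define W where "W = (LBINT x. w x)"
  have W: "0 \<le> W" using w(2) by (auto simp: W_def less_imp_le intro!: integral_nonneg_AE)
  have "\<exists>N. \<forall>i\<ge>N. \<forall>j\<ge>N. (LBINT x. norm (w x *\<^sub>R F i x - w x *\<^sub>R F j x)) < e" if "e > 0" for e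
  proof -
    \<comment> \<open>Half of \<open>e\<close> is spent on the weight, half on the
      \<open>p\<close>-th powers.\<close>
    define \<eta> where "\<eta> = e / (4 * (W + 1))"
    have \<eta>: "\<eta> > 0" using \<open>e > 0\<close> W by (simp add: \<eta>_def)
    define e' where "e' = e / (4 * \<eta> powr (1 - p))"
    have e': "e' > 0" using \<open>e > 0\<close> \<eta> by (simp add: e'_def)
    obtain N where N: "\<And>i j. i \<ge> N \<Longrightarrow> j \<ge> N \<Longrightarrow> (\<integral>\<^sup>+x. ennreal (norm (F i x - F j x) powr p) \<partial>lborel) \<le> ennreal e'"
      using Cauchy[OF e'] by blast
    have "(LBINT x. norm (w x *\<^sub>R F i x - w x *\<^sub>R F j x)) < e" if "i \<ge> N" "j \<ge> N" for i j
    proof -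
      have "integrable lborel (\<lambda>x. norm (F i x - F j x) powr p)"
        using N[OF that] by (intro integrableI_nonneg) (auto simp: less_top[symmetric] top_unique)
      then have i: "integrable lborel (\<lambda>x. norm (F i x - F j x) powr p)"
        and le: "(LBINT x. norm (F i x - F j x) powr p) \<le> e'"
        using N[OF that] e' nn_integral_eq_integral[of lborel "\<lambda>x. norm (F i x - F j x) powr p"] by auto
      have "(LBINT x. norm (w x *\<^sub>R F i x - w x *\<^sub>R F j x))
          \<le> (LBINT x. \<eta> * w x + \<eta> powr (1 - p) * norm (F i x - F j x) powr p)"
      proof (rule integral_mono)
        show "integrable lborel (\<lambda>x. norm (w x *\<^sub>R F i x - w x *\<^sub>R F j x))" using i_w by simp
        show "integrable lborel (\<lambda>x. \<eta> * w x + \<eta> powr (1 - p) * norm (F i x - F j x) powr p)"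
          using w(4) i by simp
        fix x
        have "norm (w x *\<^sub>R F i x - w x *\<^sub>R F j x) = w x * norm (F i x - F j x)"
          using w(2)[of x] by (simp flip: scaleR_diff_right)
        also have "\<dots> \<le> w x * (\<eta> + \<eta> powr (1 - p) * norm (F i x - F j x) powr p)"
          using le_eta_plus_powr[OF p \<eta>, of "norm (F i x - F j x)"] w(2)[of x] by (intro mult_left_mono) auto
        also have "\<dots> \<le> \<eta> * w x + 1 * (\<eta> powr (1 - p) * norm (F i x - F j x) powr p)"
          using mult_right_mono[OF w(3)[of x], of "\<eta> powr (1 - p) * norm (F i x - F j x) powr p"]
          by (simp add: distrib_left mult.commute[of "w x" \<eta>])
        finally show "norm (w x *\<^sub>R F i x - w x *\<^sub>R F j x) \<le> \<eta> * w x + \<eta> powr (1 - p) * norm (F i x - F j x) powr p"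
          by simp
      qed
      also have "\<dots> = \<eta> * W + \<eta> powr (1 - p) * (LBINT x. norm (F i x - F j x) powr p)"
        using w(4) i by (simp add: W_def)
      also have "\<dots> \<le> \<eta> * W + \<eta> powr (1 - p) * e'" using le by (intro add_left_mono mult_left_mono) auto
      also have "\<eta> * W \<le> e / 4" using W \<open>e > 0\<close> by (simp add: \<eta>_def field_simps)
      also have "\<eta> powr (1 - p) * e' = e / 4" using \<eta> by (simp add: e'_def)
      finally show ?thesis using \<open>e > 0\<close> by simp
    qed
    then show ?thesis by blast
  qed
  then obtain r where r: "strict_mono (r :: nat \<Rightarrow> nat)" "AE x in lborel. Cauchy (\<lambda>i. w x *\<^sub>R F (r i) x)"
    using cauchy_L1_AE_cauchy_subseq[of lborel "\<lambda>n x. w x *\<^sub>R F n x", OF i_w] by blast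
  define H where "H x = lim (\<lambda>i. F (r i) x)" for x
  have [measurable]: "H \<in> borel_measurable borel"
    unfolding H_def[abs_def] by (rule borel_measurable_lim_metric) measurable
  have lim: "AE x in lborel. (\<lambda>i. F (r i) x) \<longlonglongrightarrow> H x"
    using r(2)
  proof eventually_elim
    fix x assume "Cauchy (\<lambda>i. w x *\<^sub>R F (r i) x)"
    then have "convergent (\<lambda>i. w x *\<^sub>R F (r i) x)" by (simp add: Cauchy_convergent_iff)
    then obtain L where "(\<lambda>i. w x *\<^sub>R F (r i) x) \<longlonglongrightarrow> L" by (auto simp: convergent_def)
    then have "(\<lambda>i. inverse (w x) *\<^sub>R (w x *\<^sub>R F (r i) x)) \<longlonglongrightarrow> inverse (w x) *\<^sub>R L"
      by (intro tendsto_intros)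
    then have "convergent (\<lambda>i. F (r i) x)" using w(2)[of x] by (auto simp: convergent_def)
    then show "(\<lambda>i. F (r i) x) \<longlonglongrightarrow> H x" by (simp add: H_def convergent_LIMSEQ_iff)
  qed
  have "\<exists>N. \<forall>i\<ge>N. (\<integral>\<^sup>+x. ennreal (norm (F i x - H x) powr p) \<partial>lborel) \<le> ennreal e" if "e > 0" for e
  proof -
    obtain N where N: "\<And>i j. i \<ge> N \<Longrightarrow> j \<ge> N \<Longrightarrow> (\<integral>\<^sup>+x. ennreal (norm (F i x - F j x) powr p) \<partial>lborel) \<le> ennreal e"
      using Cauchy[OF \<open>e > 0\<close>] by blast
    have "(\<integral>\<^sup>+x. ennreal (norm (F i x - H x) powr p) \<partial>lborel) \<le> ennreal e" if "i \<ge> N" for i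
    proof (rule Fatou_bound[where f = "\<lambda>k x. ennreal (norm (F i x - F (r k) x) powr p)"])
      show "AE x in lborel. (\<lambda>k. ennreal (norm (F i x - F (r k) x) powr p)) \<longlonglongrightarrow> ennreal (norm (F i x - H x) powr p)"
        using lim
      proof eventually_elim
        fix x assume "(\<lambda>i. F (r i) x) \<longlonglongrightarrow> H x"
        then show "(\<lambda>k. ennreal (norm (F i x - F (r k) x) powr p)) \<longlonglongrightarrow> ennreal (norm (F i x - H x) powr p)"
          using p by (intro tendsto_ennrealI tendsto_powr' tendsto_intros) auto
      qed
      show "\<forall>\<^sub>F k in sequentially. (\<integral>\<^sup>+x. ennreal (norm (F i x - F (r k) x) powr p) \<partial>lborel) \<le> ennreal e"
        using eventually_ge_at_top[of N]
      proof eventually_elim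
        fix k assume "k \<ge> N"
        then have "r k \<ge> N" using seq_suble[OF r(1), of k] by simp
        then show "(\<integral>\<^sup>+x. ennreal (norm (F i x - F (r k) x) powr p) \<partial>lborel) \<le> ennreal e"
          by (rule N[OF that])
      qed
    qed measurable
    then show ?thesis by blast
  qed
  with r(1) lim \<open>H \<in> borel_measurable borel\<close> show ?thesis by blast
qed

lemma locint_if_Lp:
  fixes F :: "'a::euclidean_space \<Rightarrow> 'b::euclidean_space"
  assumes p: "1 < p" and [measurable]: "F \<in> borel_measurable borel"
    and fin: "(\<integral>\<^sup>+x. ennreal (norm (F x) powr p) \<partial>lborel) < \<infinity>"
  shows "locint F"
proof -
  have i: "integrable lborel (\<lambda>x. norm (F x) powr p)"
    using fin by (intro integrableI_nonneg) auto
  have "integrable lborel (\<lambda>x. indicator (cball 0 R) x *\<^sub>R F x)" for R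
  proof (rule Bochner_Integration.integrable_bound)
    have "integrable lborel (indicat_real (cball (0::'a) R))"
      using emeasure_bounded_finite[OF bounded_cball, of "0::'a" R] by auto
    with i show "integrable lborel (\<lambda>x. indicat_real (cball 0 R) x + norm (F x) powr p)" by simp
    show "AE x in lborel. norm (indicat_real (cball 0 R) x *\<^sub>R F x) \<le> norm (indicat_real (cball 0 R) x + norm (F x) powr p)"
      using le_eta_plus_powr[OF p, of 1 "norm (F _)"] by (intro AE_I2) (auto simp: indicator_def)
    have [measurable]: "cball (0::'a) R \<in> sets borel" by simp
    show "(\<lambda>x. indicat_real (cball 0 R) x *\<^sub>R F x) \<in> borel_measurable lborel" by measurable
  qed
  then show ?thesis by (simp add: locint_def)
qed

lemma integral_test_tendsto_if_Lp:
  fixes F :: "nat \<Rightarrow> 'a::euclidean_space \<Rightarrow> 'a" and H :: "'a \<Rightarrow> 'a"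
  assumes p: "1 < p" and F: "\<And>n. locint (F n)" and H: "locint H" and \<psi>: "test_fun \<psi>"
    and lim: "\<And>e. e > 0 \<Longrightarrow> \<exists>N. \<forall>i\<ge>N. (\<integral>\<^sup>+x. ennreal (norm (F i x - H x) powr p) \<partial>lborel) \<le> ennreal e"
  shows "(\<lambda>n. LBINT x. (F n x \<bullet> h) * \<psi> x) \<longlonglongrightarrow> (LBINT x. (H x \<bullet> h) * \<psi> x)"
proof (rule LIMSEQ_I)
  fix e :: real assume "e > 0"
  note [measurable] = locint_measurable[OF F] locint_measurable[OF H]
  obtain C R where \<psi>_bd: "0 \<le> C" "\<And>x. \<bar>\<psi> x\<bar> \<le> C * indicator (cball 0 R) x"
    using test_fun_bound(1)[OF \<psi>] by auto
  define b where "b = measure lborel (cball (0::'a) R)"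
  have b: "0 \<le> b" by (simp add: b_def)
  define L where "L = norm h * C + 1"
  have L: "0 < L" using \<psi>_bd(1) by (auto simp: L_def intro: add_nonneg_pos)
  define \<eta> where "\<eta> = e / (4 * L * (b + 1))"
  have \<eta>: "\<eta> > 0" using \<open>e > 0\<close> b L by (simp add: \<eta>_def)
  define e' where "e' = e / (4 * L * \<eta> powr (1 - p))"
  have e': "e' > 0" using \<open>e > 0\<close> \<eta> L by (simp add: e'_def)
  obtain N where N: "\<And>i. i \<ge> N \<Longrightarrow> (\<integral>\<^sup>+x. ennreal (norm (F i x - H x) powr p) \<partial>lborel) \<le> ennreal e'"
    using lim[OF e'] by blast
  have ib: "integrable lborel (indicat_real (cball (0::'a) R))"
    using emeasure_bounded_finite[OF bounded_cball, of "0::'a" R] by auto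
  have "norm ((LBINT x. (F n x \<bullet> h) * \<psi> x) - (LBINT x. (H x \<bullet> h) * \<psi> x)) < e" if "n \<ge> N" for n
  proof -
    have "integrable lborel (\<lambda>x. norm (F n x - H x) powr p)"
      using N[OF that] by (intro integrableI_nonneg) (auto simp: less_top[symmetric] top_unique)
    then have i: "integrable lborel (\<lambda>x. norm (F n x - H x) powr p)"
      and le: "(LBINT x. norm (F n x - H x) powr p) \<le> e'"
      using N[OF that] e' nn_integral_eq_integral[of lborel "\<lambda>x. norm (F n x - H x) powr p"] by auto
    have iFH: "integrable lborel (\<lambda>x. (F n x \<bullet> h) * \<psi> x)" "integrable lborel (\<lambda>x. (H x \<bullet> h) * \<psi> x)"
      by (intro integrable_locint_test locint_inner F H \<psi>)+
    have "(LBINT x. (F n x \<bullet> h) * \<psi> x) - (LBINT x. (H x \<bullet> h) * \<psi> x)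
        = (LBINT x. (F n x \<bullet> h) * \<psi> x - (H x \<bullet> h) * \<psi> x)"
      using iFH by simp
    also have "norm \<dots> \<le> (LBINT x. norm ((F n x \<bullet> h) * \<psi> x - (H x \<bullet> h) * \<psi> x))"
      by (rule integral_norm_bound)
    also have "\<dots> \<le> (LBINT x. L * (\<eta> * indicat_real (cball 0 R) x + \<eta> powr (1 - p) * norm (F n x - H x) powr p))"
    proof (rule integral_mono)
      show "integrable lborel (\<lambda>x. norm ((F n x \<bullet> h) * \<psi> x - (H x \<bullet> h) * \<psi> x))" using iFH by simp
      show "integrable lborel (\<lambda>x. L * (\<eta> * indicat_real (cball 0 R) x + \<eta> powr (1 - p) * norm (F n x - H x) powr p))"
        using ib i by simp
      fix x
      have "norm ((F n x \<bullet> h) * \<psi> x - (H x \<bullet> h) * \<psi> x) = \<bar>(F n x - H x) \<bullet> h\<bar> * \<bar>\<psi> x\<bar>"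
        by (simp add: inner_diff_left left_diff_distrib[symmetric] abs_mult)
      also have "\<dots> \<le> (norm (F n x - H x) * norm h) * (C * indicator (cball 0 R) x)"
        by (intro mult_mono Cauchy_Schwarz_ineq2 \<psi>_bd) auto
      also have "\<dots> = (norm h * C) * (indicator (cball 0 R) x * norm (F n x - H x))" by simp
      also have "\<dots> \<le> L * (indicator (cball 0 R) x * norm (F n x - H x))"
        by (intro mult_right_mono) (auto simp: L_def)
      also have "\<dots> \<le> L * (\<eta> * indicat_real (cball 0 R) x + \<eta> powr (1 - p) * norm (F n x - H x) powr p)"
        using le_eta_plus_powr[OF p \<eta>, of "norm (F n x - H x)"] L
        by (intro mult_left_mono) (auto simp: indicator_def)
      finally show "norm ((F n x \<bullet> h) * \<psi> x - (H x \<bullet> h) * \<psi> x)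
          \<le> L * (\<eta> * indicat_real (cball 0 R) x + \<eta> powr (1 - p) * norm (F n x - H x) powr p)" .
    qed
    also have "\<dots> = L * (\<eta> * b + \<eta> powr (1 - p) * (LBINT x. norm (F n x - H x) powr p))"
      using ib i by (simp add: b_def)
    also have "\<dots> \<le> L * (\<eta> * b + \<eta> powr (1 - p) * e')"
      using le L by (intro mult_left_mono add_left_mono) auto
    also have "\<dots> \<le> e / 4 + e / 4"
    proof -
      have "\<eta> * b \<le> \<eta> * (b + 1)" using \<eta> by simp
      also have "\<dots> = e / (4 * L)" using b by (simp add: \<eta>_def)
      finally have "L * (\<eta> * b) \<le> L * (e / (4 * L))" using L by (intro mult_left_mono) auto
      moreover have "\<eta> powr (1 - p) * e' = e / (4 * L)" using \<eta> by (simp add: e'_def)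
      ultimately show ?thesis using L by (simp add: distrib_left)
    qed
    finally show ?thesis using \<open>e > 0\<close> by simp
  qed
  then show "\<exists>N. \<forall>n\<ge>N. norm ((LBINT x. (F n x \<bullet> h) * \<psi> x) - (LBINT x. (H x \<bullet> h) * \<psi> x)) < e"
    by blast
qed

section \<open>Lower semicontinuity of the Dirichlet energy\<close>

text \<open>Iterated midpoints of the members of the sequence with index at least \<open>N\<close>,
  with their gradients. Dyadic convex combinations are all that the argument needs, and they require
  no vector space of functions.\<close>

inductive tail_mean ::
  "(nat \<Rightarrow> 'a::euclidean_space \<Rightarrow> real) \<Rightarrow> (nat \<Rightarrow> 'a \<Rightarrow> 'a) \<Rightarrow> nat \<Rightarrow> ('a \<Rightarrow> real) \<Rightarrow> ('a \<Rightarrow> 'a) \<Rightarrow> bool"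
  for u G N where
  tail: "n \<ge> N \<Longrightarrow> tail_mean u G N (u n) (G n)"
| midpoint: "tail_mean u G N f F \<Longrightarrow> tail_mean u G N g K \<Longrightarrow>
    tail_mean u G N (\<lambda>x. (f x + g x) / 2) (\<lambda>x. (F x + K x) /\<^sub>R 2)"

lemma tail_mean_antimono:
  assumes "tail_mean u G N f F" "N' \<le> N"
  shows "tail_mean u G N' f F"
  using assms(1)
proof (induction rule: tail_mean.induct)
  case (tail n)
  with assms(2) show ?case by (intro tail_mean.tail) simp
next
  case (midpoint f F g K)
  then show ?case by (intro tail_mean.midpoint)
qed

text \<open>Balls are convex, so the elements of the tails converge wherever the original sequence
  does.\<close>

lemma tail_mean_near:
  assumes "tail_mean u G N f F" "\<And>n. n \<ge> N \<Longrightarrow> \<bar>u n x - l\<bar> \<le> s"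
  shows "\<bar>f x - l\<bar> \<le> s"
  using assms(1)
proof (induction rule: tail_mean.induct)
  case (midpoint f F g K)
  then show ?case unfolding abs_le_iff by (simp add: field_simps)
qed (use assms(2) in auto)

lemma integrable_norm_powr_add:
  fixes F K :: "'a::euclidean_space \<Rightarrow> 'b::euclidean_space"
  assumes p: "1 < p" and [measurable]: "F \<in> borel_measurable borel" "K \<in> borel_measurable borel"
    and i: "integrable lborel (\<lambda>x. norm (F x) powr p)" "integrable lborel (\<lambda>x. norm (K x) powr p)"
  shows "integrable lborel (\<lambda>x. norm ((F x + K x) /\<^sub>R 2) powr p)"
proof (rule Bochner_Integration.integrable_bound)
  show "integrable lborel (\<lambda>x. norm (F x) powr p + norm (K x) powr p)" using i by simp
  show "AE x in lborel. norm (norm ((F x + K x) /\<^sub>R 2) powr p) \<le> norm (norm (F x) powr p + norm (K x) powr p)"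
  proof (intro AE_I2)
    fix x
    have "norm ((F x + K x) /\<^sub>R 2) powr p \<le> (norm (F x) powr p + norm (K x) powr p) / 2"
      using convexity_gap_nonneg[OF p, of "F x" "K x"] by (simp add: convexity_gap_def)
    also have "\<dots> \<le> norm (F x) powr p + norm (K x) powr p" by simp
    finally show "norm (norm ((F x + K x) /\<^sub>R 2) powr p) \<le> norm (norm (F x) powr p + norm (K x) powr p)"
      by simp
  qed
qed measurable

lemma wgrad_midpoint:
  assumes "wgrad f F" "wgrad g K"
  shows "wgrad (\<lambda>x. (f x + g x) / 2) (\<lambda>x. (F x + K x) /\<^sub>R 2)"
proof -
  have l: "locint f" "locint g" "locint F" "locint K" using assms by (auto simp: wgrad_def)
  have 1: "locint (\<lambda>x. (f x + g x) / 2)"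
    using locint_cmult[OF locint_add[OF l(1,2)], of "1 / 2"] by simp
  have "integrable lborel (\<lambda>x. (1 / 2) *\<^sub>R (indicator (cball 0 R) x *\<^sub>R (F x + K x)))" for R
    using locint_add[OF l(3,4)] unfolding locint_def by (intro integrable_scaleR_right) auto
  then have 2: "locint (\<lambda>x. (F x + K x) /\<^sub>R 2)"
    using locint_measurable[OF l(3)] locint_measurable[OF l(4)]
    by (simp add: locint_def mult.commute)
  have "(LBINT x. (f x + g x) / 2 * frechet_derivative \<psi> (at x) h) = - (LBINT x. (((F x + K x) /\<^sub>R 2) \<bullet> h) * \<psi> x)"
    if \<psi>: "test_fun \<psi>" for \<psi> h
  proof -
    have "(LBINT x. (f x + g x) / 2 * frechet_derivative \<psi> (at x) h)
        = (LBINT x. (f x * frechet_derivative \<psi> (at x) h + g x * frechet_derivative \<psi> (at x) h) / 2)"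
      by (simp add: algebra_simps add_divide_distrib)
    also have "\<dots> = ((LBINT x. f x * frechet_derivative \<psi> (at x) h) + (LBINT x. g x * frechet_derivative \<psi> (at x) h)) / 2"
      using integrable_locint_test(2)[OF l(1) \<psi>, of h] integrable_locint_test(2)[OF l(2) \<psi>, of h] by simp
    also have "(LBINT x. f x * frechet_derivative \<psi> (at x) h) = - (LBINT x. (F x \<bullet> h) * \<psi> x)"
      using assms(1) \<psi> unfolding wgrad_def by blast
    also have "(LBINT x. g x * frechet_derivative \<psi> (at x) h) = - (LBINT x. (K x \<bullet> h) * \<psi> x)"
      using assms(2) \<psi> unfolding wgrad_def by blast
    also have "(- (LBINT x. (F x \<bullet> h) * \<psi> x) + - (LBINT x. (K x \<bullet> h) * \<psi> x)) / 2
        = - (((LBINT x. (F x \<bullet> h) * \<psi> x) + (LBINT x. (K x \<bullet> h) * \<psi> x)) / 2)"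
      by argo
    also have "\<dots> = - (LBINT x. ((F x \<bullet> h) * \<psi> x + (K x \<bullet> h) * \<psi> x) / 2)"
      using integrable_locint_test(1)[OF locint_inner[OF l(3)] \<psi>, of h]
        integrable_locint_test(1)[OF locint_inner[OF l(4)] \<psi>, of h] by simp
    also have "(LBINT x. ((F x \<bullet> h) * \<psi> x + (K x \<bullet> h) * \<psi> x) / 2) = (LBINT x. (((F x + K x) /\<^sub>R 2) \<bullet> h) * \<psi> x)"
      by (intro Bochner_Integration.integral_cong) (auto simp: inner_add_left field_simps)
    finally show ?thesis .
  qed
  with 1 2 show ?thesis by (auto simp: wgrad_def)
qed

lemma tail_mean_wgrad:
  assumes "tail_mean u G N f F" and p: "1 < p"
    and "\<And>n. wgrad (u n) (G n)" "\<And>n. integrable lborel (\<lambda>x. norm (G n x) powr p)"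
  shows "wgrad f F \<and> integrable lborel (\<lambda>x. norm (F x) powr p)"
  using assms(1)
proof (induction rule: tail_mean.induct)
  case (midpoint f F g K)
  have "F \<in> borel_measurable borel" "K \<in> borel_measurable borel"
    using midpoint.IH by (auto simp: wgrad_def locint_def)
  with midpoint.IH show ?case
    using wgrad_midpoint integrable_norm_powr_add[OF p] by blast
qed (use assms(3,4) in auto)

text \<open>Let \<open>a N\<close> be the infimum of the energy over the convex combinations of the
  tail from \<open>N\<close>. It increases with \<open>N\<close> to a limit
  \<open>L \<le> A\<close>. If \<open>F N\<close> is nearly optimal in the tail from
  \<open>N\<close>, then the midpoint of \<open>F i\<close> and \<open>F j\<close> still belongs
  to a tail, so its energy cannot be much below \<open>L\<close>; the convexity gap of
  \<open>F i\<close> and \<open>F j\<close> therefore has small integral, and by uniform convexity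
  these gradients form a Cauchy sequence in \<open>L\<^sup>p\<close>. The corresponding functions
  converge to \<open>v\<close>, so the limit of the gradients is the weak gradient of
  \<open>v\<close>, with energy at most \<open>L\<close>. No weak compactness is involved.\<close>

theorem wgrad_lower_semicontinuous:
  fixes u :: "nat \<Rightarrow> 'a::euclidean_space \<Rightarrow> real" and G :: "nat \<Rightarrow> 'a \<Rightarrow> 'a"
  assumes p: "1 < p" and wg: "\<And>n. wgrad (u n) (G n)"
    and fin: "\<And>n. integrable lborel (\<lambda>x. norm (G n x) powr p)"
    and A: "(\<lambda>n. LBINT x. norm (G n x) powr p) \<longlonglongrightarrow> A"
    and M: "\<And>n x. \<bar>u n x\<bar> \<le> M"
    and [measurable]: "v \<in> borel_measurable borel" and conv: "AE x in lborel. (\<lambda>n. u n x) \<longlonglongrightarrow> v x"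
  shows "\<exists>H. wgrad v H \<and> integrable lborel (\<lambda>x. norm (H x) powr p) \<and> (LBINT x. norm (H x) powr p) \<le> A"
proof -
  define E where "E F = (LBINT x. norm (F x) powr p)" for F :: "'a \<Rightarrow> 'a"
  have E0: "0 \<le> E F" for F by (simp add: E_def)
  define X where "X N = {E F | f F. tail_mean u G N f F}" for N
  have ne: "X N \<noteq> {}" for N using tail_mean.tail[of N N u G] by (auto simp: X_def)
  have bb: "bdd_below (X N)" for N using E0 by (auto simp: X_def intro!: bdd_belowI[of _ 0])
  define a where "a N = Inf (X N)" for N
  have a_le: "a N \<le> E F" if "tail_mean u G N f F" for N f F
    unfolding a_def using bb that by (intro cInf_lower) (auto simp: X_def)
  have a_mono: "a N \<le> a N'" if "N \<le> N'" for N N'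
    unfolding a_def using that bb ne
    by (intro cInf_superset_mono) (auto simp: X_def intro: tail_mean_antimono)
  have a_A: "a N \<le> A" for N
  proof (rule tendsto_lowerbound[OF A])
    show "\<forall>\<^sub>F n in sequentially. a N \<le> (LBINT x. norm (G n x) powr p)"
      using eventually_ge_at_top[of N]
      by eventually_elim (use a_le[OF tail_mean.tail] in \<open>auto simp: E_def\<close>)
  qed simp
  obtain L where L: "a \<longlonglongrightarrow> L" "\<And>i. a i \<le> L"
    using incseq_convergent[of a A] a_mono a_A by (auto simp: incseq_def)
  have LA: "L \<le> A" by (rule LIMSEQ_le_const2[OF L(1)]) (use a_A in auto)
  have "\<exists>f F. tail_mean u G N f F \<and> E F < a N + inverse (real (Suc N))" for N
  proof -
    have "\<exists>e\<in>X N. e < a N + inverse (real (Suc N))"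
      using cInf_lessD[OF ne[of N], of "a N + inverse (real (Suc N))"] by (auto simp: a_def)
    then show ?thesis by (auto simp: X_def)
  qed
  then obtain f F where fF: "\<And>N. tail_mean u G N (f N) (F N)" "\<And>N. E (F N) < a N + inverse (real (Suc N))"
    by metis
  have E_lim: "(\<lambda>N. E (F N)) \<longlonglongrightarrow> L"
  proof (rule tendsto_sandwich[OF _ _ L(1)])
    show "(\<lambda>N. a N + inverse (real (Suc N))) \<longlonglongrightarrow> L"
      using tendsto_add[OF L(1) LIMSEQ_inverse_real_of_nat] by simp
  qed (intro always_eventually allI a_le[OF fF(1)] less_imp_le[OF fF(2)])+
  have wgF: "wgrad (f N) (F N)" and iF: "integrable lborel (\<lambda>x. norm (F N x) powr p)" for N
    using tail_mean_wgrad[OF fF(1) p wg fin] by auto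
  have locF: "locint (F N)" and locf: "locint (f N)" for N using wgF[of N] by (auto simp: wgrad_def)
  note [measurable] = locint_measurable[OF locF] locint_measurable[OF locf]
  have Cauchy: "\<exists>N. \<forall>i\<ge>N. \<forall>j\<ge>N. (\<integral>\<^sup>+x. ennreal (norm (F i x - F j x) powr p) \<partial>lborel) \<le> ennreal e"
    if "e > 0" for e
  proof -
    have A0: "0 \<le> L" using E_lim E0 by (intro LIMSEQ_le_const[OF E_lim]) auto
    define \<eta> where "\<eta> = e / (4 * (L + 1))"
    have \<eta>: "\<eta> > 0" using \<open>e > 0\<close> A0 by (simp add: \<eta>_def)
    obtain C where C: "C \<ge> 0" "\<And>a b :: 'a.
      norm (a - b) powr p \<le> \<eta> * (norm a powr p + norm b powr p) + C * convexity_gap p a b"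
      using uniform_convexity[OF p \<eta>] by blast
    \<comment> \<open>All energies and infima involved lie within \<open>d\<close> of
      \<open>L\<close>, so the gap has integral at most \<open>2 * d\<close>.\<close>
    define d where "d = min 1 (e / (4 * (C + 1)))"
    have d: "d > 0" "d \<le> 1" "C * d \<le> e / 4"
    proof -
      have "C * d \<le> (C + 1) * (e / (4 * (C + 1)))" using C(1) \<open>e > 0\<close> by (intro mult_mono) (auto simp: d_def)
      also have "\<dots> = e / 4" using C(1) by (simp add: field_simps)
      finally show "C * d \<le> e / 4" .
    qed (use C(1) \<open>e > 0\<close> in \<open>auto simp: d_def\<close>)
    have "\<forall>\<^sub>F N in sequentially. E (F N) < L + d" "\<forall>\<^sub>F N in sequentially. L - d < a N"
      using order_tendstoD(2)[OF E_lim, of "L + d"] order_tendstoD(1)[OF L(1), of "L - d"] d(1) by auto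
    then have "\<forall>\<^sub>F N in sequentially. E (F N) < L + d \<and> L - d < a N"
      by (rule eventually_conj)
    then obtain N where N: "\<And>n. n \<ge> N \<Longrightarrow> E (F n) < L + d" "\<And>n. n \<ge> N \<Longrightarrow> L - d < a n"
      unfolding eventually_sequentially by blast
    have "(\<integral>\<^sup>+x. ennreal (norm (F i x - F j x) powr p) \<partial>lborel) \<le> ennreal e" if ij: "i \<ge> N" "j \<ge> N" for i j
    proof -
      define g where "g x = \<eta> * (norm (F i x) powr p + norm (F j x) powr p) + C * convexity_gap p (F i x) (F j x)" for x
      have imid: "integrable lborel (\<lambda>x. norm ((F i x + F j x) /\<^sub>R 2) powr p)"
        by (intro integrable_norm_powr_add p iF) measurable
      have ig: "integrable lborel g"
        unfolding g_def[abs_def] convexity_gap_def using iF imid by simp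
      have Ig: "(LBINT x. g x) = \<eta> * (E (F i) + E (F j)) + C * ((E (F i) + E (F j)) / 2 - E (\<lambda>x. (F i x + F j x) /\<^sub>R 2))"
        unfolding g_def convexity_gap_def E_def using iF imid by simp
      have "tail_mean u G N (\<lambda>x. (f i x + f j x) / 2) (\<lambda>x. (F i x + F j x) /\<^sub>R 2)"
        by (intro tail_mean.midpoint tail_mean_antimono[OF fF(1)] ij)
      from a_le[OF this] have "L - d < E (\<lambda>x. (F i x + F j x) /\<^sub>R 2)" using N(2)[of N] by simp
      then have "(E (F i) + E (F j)) / 2 - E (\<lambda>x. (F i x + F j x) /\<^sub>R 2) \<le> 2 * d"
        using N(1)[OF ij(1)] N(1)[OF ij(2)] by argo
      then have "C * ((E (F i) + E (F j)) / 2 - E (\<lambda>x. (F i x + F j x) /\<^sub>R 2)) \<le> C * (2 * d)"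
        using C(1) by (rule mult_left_mono)
      also have "\<dots> \<le> e / 2" using d(3) by simp
      finally have 1: "C * ((E (F i) + E (F j)) / 2 - E (\<lambda>x. (F i x + F j x) /\<^sub>R 2)) \<le> e / 2" .
      have "\<eta> * (E (F i) + E (F j)) \<le> \<eta> * (2 * (L + 1))"
        using N(1)[OF ij(1)] N(1)[OF ij(2)] d(2) \<eta> by (intro mult_left_mono) auto
      also have "\<dots> = e / 2" using A0 by (simp add: \<eta>_def field_simps)
      finally have "(LBINT x. g x) \<le> e" using 1 Ig by simp
      moreover have "(\<integral>\<^sup>+x. ennreal (norm (F i x - F j x) powr p) \<partial>lborel) \<le> (\<integral>\<^sup>+x. ennreal (g x) \<partial>lborel)"
        unfolding g_def by (intro nn_integral_mono ennreal_leI C)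
      moreover have "(\<integral>\<^sup>+x. ennreal (g x) \<partial>lborel) = ennreal (LBINT x. g x)"
      proof (rule nn_integral_eq_integral[OF ig], intro AE_I2)
        show "0 \<le> g x" for x
          by (rule order_trans[OF _ C(2)[of "F i x" "F j x", folded g_def]]) simp
      qed
      ultimately show ?thesis by (metis (no_types, lifting) ennreal_leI order_trans)
    qed
    then show ?thesis by blast
  qed
  obtain r H where r: "strict_mono (r :: nat \<Rightarrow> nat)" and H[measurable]: "H \<in> borel_measurable borel"
    and r_lim: "AE x in lborel. (\<lambda>i. F (r i) x) \<longlonglongrightarrow> H x"
    and H_lim: "\<And>e. e > 0 \<Longrightarrow> \<exists>N. \<forall>i\<ge>N. (\<integral>\<^sup>+x. ennreal (norm (F i x - H x) powr p) \<partial>lborel) \<le> ennreal e"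
    using Lp_complete[OF p _ iF Cauchy] by auto
  have "(\<integral>\<^sup>+x. ennreal (norm (H x) powr p) \<partial>lborel) \<le> liminf (\<lambda>i. \<integral>\<^sup>+x. ennreal (norm (F (r i) x) powr p) \<partial>lborel)"
  proof (rule Fatou_AE)
    show "AE x in lborel. (\<lambda>i. ennreal (norm (F (r i) x) powr p)) \<longlonglongrightarrow> ennreal (norm (H x) powr p)"
      using r_lim
    proof eventually_elim
      fix x assume "(\<lambda>i. F (r i) x) \<longlonglongrightarrow> H x"
      then show "(\<lambda>i. ennreal (norm (F (r i) x) powr p)) \<longlonglongrightarrow> ennreal (norm (H x) powr p)"
        using p by (intro tendsto_ennrealI tendsto_powr' tendsto_intros) auto
    qed
  qed measurable
  also have "(\<lambda>i. \<integral>\<^sup>+x. ennreal (norm (F (r i) x) powr p) \<partial>lborel) = (\<lambda>i. ennreal (E (F (r i))))"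
    using nn_integral_eq_integral[OF iF] by (simp add: E_def)
  also have "liminf (\<lambda>i. ennreal (E (F (r i)))) = ennreal L"
    by (intro lim_imp_Liminf tendsto_ennrealI LIMSEQ_subseq_LIMSEQ[OF E_lim r, unfolded o_def]) simp
  finally have HL: "(\<integral>\<^sup>+x. ennreal (norm (H x) powr p) \<partial>lborel) \<le> ennreal L" .
  then have Hfin: "(\<integral>\<^sup>+x. ennreal (norm (H x) powr p) \<partial>lborel) < \<infinity>"
    by (simp add: le_less_trans)
  have iH: "integrable lborel (\<lambda>x. norm (H x) powr p)"
    using Hfin by (intro integrableI_nonneg) auto
  have locH: "locint H" by (rule locint_if_Lp[OF p H Hfin])
  have f_conv: "AE x in lborel. (\<lambda>N. f N x) \<longlonglongrightarrow> v x"
    using conv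
  proof eventually_elim
    fix x assume *: "(\<lambda>n. u n x) \<longlonglongrightarrow> v x"
    show "(\<lambda>N. f N x) \<longlonglongrightarrow> v x"
    proof (rule LIMSEQ_I)
      fix e :: real assume "e > 0"
      then obtain N where N: "\<And>n. n \<ge> N \<Longrightarrow> \<bar>u n x - v x\<bar> < e / 2"
        using LIMSEQ_D[OF *, of "e / 2"] by auto
      have "\<bar>f n x - v x\<bar> \<le> e / 2" if "n \<ge> N" for n
        by (rule tail_mean_near[OF fF(1)[of n]], rule less_imp_le[OF N]) (use that in simp)
      then show "\<exists>N. \<forall>n\<ge>N. norm (f n x - v x) < e" using \<open>e > 0\<close> by (intro exI[of _ N]) force
    qed
  qed
  have fM: "\<bar>f N x\<bar> \<le> M" for N x
    using tail_mean_near[OF fF(1)[of N], of x 0 M] M by simp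
  have "AE x in lborel. \<bar>v x\<bar> \<le> M"
    using conv
  proof eventually_elim
    fix x assume *: "(\<lambda>n. u n x) \<longlonglongrightarrow> v x"
    show "\<bar>v x\<bar> \<le> M" by (rule tendsto_upperbound[OF tendsto_rabs[OF *]]) (use M in auto)
  qed
  have locv: "locint v"
    unfolding locint_def
  proof (intro conjI allI)
    fix R
    have [measurable]: "cball (0::'a) R \<in> sets borel" by simp
    show "integrable lborel (\<lambda>x. indicator (cball 0 R) x *\<^sub>R v x)"
    proof (rule Bochner_Integration.integrable_bound)
      have "locint (\<lambda>x::'a. M)" by (rule locint_const)
      then show "integrable lborel (\<lambda>x::'a. indicator (cball 0 R) x *\<^sub>R M)"
        unfolding locint_def by blast
      show "AE x in lborel. norm (indicator (cball 0 R) x *\<^sub>R v x) \<le> norm (indicator (cball 0 R) x *\<^sub>R M)"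
        using \<open>AE x in lborel. \<bar>v x\<bar> \<le> M\<close> by eventually_elim (auto simp: indicator_def)
    qed measurable
  qed measurable
  have "(LBINT x. v x * frechet_derivative \<psi> (at x) h) = - (LBINT x. (H x \<bullet> h) * \<psi> x)"
    if \<psi>: "test_fun \<psi>" for \<psi> h
  proof -
    have [measurable]: "(\<lambda>x. frechet_derivative \<psi> (at x) h) \<in> borel_measurable borel"
      using test_fun_continuous[OF \<psi>] by (auto intro: borel_measurable_continuous_onI)
    have 1: "(\<lambda>N. LBINT x. f N x * frechet_derivative \<psi> (at x) h) \<longlonglongrightarrow> (LBINT x. v x * frechet_derivative \<psi> (at x) h)"
    proof (rule integral_dominated_convergence)
      show "integrable lborel (\<lambda>x. norm (M * frechet_derivative \<psi> (at x) h))"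
        by (intro integrable_norm integrable_locint_test locint_const \<psi>)
      show "AE x in lborel. (\<lambda>N. f N x * frechet_derivative \<psi> (at x) h) \<longlonglongrightarrow> v x * frechet_derivative \<psi> (at x) h"
        using f_conv by eventually_elim (intro tendsto_intros)
      show "AE x in lborel. norm (f N x * frechet_derivative \<psi> (at x) h) \<le> norm (M * frechet_derivative \<psi> (at x) h)" for N
        using order_trans[OF fM abs_ge_self] by (intro AE_I2) (auto simp: abs_mult intro!: mult_right_mono)
    qed measurable
    have 2: "(\<lambda>N. LBINT x. (F N x \<bullet> h) * \<psi> x) \<longlonglongrightarrow> (LBINT x. (H x \<bullet> h) * \<psi> x)"
      by (rule integral_test_tendsto_if_Lp[OF p locF locH \<psi> H_lim])
    have "(LBINT x. f N x * frechet_derivative \<psi> (at x) h) = - (LBINT x. (F N x \<bullet> h) * \<psi> x)" for N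
      using wgF[of N] \<psi> by (simp add: wgrad_def)
    with LIMSEQ_unique[OF 1] tendsto_minus[OF 2] show ?thesis by simp
  qed
  then have "wgrad v H" using locv locH by (simp add: wgrad_def)
  moreover have "(LBINT x. norm (H x) powr p) \<le> A"
  proof -
    have "0 \<le> L" using E0 by (intro LIMSEQ_le_const[OF E_lim]) auto
    then have "(LBINT x. norm (H x) powr p) \<le> L"
      using HL nn_integral_eq_integral[OF iH] by simp
    then show ?thesis using LA by simp
  qed
  ultimately show ?thesis using iH by blast
qed

section \<open>Borel representatives of Sobolev functions\<close>

lemma lebesgue_borel_representative_real:
  fixes f :: "'a::euclidean_space \<Rightarrow> real"
  assumes "f \<in> borel_measurable lebesgue"
  shows "\<exists>f'\<in>borel_measurable borel. AE x in lborel. f x = f' x"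
  using completion_ex_borel_measurable_real[OF assms] by (simp only: measurable_lborel2)

lemma lebesgue_borel_representative:
  fixes f :: "'a::euclidean_space \<Rightarrow> 'b::euclidean_space"
  assumes f: "f \<in> borel_measurable lebesgue"
  shows "\<exists>f'\<in>borel_measurable borel. AE x in lborel. f x = f' x"
proof -
  have "\<exists>f'. f' \<in> borel_measurable borel \<and> (AE x in lborel. f x \<bullet> b = f' x)" for b
    using lebesgue_borel_representative_real[OF borel_measurable_inner[OF f borel_measurable_const], of b]
    unfolding Bex_def .
  then have "\<exists>f'. \<forall>b. f' b \<in> borel_measurable borel \<and> (AE x in lborel. f x \<bullet> b = f' b x)"
    by (intro choice allI)
  then obtain f' where *: "\<forall>b. f' b \<in> borel_measurable borel \<and> (AE x in lborel. f x \<bullet> b = f' b x)" ..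
  have f': "f' b \<in> borel_measurable borel" "AE x in lborel. f x \<bullet> b = f' b x" for b
    using spec[OF *, of b] by (rule conjunct1, rule conjunct2)
  have "AE x in lborel. \<forall>b\<in>Basis. f x \<bullet> b = f' b x"
    by (intro AE_finite_allI f'(2)) auto
  then have "AE x in lborel. f x = (\<Sum>b\<in>Basis. f' b x *\<^sub>R b)"
  proof eventually_elim
    fix x assume "\<forall>b\<in>Basis. f x \<bullet> b = f' b x"
    then have "(\<Sum>b\<in>Basis. f' b x *\<^sub>R b) = (\<Sum>b\<in>Basis. (f x \<bullet> b) *\<^sub>R b)"
      by (intro sum.cong) auto
    then show "f x = (\<Sum>b\<in>Basis. f' b x *\<^sub>R b)" by (simp add: euclidean_representation)
  qed
  moreover have "(\<lambda>x. \<Sum>b\<in>Basis. f' b x *\<^sub>R b) \<in> borel_measurable borel"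
    by (intro borel_measurable_sum borel_measurable_scaleR f'(1) borel_measurable_const)
  ultimately show ?thesis by (rule bexI)
qed

lemma locally_integrable_measurable:
  assumes "locally_integrable f"
  shows "f \<in> borel_measurable lebesgue"
proof (rule borel_measurable_LIMSEQ_metric)
  show "(\<lambda>x. indicat_real (cball 0 (real n)) x *\<^sub>R f x) \<in> borel_measurable lebesgue" for n
    by (rule borel_measurable_integrable)
      (use assms in \<open>auto simp: locally_integrable_def set_integrable_def\<close>)
  show "(\<lambda>n. indicat_real (cball 0 (real n)) x *\<^sub>R f x) \<longlonglongrightarrow> f x" for x
  proof (rule tendsto_eventually)
    obtain N :: nat where N: "norm x \<le> real N" using real_arch_simple by blast
    show "\<forall>\<^sub>F n in sequentially. indicat_real (cball 0 (real n)) x *\<^sub>R f x = f x"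
      using eventually_ge_at_top[of N] by eventually_elim (use N in auto)
  qed
qed

lemma borel_imp_lebesgue_measurable:
  "f \<in> borel_measurable borel \<Longrightarrow> f \<in> borel_measurable lebesgue"
  by (rule measurable_completion) (simp only: measurable_lborel2)

lemma locint_if_locally_integrable:
  assumes "locally_integrable f" and f': "f' \<in> borel_measurable borel" and ae: "AE x in lborel. f x = f' x"
  shows "locint f'"
  unfolding locint_def
proof (intro conjI allI f')
  fix R
  have m: "indicat_real (cball 0 R) \<in> borel_measurable borel" by (rule borel_measurable_indicator) simp
  have "integrable lebesgue (\<lambda>x. indicat_real (cball 0 R) x *\<^sub>R f x)"
    using assms(1) unfolding locally_integrable_def set_integrable_def by auto
  then have "integrable lebesgue (\<lambda>x. indicat_real (cball 0 R) x *\<^sub>R f' x)"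
    by (rule integrable_cong_AE_imp)
      (use AE_completion[OF ae] f' m in \<open>auto intro!: borel_imp_lebesgue_measurable borel_measurable_scaleR\<close>)
  then show "integrable lborel (\<lambda>x. indicat_real (cball 0 R) x *\<^sub>R f' x)"
    using f' m by (subst (asm) integrable_completion) (auto intro: borel_measurable_scaleR)
qed

lemma locally_integrable_if_locint:
  assumes "locint f"
  shows "locally_integrable f"
  unfolding locally_integrable_def
proof (intro allI impI)
  fix K :: "'a set" assume "compact K"
  then obtain R where R: "K \<subseteq> cball 0 R"
    using bounded_subset_cball0[OF compact_imp_bounded[OF \<open>compact K\<close>]] by blast
  have f: "f \<in> borel_measurable borel" by (rule locint_measurable[OF assms])
  have m: "indicat_real (cball (0::'a) R) \<in> borel_measurable borel" by (rule borel_measurable_indicator) simp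
  have "integrable lebesgue (\<lambda>x. indicat_real (cball 0 R) x *\<^sub>R f x)"
    using assms f m by (subst integrable_completion) (auto simp: locint_def intro: borel_measurable_scaleR)
  then have "set_integrable lebesgue (cball 0 R) f" by (simp add: set_integrable_def)
  then show "set_integrable lebesgue K f"
    by (rule set_integrable_subset) (use R \<open>compact K\<close> in \<open>auto intro: lmeasurable_compact fmeasurableD\<close>)
qed

text \<open>Testing in the coordinate directions suffices, as both sides are linear in the
  direction.\<close>

lemma wgrad_if_has_weak_gradient:
  fixes v :: "real ^ 'n \<Rightarrow> real"
  assumes wg: "has_weak_gradient v G"
    and [measurable]: "v' \<in> borel_measurable borel" "G' \<in> borel_measurable borel"
    and ae: "AE x in lborel. v x = v' x" "AE x in lborel. G x = G' x"
  shows "wgrad v' G'"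
proof -
  have l: "locally_integrable v" "locally_integrable G"
    using wg unfolding has_weak_gradient_def by blast+
  have l': "locint v'" "locint G'"
    using locint_if_locally_integrable[OF l(1) assms(2) ae(1)]
      locint_if_locally_integrable[OF l(2) assms(3) ae(2)] by blast+
  have axis: "(LBINT x. v' x * frechet_derivative \<psi> (at x) b) = - (LBINT x. (G' x \<bullet> b) * \<psi> x)"
    if \<psi>: "test_fun \<psi>" and b: "b \<in> Basis" for \<psi> b
  proof -
    note [measurable] = test_fun_borel[OF \<psi>]
    have mL: "v \<in> borel_measurable lebesgue" "G \<in> borel_measurable lebesgue"
      "v' \<in> borel_measurable lebesgue" "G' \<in> borel_measurable lebesgue"
      "\<psi> \<in> borel_measurable lebesgue" "(\<lambda>x. frechet_derivative \<psi> (at x) b) \<in> borel_measurable lebesgue"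
      by (rule locally_integrable_measurable l borel_imp_lebesgue_measurable assms(2,3) test_fun_borel \<psi>)+
    obtain i where i: "b = axis i 1" using b by (auto simp: Basis_vec_def)
    have "(LBINT x. v' x * frechet_derivative \<psi> (at x) b) = (LINT x|lebesgue. v' x * frechet_derivative \<psi> (at x) b)"
      by (subst integral_completion) auto
    also have "\<dots> = (LINT x|lebesgue. v x * frechet_derivative \<psi> (at x) b)"
      using AE_completion[OF ae(1)]
      by (intro integral_cong_AE borel_measurable_times mL) auto
    also have "\<dots> = - (LINT x|lebesgue. (G x \<bullet> b) * \<psi> x)"
      using wg \<psi> unfolding has_weak_gradient_def test_fun_def i by (simp add: inner_axis)
    also have "(LINT x|lebesgue. (G x \<bullet> b) * \<psi> x) = (LINT x|lebesgue. (G' x \<bullet> b) * \<psi> x)"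
      using AE_completion[OF ae(2)]
      by (intro integral_cong_AE borel_measurable_times borel_measurable_inner borel_measurable_const mL) auto
    also have "\<dots> = (LBINT x. (G' x \<bullet> b) * \<psi> x)"
      by (subst integral_completion) auto
    finally show ?thesis .
  qed
  have "(LBINT x. v' x * frechet_derivative \<psi> (at x) h) = - (LBINT x. (G' x \<bullet> h) * \<psi> x)"
    if \<psi>: "test_fun \<psi>" for \<psi> h
  proof -
    have lin: "linear (frechet_derivative \<psi> (at x))" for x
      using test_fun_differentiable[OF \<psi>] has_derivative_linear by blast
    have "frechet_derivative \<psi> (at x) h = (\<Sum>b\<in>Basis. (h \<bullet> b) * frechet_derivative \<psi> (at x) b)" for x
      using linear_sum[OF lin[of x], of "\<lambda>b. (h \<bullet> b) *\<^sub>R b" Basis]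
      by (simp add: euclidean_representation linear_scale[OF lin])
    then have "(LBINT x. v' x * frechet_derivative \<psi> (at x) h)
        = (LBINT x. (\<Sum>b\<in>Basis. (h \<bullet> b) * (v' x * frechet_derivative \<psi> (at x) b)))"
      by (simp add: sum_distrib_left mult_ac)
    also have "\<dots> = (\<Sum>b\<in>Basis. (h \<bullet> b) * (LBINT x. v' x * frechet_derivative \<psi> (at x) b))"
      using integrable_locint_test(2)[OF l'(1) \<psi>] by (subst Bochner_Integration.integral_sum) auto
    also have "\<dots> = - (\<Sum>b\<in>Basis. (h \<bullet> b) * (LBINT x. (G' x \<bullet> b) * \<psi> x))"
      by (simp add: axis[OF \<psi>] sum_negf)
    also have "(\<Sum>b\<in>Basis. (h \<bullet> b) * (LBINT x. (G' x \<bullet> b) * \<psi> x))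
        = (LBINT x. (\<Sum>b\<in>Basis. (h \<bullet> b) * ((G' x \<bullet> b) * \<psi> x)))"
      using integrable_locint_test(1)[OF locint_inner[OF l'(2)] \<psi>]
      by (subst Bochner_Integration.integral_sum) auto
    also have "\<dots> = (LBINT x. (G' x \<bullet> h) * \<psi> x)"
      by (intro Bochner_Integration.integral_cong)
        (auto simp: euclidean_inner[of "G' _" h] sum_distrib_left sum_distrib_right mult_ac)
    finally show ?thesis .
  qed
  with l' show ?thesis by (simp add: wgrad_def)
qed

lemma has_weak_gradient_if_wgrad:
  fixes v :: "real ^ 'n \<Rightarrow> real"
  assumes wg: "wgrad v G"
  shows "has_weak_gradient v G"
proof -
  have l: "locint v" "locint G" using wg by (auto simp: wgrad_def)
  note [measurable] = locint_measurable[OF l(1)] locint_measurable[OF l(2)]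
  have "(LINT x|lebesgue. v x * frechet_derivative \<psi> (at x) (axis i 1)) = - (LINT x|lebesgue. G x $ i * \<psi> x)"
    if \<psi>: "test_fun \<psi>" for \<psi> i
  proof -
    note [measurable] = test_fun_borel[OF \<psi>]
    have "(LINT x|lebesgue. v x * frechet_derivative \<psi> (at x) (axis i 1)) = (LBINT x. v x * frechet_derivative \<psi> (at x) (axis i 1))"
      by (subst integral_completion) auto
    also have "\<dots> = - (LBINT x. (G x \<bullet> axis i 1) * \<psi> x)" using wg \<psi> by (simp add: wgrad_def)
    also have "(LBINT x. (G x \<bullet> axis i 1) * \<psi> x) = (LINT x|lebesgue. (G x \<bullet> axis i 1) * \<psi> x)"
      by (subst integral_completion) auto
    finally show ?thesis by (simp add: inner_axis)
  qed
  then show ?thesis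
    using l by (auto simp: has_weak_gradient_def test_fun_def intro: locally_integrable_if_locint)
qed

lemma in_Lp_borel:
  assumes "f \<in> borel_measurable borel"
  shows "in_Lp p f \<longleftrightarrow> integrable lborel (\<lambda>x. norm (f x) powr p)"
proof -
  have "(\<lambda>x. norm (f x) powr p) \<in> borel_measurable lborel" using assms by simp
  from integrable_completion[OF this] show ?thesis
    using borel_imp_lebesgue_measurable[OF assms] unfolding in_Lp_def by blast
qed

lemma in_Lp_cong_AE:
  assumes "in_Lp p f" "f' \<in> borel_measurable borel" "AE x in lborel. f x = f' x"
  shows "integrable lborel (\<lambda>x. norm (f' x) powr p)"
proof -
  have "integrable lebesgue (\<lambda>x. norm (f x) powr p)" using assms(1) by (simp add: in_Lp_def)
  then have "integrable lebesgue (\<lambda>x. norm (f' x) powr p)"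
  proof (rule integrable_cong_AE_imp)
    show "(\<lambda>x. norm (f' x) powr p) \<in> borel_measurable lebesgue"
      using assms(2) by (intro borel_imp_lebesgue_measurable) measurable
    show "AE x in lebesgue. norm (f x) powr p = norm (f' x) powr p"
      using AE_completion[OF assms(3)] by eventually_elim simp
  qed
  then show ?thesis using in_Lp_borel[OF assms(2), of p] borel_imp_lebesgue_measurable[OF assms(2)]
    unfolding in_Lp_def by blast
qed

text \<open>A function in \<open>W\<^sup>1\<^sup>,\<^sup>p\<close> together with its gradient, by
  Borel representatives.\<close>

definition sobolev_pair :: "real \<Rightarrow> ('a::euclidean_space \<Rightarrow> real) \<Rightarrow> ('a \<Rightarrow> 'a) \<Rightarrow> bool" where
  "sobolev_pair p v G \<longleftrightarrow> wgrad v G \<and>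
     integrable lborel (\<lambda>x. \<bar>v x\<bar> powr p) \<and> integrable lborel (\<lambda>x. norm (G x) powr p)"

text \<open>The gradient that \<open>weak_grad\<close> chooses need not be the one known to be in
  \<open>L\<^sup>p\<close>; by uniqueness the two agree almost everywhere.\<close>

lemma sobolev_pair_if_W1p:
  fixes v :: "real ^ 'n \<Rightarrow> real"
  assumes "v \<in> W1p p"
  shows "\<exists>v' G'. sobolev_pair p v' G' \<and> (AE x in lborel. v x = v' x) \<and> (AE x in lborel. weak_grad v x = G' x)"
proof -
  obtain G where v: "in_Lp p v" and wg: "has_weak_gradient v G" and G: "in_Lp p G"
    using assms by (auto simp: W1p_def)
  have wg2: "has_weak_gradient v (weak_grad v)"
    unfolding weak_grad_def by (rule someI[of "has_weak_gradient v", OF wg])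
  have m: "v \<in> borel_measurable lebesgue" "G \<in> borel_measurable lebesgue" "weak_grad v \<in> borel_measurable lebesgue"
    using wg wg2 by (auto simp: has_weak_gradient_def intro: locally_integrable_measurable)
  obtain v' where v': "v' \<in> borel_measurable borel" "AE x in lborel. v x = v' x"
    using lebesgue_borel_representative[OF m(1)] by blast
  obtain G' where G': "G' \<in> borel_measurable borel" "AE x in lborel. G x = G' x"
    using lebesgue_borel_representative[OF m(2)] by blast
  obtain G2 where G2: "G2 \<in> borel_measurable borel" "AE x in lborel. weak_grad v x = G2 x"
    using lebesgue_borel_representative[OF m(3)] by blast
  have 1: "wgrad v' G'" by (rule wgrad_if_has_weak_gradient[OF wg v'(1) G'(1) v'(2) G'(2)])
  have 2: "wgrad v' G2" by (rule wgrad_if_has_weak_gradient[OF wg2 v'(1) G2(1) v'(2) G2(2)])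
  have "AE x in lborel. weak_grad v x = G' x"
    using wgrad_unique[OF 1 2] G2(2) by eventually_elim simp
  moreover have "sobolev_pair p v' G'"
    using 1 in_Lp_cong_AE[OF v v'] in_Lp_cong_AE[OF G G'] by (simp add: sobolev_pair_def)
  ultimately show ?thesis using v'(2) by blast
qed

lemma W1p_if_sobolev_pair:
  fixes v :: "real ^ 'n \<Rightarrow> real"
  assumes "sobolev_pair p v G"
  shows "v \<in> W1p p"
proof -
  have wg: "wgrad v G" using assms by (simp add: sobolev_pair_def)
  then have m: "v \<in> borel_measurable borel" "G \<in> borel_measurable borel"
    unfolding wgrad_def locint_def by blast+
  have "in_Lp p v" "in_Lp p G"
    unfolding in_Lp_borel[OF m(1)] in_Lp_borel[OF m(2)]
    using assms by (simp_all add: sobolev_pair_def)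
  then show ?thesis
    using has_weak_gradient_if_wgrad[OF wg] unfolding W1p_def by blast
qed

lemma weak_grad_sobolev_pair:
  fixes v :: "real ^ 'n \<Rightarrow> real"
  assumes "sobolev_pair p v G"
  shows "AE x in lborel. weak_grad v x = G x"
proof -
  obtain v' G' where v': "sobolev_pair p v' G'" "AE x in lborel. v x = v' x" "AE x in lborel. weak_grad v x = G' x"
    using sobolev_pair_if_W1p[OF W1p_if_sobolev_pair[OF assms]] by blast
  have wg: "wgrad v G" "wgrad v' G'" using assms v' by (auto simp: sobolev_pair_def)
  then have "wgrad v' G"
    using v'(2) by (intro wgrad_cong_AE[OF wg(1) v'(2)]) (auto simp: wgrad_def locint_def)
  from wgrad_unique[OF this wg(2)] v'(3) show ?thesis by eventually_elim simp
qed

lemma h_delta_eq: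
  assumes "\<delta> > 0"
  shows "h_delta \<delta> t = max 0 (min 1 (t / \<delta>))"
proof (cases "t \<le> 0")
  case True
  then have "t / \<delta> \<le> 0" using assms by (simp add: divide_le_0_iff)
  with True show ?thesis by (simp add: h_delta_def)
next
  case False
  then have "0 < t / \<delta>" "t \<ge> \<delta> \<longleftrightarrow> t / \<delta> \<ge> 1" using assms by (simp_all add: le_divide_eq)
  with False show ?thesis by (simp add: h_delta_def min_def)
qed

lemma f_eps_max_min:
  "f_eps \<gamma> \<epsilon> (ereal t) = ereal (1 / \<epsilon> * max (t - \<gamma>) 0 + \<epsilon> * min (t - \<gamma>) 0)"
  unfolding f_eps_ereal by (cases "t \<ge> \<gamma>") (simp_all add: max_def min_def)

lemma f_eps_mono:
  assumes e: "\<epsilon> > 0" and a: "0 \<le> a" and ab: "a \<le> b"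
  shows "f_eps \<gamma> \<epsilon> a \<le> f_eps \<gamma> \<epsilon> b"
proof (cases "b = \<infinity>")
  case True
  then show ?thesis using f_eps_PInfty[OF e] by simp
next
  case False
  then obtain s where s: "b = ereal s" using a ab by (cases b) auto
  then obtain r where r: "a = ereal r" using a ab by (cases a) auto
  have "r \<le> s" using ab r s by simp
  then have "1 / \<epsilon> * max (r - \<gamma>) 0 + \<epsilon> * min (r - \<gamma>) 0 \<le> 1 / \<epsilon> * max (s - \<gamma>) 0 + \<epsilon> * min (s - \<gamma>) 0"
    using e by (intro add_mono mult_left_mono) auto
  then show ?thesis unfolding r s f_eps_max_min by simp
qed

section \<open>The penalised functional\<close>

text \<open>The functional on pairs of a function and its gradient, with respect to Borel-Lebesgue
  measure.\<close>

definition J_pair ::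
  "real \<Rightarrow> 'a::euclidean_space set \<Rightarrow> ('a \<Rightarrow> real) \<Rightarrow> real \<Rightarrow> (real \<Rightarrow> real) \<Rightarrow> real \<Rightarrow> real \<Rightarrow>
   ('a \<Rightarrow> real) \<Rightarrow> ('a \<Rightarrow> 'a) \<Rightarrow> ereal" where
  "J_pair p \<Omega> \<phi> \<gamma> g \<delta> \<epsilon> v G =
     enn2ereal (\<integral>\<^sup>+ x. ennreal (1 / p * norm (G x) powr p + g (v x - \<phi> x)) \<partial>lborel)
     + f_eps \<gamma> \<epsilon> (enn2ereal (\<integral>\<^sup>+ x \<in> - \<Omega>. ennreal (h_delta \<delta> (v x)) \<partial>lborel))"

lemma J_fun_eq_J_pair:
  assumes "AE x in lborel. v x = v' x" "AE x in lborel. weak_grad v x = G' x"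
  shows "J_fun p \<Omega> \<phi> \<gamma> g \<delta> \<epsilon> v = J_pair p \<Omega> \<phi> \<gamma> g \<delta> \<epsilon> v' G'"
proof -
  have "(\<integral>\<^sup>+ x. ennreal (1 / p * norm (weak_grad v x) powr p + g (v x - \<phi> x)) \<partial>lborel)
      = (\<integral>\<^sup>+ x. ennreal (1 / p * norm (G' x) powr p + g (v' x - \<phi> x)) \<partial>lborel)"
    by (rule nn_integral_cong_AE) (use assms in eventually_elim, simp)
  moreover have "(\<integral>\<^sup>+ x \<in> - \<Omega>. ennreal (h_delta \<delta> (v x)) \<partial>lborel) = (\<integral>\<^sup>+ x \<in> - \<Omega>. ennreal (h_delta \<delta> (v' x)) \<partial>lborel)"
    by (rule nn_integral_cong_AE) (use assms(1) in eventually_elim, simp)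
  ultimately show ?thesis by (simp add: J_fun_def J_pair_def nn_integral_completion)
qed

text \<open>The data of the problem, reduced to what the variational argument uses: \<open>M\<close>
  is an upper bound for the obstacle, which has bounded support.\<close>

locale obstacle_functional =
  fixes p \<gamma> \<delta> \<epsilon> M :: real and \<Omega> :: "'a::euclidean_space set" and \<phi> :: "'a \<Rightarrow> real" and g :: "real \<Rightarrow> real"
  assumes p: "1 < p" and \<delta>: "\<delta> > 0" and \<epsilon>: "\<epsilon> > 0" and \<gamma>: "\<gamma> > 0"
    and \<Omega>: "\<Omega> \<in> sets borel" "bounded \<Omega>"
    and \<phi>_cont: "continuous_on UNIV \<phi>" and \<phi>: "\<And>x. 0 \<le> \<phi> x" "\<And>x. \<phi> x \<le> M"
    and \<phi>_supp: "\<exists>R. \<forall>x. x \<notin> cball 0 R \<longrightarrow> \<phi> x = 0"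
    and g_cont: "continuous_on UNIV g" and g: "\<And>t. 0 \<le> g t" "antimono g" "\<And>t. 0 \<le> t \<Longrightarrow> g t = 0"
begin

abbreviation "J \<equiv> J_pair p \<Omega> \<phi> \<gamma> g \<delta> \<epsilon>"

definition dirichlet :: "('a \<Rightarrow> 'a) \<Rightarrow> ennreal" where
  "dirichlet G = (\<integral>\<^sup>+x. ennreal (1 / p * norm (G x) powr p) \<partial>lborel)"

definition penalty :: "('a \<Rightarrow> real) \<Rightarrow> ennreal" where
  "penalty v = (\<integral>\<^sup>+x. ennreal (g (v x - \<phi> x)) \<partial>lborel)"

text \<open>The real values of \<open>f_eps\<close>, in a form from which monotonicity and
  continuity can be read off.\<close>

definition volume_cost :: "real \<Rightarrow> real" where
  "volume_cost V = 1 / \<epsilon> * max (V - \<gamma>) 0 + \<epsilon> * min (V - \<gamma>) 0"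

lemma f_eps_volume_cost: "f_eps \<gamma> \<epsilon> (ereal V) = ereal (volume_cost V)"
  by (simp only: f_eps_max_min volume_cost_def)

lemma volume_cost_mono: "s \<le> t \<Longrightarrow> volume_cost s \<le> volume_cost t"
  unfolding volume_cost_def using \<epsilon> by (intro add_mono mult_left_mono) auto

definition volume :: "('a \<Rightarrow> real) \<Rightarrow> ennreal" where
  "volume v = (\<integral>\<^sup>+x\<in>-\<Omega>. ennreal (h_delta \<delta> (v x)) \<partial>lborel)"

lemma measurable_data [measurable]:
  "\<phi> \<in> borel_measurable borel" "g \<in> borel_measurable borel" "h_delta \<delta> \<in> borel_measurable borel"
  "\<Omega> \<in> sets borel"
proof -
  show "\<phi> \<in> borel_measurable borel" "g \<in> borel_measurable borel"
    using \<phi>_cont g_cont by (auto intro: borel_measurable_continuous_onI)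
  show "h_delta \<delta> \<in> borel_measurable borel"
    unfolding h_delta_eq[OF \<delta>, abs_def] by measurable
qed (rule \<Omega>)

lemma M_nonneg: "0 \<le> M" using \<phi>[of 0] by linarith

lemma J_split:
  assumes [measurable]: "v \<in> borel_measurable borel" "G \<in> borel_measurable borel"
  shows "J v G = enn2ereal (dirichlet G + penalty v) + f_eps \<gamma> \<epsilon> (enn2ereal (volume v))"
proof -
  have "(\<integral>\<^sup>+ x. ennreal (1 / p * norm (G x) powr p + g (v x - \<phi> x)) \<partial>lborel)
      = (\<integral>\<^sup>+ x. ennreal (1 / p * norm (G x) powr p) + ennreal (g (v x - \<phi> x)) \<partial>lborel)"
    using p g(1) by (intro nn_integral_cong ennreal_plus) auto
  also have "\<dots> = dirichlet G + penalty v"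
    unfolding dirichlet_def penalty_def by (rule nn_integral_add) measurable
  finally show ?thesis by (simp add: J_pair_def volume_def)
qed

lemma sobolev_pair_measurable:
  assumes "sobolev_pair p v G"
  shows "v \<in> borel_measurable borel" "G \<in> borel_measurable borel"
  using assms by (auto simp: sobolev_pair_def wgrad_def dest: locint_measurable)

lemma h_delta_bounds: "0 \<le> h_delta \<delta> t" "h_delta \<delta> t \<le> 1"
  unfolding h_delta_eq[OF \<delta>] by auto

lemma h_delta_mono: "s \<le> t \<Longrightarrow> h_delta \<delta> s \<le> h_delta \<delta> t"
  unfolding h_delta_eq[OF \<delta>] using \<delta> by (intro max.mono min.mono divide_right_mono) auto

abbreviation trunc :: "('a \<Rightarrow> real) \<Rightarrow> 'a \<Rightarrow> real" where
  "trunc v \<equiv> \<lambda>x. min (max (v x) 0) M"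

abbreviation trunc_grad :: "('a \<Rightarrow> real) \<Rightarrow> ('a \<Rightarrow> 'a) \<Rightarrow> 'a \<Rightarrow> 'a" where
  "trunc_grad v G \<equiv> \<lambda>x. (if 0 < v x \<and> v x < M then 1 else 0) *\<^sub>R G x"

lemma sobolev_pair_trunc:
  assumes v: "sobolev_pair p v G"
  shows "sobolev_pair p (trunc v) (trunc_grad v G)"
proof -
  note [measurable] = sobolev_pair_measurable[OF v]
  have "integrable lborel (\<lambda>x. \<bar>trunc v x\<bar> powr p)"
  proof (rule Bochner_Integration.integrable_bound)
    show "integrable lborel (\<lambda>x. \<bar>v x\<bar> powr p)" using v by (simp add: sobolev_pair_def)
    show "AE x in lborel. norm (\<bar>trunc v x\<bar> powr p) \<le> norm (\<bar>v x\<bar> powr p)"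
      using p M_nonneg by (intro AE_I2) (auto intro!: powr_mono2)
  qed measurable
  moreover have "integrable lborel (\<lambda>x. norm (trunc_grad v G x) powr p)"
  proof (rule Bochner_Integration.integrable_bound)
    show "integrable lborel (\<lambda>x. norm (G x) powr p)" using v by (simp add: sobolev_pair_def)
  qed auto
  ultimately show ?thesis
    using v wgrad_truncate[of v G M] by (simp add: sobolev_pair_def)
qed

text \<open>Below 0 the truncation raises the function towards the obstacle, which lowers the
  decreasing penalty; above \<open>M\<close> the penalty vanishes before and after, as the obstacle
  is at most \<open>M\<close>. The volume term is nondecreasing in the value and zero for negative
  values.\<close>

lemma trunc_decreases:
  shows "dirichlet (trunc_grad v G) \<le> dirichlet G" "penalty (trunc v) \<le> penalty v" "volume (trunc v) \<le> volume v"
proof -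
  show "dirichlet (trunc_grad v G) \<le> dirichlet G"
    unfolding dirichlet_def using p by (intro nn_integral_mono) (auto intro!: ennreal_leI)
  have "g (trunc v x - \<phi> x) \<le> g (v x - \<phi> x)" for x
  proof (cases "v x \<le> M")
    case True
    then have "v x - \<phi> x \<le> trunc v x - \<phi> x" by simp
    with g(2) show ?thesis by (rule antimonoD)
  next
    case False
    then have "g (trunc v x - \<phi> x) = 0" using \<phi>(2)[of x] M_nonneg by (intro g(3)) auto
    then show ?thesis using g(1) by simp
  qed
  then show "penalty (trunc v) \<le> penalty v"
    unfolding penalty_def by (intro nn_integral_mono ennreal_leI)
  have "h_delta \<delta> (trunc v x) \<le> h_delta \<delta> (v x)" for x
  proof (cases "v x \<le> 0")
    case True
    then have "h_delta \<delta> (trunc v x) = 0" using M_nonneg by (simp add: h_delta_def)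
    then show ?thesis using h_delta_bounds(1) by simp
  qed (auto intro: h_delta_mono)
  then show "volume (trunc v) \<le> volume v"
    unfolding volume_def by (intro nn_integral_mono mult_right_mono ennreal_leI) auto
qed

lemma J_trunc_le:
  assumes v: "sobolev_pair p v G"
  shows "J (trunc v) (trunc_grad v G) \<le> J v G"
  unfolding J_split[OF sobolev_pair_measurable[OF v]] J_split[OF sobolev_pair_measurable[OF sobolev_pair_trunc[OF v]]]
  by (intro add_mono f_eps_mono \<epsilon>)
    (auto simp: less_eq_ennreal.rep_eq[symmetric] intro!: add_mono trunc_decreases)

lemma J_lower_bound:
  assumes "sobolev_pair p v G"
  shows "ereal (- \<epsilon> * \<gamma>) \<le> J v G"
proof -
  have "f_eps \<gamma> \<epsilon> 0 \<le> f_eps \<gamma> \<epsilon> (enn2ereal (volume v))"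
    by (intro f_eps_mono \<epsilon>) auto
  moreover have "f_eps \<gamma> \<epsilon> 0 = ereal (- \<epsilon> * \<gamma>)"
    using f_eps_max_min[of \<gamma> \<epsilon> 0, folded zero_ereal_def] \<gamma> by simp
  moreover have "0 \<le> enn2ereal (dirichlet G + penalty v)" by simp
  ultimately show ?thesis unfolding J_split[OF sobolev_pair_measurable[OF assms]]
    by (metis add_mono add.left_neutral)
qed

lemma sobolev_pair_zero: "sobolev_pair p (\<lambda>x::'a. 0) (\<lambda>x. 0)"
proof -
  have "locint (\<lambda>x::'a. 0::real)" "locint (\<lambda>x::'a. 0::'a)" by (rule locint_const)+
  then show ?thesis by (simp add: sobolev_pair_def wgrad_def)
qed

lemma J_zero_finite: "J (\<lambda>x. 0) (\<lambda>x. 0) < \<infinity>"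
proof -
  obtain R where R: "\<And>x. x \<notin> cball 0 R \<Longrightarrow> \<phi> x = 0" using \<phi>_supp by blast
  have "penalty (\<lambda>x. 0) \<le> (\<integral>\<^sup>+x. ennreal (g (- M)) * indicator (cball (0::'a) R) x \<partial>lborel)"
    unfolding penalty_def
  proof (rule nn_integral_mono)
    fix x :: 'a
    show "ennreal (g (0 - \<phi> x)) \<le> ennreal (g (- M)) * indicator (cball 0 R) x"
    proof (cases "x \<in> cball 0 R")
      case True
      have "g (0 - \<phi> x) \<le> g (- M)" using \<phi>(2)[of x] by (intro antimonoD[OF g(2)]) simp
      with True show ?thesis by (simp add: ennreal_leI)
    next
      case False
      then show ?thesis using R[of x] g(3)[of 0] by simp
    qed
  qed
  also have "\<dots> = ennreal (g (- M)) * emeasure lborel (cball (0::'a) R)"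
    by (rule nn_integral_cmult_indicator) simp
  also have "\<dots> < \<infinity>"
    using emeasure_bounded_finite[OF bounded_cball, of "0::'a" R] by (simp add: ennreal_mult_less_top)
  finally have "penalty (\<lambda>x. 0) < \<infinity>" .
  moreover have "dirichlet (\<lambda>x. 0) = 0" using p by (simp add: dirichlet_def)
  moreover have "volume (\<lambda>x. 0) = 0" by (simp add: volume_def h_delta_def)
  moreover have "f_eps \<gamma> \<epsilon> 0 = ereal (- \<epsilon> * \<gamma>)"
    using f_eps_max_min[of \<gamma> \<epsilon> 0, folded zero_ereal_def] \<gamma> by simp
  moreover have "J (\<lambda>x. 0) (\<lambda>x. 0) = enn2ereal (dirichlet (\<lambda>x. 0) + penalty (\<lambda>x. 0)) + f_eps \<gamma> \<epsilon> (enn2ereal (volume (\<lambda>x. 0)))"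
    by (rule J_split) simp_all
  ultimately show ?thesis
    by (cases "penalty (\<lambda>x. 0)") (auto simp: enn2ereal_ennreal zero_ennreal.rep_eq)
qed

text \<open>All three terms of a finite value are finite, because the volume term is bounded
  below.\<close>

lemma J_real:
  assumes v: "sobolev_pair p v G" and J: "J v G < \<infinity>"
  obtains D P V where "0 \<le> D" "0 \<le> P" "0 \<le> V" "dirichlet G = ennreal D" "penalty v = ennreal P" "volume v = ennreal V"
    "J v G = ereal (D + P + volume_cost V)"
proof -
  note eq = J_split[OF sobolev_pair_measurable[OF v]]
  have "volume v \<noteq> \<infinity>"
  proof
    assume "volume v = \<infinity>"
    then have "f_eps \<gamma> \<epsilon> (enn2ereal (volume v)) = \<infinity>" using f_eps_PInfty[OF \<epsilon>] by simp
    then show False using J eq by simp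
  qed
  then obtain V where V: "volume v = ennreal V" "0 \<le> V" by (cases "volume v") auto
  then have f: "f_eps \<gamma> \<epsilon> (enn2ereal (volume v)) = ereal (volume_cost V)"
    by (simp only: enn2ereal_ennreal f_eps_volume_cost)
  have "dirichlet G + penalty v \<noteq> \<infinity>"
  proof
    assume "dirichlet G + penalty v = \<infinity>"
    then show False using J eq f by simp
  qed
  then have "dirichlet G \<noteq> \<infinity>" "penalty v \<noteq> \<infinity>" by auto
  then obtain D P where DP: "dirichlet G = ennreal D" "0 \<le> D" "penalty v = ennreal P" "0 \<le> P"
    by (cases "dirichlet G"; cases "penalty v") auto
  have "enn2ereal (dirichlet G + penalty v) = ereal (D + P)"
    unfolding DP(1,3) using DP(2,4) by (simp add: enn2ereal_ennreal flip: ennreal_plus)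
  then have "J v G = ereal (D + P + volume_cost V)"
    unfolding eq f by simp
  with that DP V show ?thesis by blast
qed

section \<open>Existence of a minimizer\<close>

lemma penalty_volume_measurable:
  assumes [measurable]: "v \<in> borel_measurable borel"
  shows "(\<lambda>x. ennreal (g (v x - \<phi> x))) \<in> borel_measurable lborel"
    "(\<lambda>x. ennreal (h_delta \<delta> (v x)) * indicator (- \<Omega>) x) \<in> borel_measurable lborel"
  by measurable

text \<open>On \<open>[0, \<delta>]\<close> the power lies below \<open>\<delta> powr p\<close>
  times \<open>h_delta\<close>, because the exponent exceeds 1; beyond \<open>\<delta>\<close> the
  power is at most that of \<open>M\<close>.\<close>

lemma powr_le_h_delta:
  assumes "0 \<le> t" "t \<le> M"
  shows "t powr p \<le> (M powr p + \<delta> powr p) * h_delta \<delta> t"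
proof (cases "t \<ge> \<delta>")
  case True
  then have "h_delta \<delta> t = 1" using \<delta> by (simp add: h_delta_def)
  moreover have "t powr p \<le> M powr p" using assms p by (intro powr_mono2) auto
  ultimately show ?thesis by (simp add: add_increasing2)
next
  case False
  then have h: "h_delta \<delta> t = t / \<delta>" using assms \<delta> by (auto simp: h_delta_def)
  have "(t / \<delta>) powr p \<le> (t / \<delta>) powr 1"
    using assms \<delta> False p by (intro powr_mono') auto
  then have "\<delta> powr p * (t / \<delta>) powr p \<le> \<delta> powr p * (t / \<delta>)"
    using assms \<delta> by (intro mult_left_mono) auto
  then have "t powr p \<le> \<delta> powr p * h_delta \<delta> t"
    using assms \<delta> h by (simp add: powr_divide)
  also have "\<dots> \<le> (M powr p + \<delta> powr p) * h_delta \<delta> t"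
    by (intro mult_right_mono h_delta_bounds) auto
  finally show ?thesis .
qed

text \<open>The source of coercivity: the functional does not contain the norm of \<open>v\<close>
  itself, but for values in \<open>[0, M]\<close> the volume term controls it outside
  \<open>\<Omega>\<close>, and \<open>\<Omega>\<close> is bounded.\<close>

lemma in_Lp_if_volume_finite:
  assumes [measurable]: "v \<in> borel_measurable borel" and v: "AE x in lborel. 0 \<le> v x \<and> v x \<le> M"
    and vol: "volume v < \<infinity>"
  shows "integrable lborel (\<lambda>x. \<bar>v x\<bar> powr p)"
proof (rule integrableI_nonneg)
  define C where "C = M powr p + \<delta> powr p"
  have C: "0 \<le> C" by (simp add: C_def)
  note [measurable] = penalty_volume_measurable[OF assms(1)]
  have "(\<integral>\<^sup>+x. ennreal (\<bar>v x\<bar> powr p) \<partial>lborel)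
      \<le> (\<integral>\<^sup>+x. ennreal (M powr p) * indicator \<Omega> x + ennreal C * (ennreal (h_delta \<delta> (v x)) * indicator (- \<Omega>) x) \<partial>lborel)"
  proof (rule nn_integral_mono_AE)
    show "AE x in lborel. ennreal (\<bar>v x\<bar> powr p)
        \<le> ennreal (M powr p) * indicator \<Omega> x + ennreal C * (ennreal (h_delta \<delta> (v x)) * indicator (- \<Omega>) x)"
      using v
    proof eventually_elim
      fix x assume x: "0 \<le> v x \<and> v x \<le> M"
      show "ennreal (\<bar>v x\<bar> powr p)
        \<le> ennreal (M powr p) * indicator \<Omega> x + ennreal C * (ennreal (h_delta \<delta> (v x)) * indicator (- \<Omega>) x)"
      proof (cases "x \<in> \<Omega>")
        case True
        have "v x powr p \<le> M powr p" using x p by (intro powr_mono2) auto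
        with True x show ?thesis by (simp add: ennreal_leI)
      next
        case False
        have "ennreal (v x powr p) \<le> ennreal (C * h_delta \<delta> (v x))"
          unfolding C_def using x by (intro ennreal_leI powr_le_h_delta) auto
        with False x C show ?thesis by (simp add: ennreal_mult h_delta_bounds)
      qed
    qed
  qed
  also have "\<dots> = ennreal (M powr p) * emeasure lborel \<Omega> + ennreal C * volume v"
    unfolding volume_def by (subst nn_integral_add) (auto simp: nn_integral_cmult nn_integral_cmult_indicator)
  also have "\<dots> < \<infinity>"
    using vol emeasure_bounded_finite[OF \<Omega>(2)] by (simp add: ennreal_mult_less_top)
  finally show "(\<integral>\<^sup>+x. ennreal (\<bar>v x\<bar> powr p) \<partial>lborel) < \<infinity>" .
qed auto

text \<open>The direct method. Truncation allows a minimizing sequence with values in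
  \<open>[0, M]\<close>; the three terms of the functional are then bounded, and a subsequence
  makes them converge. The gradients are bounded in \<open>L\<^sup>p\<close>, so a further
  subsequence converges almost everywhere by \<open>Rellich\<close>. This is needed because
  \<open>h_delta\<close> is neither convex nor concave: the penalty and the volume pass to the limit
  by Fatou, and the Dirichlet term by lower semicontinuity. As \<open>volume_cost\<close> is
  continuous and nondecreasing, the limit attains the infimum.\<close>

theorem minimizer_exists:
  "\<exists>v G. sobolev_pair p v G \<and> (\<forall>v' G'. sobolev_pair p v' G' \<longrightarrow> J v G \<le> J v' G')"
proof -
  define X where "X = {J v G | v G. sobolev_pair p v G}"
  define m where "m = Inf X"
  have m_le: "m \<le> J v G" if "sobolev_pair p v G" for v G
    unfolding m_def using that by (intro Inf_lower) (auto simp: X_def)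
  have "X \<noteq> {}" using sobolev_pair_zero by (auto simp: X_def)
  from Inf_as_limit[OF this] obtain s where s: "\<And>n::nat. s n \<in> X" "s \<longlonglongrightarrow> m"
    by (auto simp: m_def)
  have m_fin: "m < \<infinity>" using m_le[OF sobolev_pair_zero] J_zero_finite by (rule le_less_trans)
  have m_low: "ereal (- \<epsilon> * \<gamma>) \<le> m"
    unfolding m_def
  proof (rule Inf_greatest)
    fix y assume "y \<in> X"
    then obtain v G where "sobolev_pair p v G" "y = J v G" by (auto simp: X_def)
    then show "ereal (- \<epsilon> * \<gamma>) \<le> y" by (simp only: J_lower_bound)
  qed
  obtain mr where mr: "m = ereal mr" using m_fin m_low by (cases m) auto
  define c where "c = mr + 1"
  have "\<forall>\<^sub>F n in sequentially. s n < ereal c"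
    using s(2) by (rule order_tendstoD) (simp add: mr c_def)
  then obtain N where N: "\<And>n. n \<ge> N \<Longrightarrow> s n < ereal c" by (auto simp: eventually_sequentially)
  have "\<exists>v G. sobolev_pair p v G \<and> J v G = s (n + N)" for n
  proof -
    obtain v G where "sobolev_pair p v G" "s (n + N) = J v G" using s(1)[of "n + N"] by (auto simp: X_def)
    then have "sobolev_pair p v G \<and> J v G = s (n + N)" by simp
    then show ?thesis by (intro exI)
  qed
  then obtain v0 G0 where v0: "\<And>n. sobolev_pair p (v0 n) (G0 n)" "\<And>n. J (v0 n) (G0 n) = s (n + N)"
    by metis
  define u where "u n = trunc (v0 n)" for n
  define G where "G n = trunc_grad (v0 n) (G0 n)" for n
  have uG: "sobolev_pair p (u n) (G n)" for n
    unfolding u_def G_def by (rule sobolev_pair_trunc[OF v0(1)])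
  have u_bd: "0 \<le> u n x" "u n x \<le> M" "\<bar>u n x\<bar> \<le> M" for n x
    using M_nonneg by (auto simp: u_def)
  note [measurable] = sobolev_pair_measurable[OF uG]
  have J_le: "J (u n) (G n) \<le> s (n + N)" for n
    unfolding u_def G_def v0(2)[symmetric] by (rule J_trunc_le[OF v0(1)])
  have J_c: "J (u n) (G n) < ereal c" for n
    using J_le[of n] N[of "n + N"] by (simp add: le_less_trans)
  have J_lim: "(\<lambda>n. J (u n) (G n)) \<longlonglongrightarrow> m"
    by (rule tendsto_sandwich[OF _ _ tendsto_const LIMSEQ_ignore_initial_segment[OF s(2), of N]])
      (intro always_eventually allI m_le uG J_le)+
  have "\<exists>D P V. 0 \<le> D \<and> 0 \<le> P \<and> 0 \<le> V \<and> dirichlet (G n) = ennreal D \<and> penalty (u n) = ennreal P \<and>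
      volume (u n) = ennreal V \<and> J (u n) (G n) = ereal (D + P + volume_cost V)" for n
  proof -
    have "J (u n) (G n) < \<infinity>" using J_c[of n] by (rule less_trans) simp
    from J_real[OF uG this] show ?thesis by metis
  qed
  then obtain D P V where nn: "\<And>n. 0 \<le> D n" "\<And>n. 0 \<le> P n" "\<And>n. 0 \<le> V n"
    and D: "\<And>n. dirichlet (G n) = ennreal (D n)" and P: "\<And>n. penalty (u n) = ennreal (P n)"
    and V: "\<And>n. volume (u n) = ennreal (V n)" and Jn: "\<And>n. J (u n) (G n) = ereal (D n + P n + volume_cost (V n))"
    by metis
  have DPV: "D n + P n + volume_cost (V n) < c" for n using J_c[of n] unfolding Jn by simp
  \<comment> \<open>The cost is at least \<open>- \<epsilon> * \<gamma>\<close>, which bounds the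
    first two terms; these are nonnegative, which bounds the cost and thereby the volume.\<close>
  define C where "C = max (c + \<epsilon> * \<gamma>) (\<epsilon> * (\<bar>c\<bar> + \<epsilon> * \<gamma>) + \<gamma>)"
  have bd: "D n \<in> {0..C}" "P n \<in> {0..C}" "V n \<in> {0..C}" for n
  proof -
    have 1: "- (\<epsilon> * \<gamma>) \<le> \<epsilon> * min (V n - \<gamma>) 0"
      using mult_left_mono[of "- \<gamma>" "min (V n - \<gamma>) 0" \<epsilon>] nn(3)[of n] \<epsilon> \<gamma> by simp
    moreover have 2: "0 \<le> 1 / \<epsilon> * max (V n - \<gamma>) 0" using \<epsilon> by simp
    ultimately have "D n + P n \<le> c + \<epsilon> * \<gamma>" using DPV[of n] unfolding volume_cost_def by linarith
    then show "D n \<in> {0..C}" "P n \<in> {0..C}" using nn(1,2)[of n] by (auto simp: C_def)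
    have "1 / \<epsilon> * max (V n - \<gamma>) 0 \<le> \<bar>c\<bar> + \<epsilon> * \<gamma>"
      using DPV[of n] 1 nn(1,2)[of n] unfolding volume_cost_def by linarith
    then have "max (V n - \<gamma>) 0 \<le> \<epsilon> * (\<bar>c\<bar> + \<epsilon> * \<gamma>)"
      using \<epsilon> by (simp add: pos_divide_le_eq mult.commute)
    then have "V n \<le> \<epsilon> * (\<bar>c\<bar> + \<epsilon> * \<gamma>) + \<gamma>" by linarith
    then show "V n \<in> {0..C}" using nn(3)[of n] by (simp add: C_def)
  qed
  have "seq_compact ({0..C} \<times> {0..C} \<times> {0..C})"
    by (intro compact_imp_seq_compact compact_Times compact_Icc)
  moreover have "\<forall>n. (D n, P n, V n) \<in> {0..C} \<times> {0..C} \<times> {0..C}" using bd by simp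
  ultimately obtain l r1 where r1: "strict_mono (r1 :: nat \<Rightarrow> nat)" "((\<lambda>n. (D n, P n, V n)) \<circ> r1) \<longlonglongrightarrow> l"
    by (rule seq_compactE)
  \<comment> \<open>The gradient is at most 1 plus its \<open>p\<close>-th power.\<close>
  define K where "K R = measure lborel (cball (0::'a) (R + 1)) + p * C" for R
  have C0: "0 \<le> C" using bd(1)[of 0] by simp
  have K0: "0 \<le> K R" for R using p C0 by (simp add: K_def)
  have est: "(\<integral>\<^sup>+x\<in>cball 0 R. ennreal \<bar>u n (x + h) - u n x\<bar> \<partial>lborel) \<le> ennreal (norm h * K R)"
    if h: "norm h \<le> 1" for n h R
  proof -
    have wg: "wgrad (u n) (G n)" using uG[of n] by (simp add: sobolev_pair_def)
    have [measurable]: "cball (0::'a) r \<in> sets borel" for r :: real by simp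
    have fin: "emeasure lborel (cball (0::'a) (R + 1)) = ennreal (measure lborel (cball (0::'a) (R + 1)))"
      using emeasure_bounded_finite[OF bounded_cball, of "0::'a" "R + 1"]
      by (intro emeasure_eq_ennreal_measure) auto
    have "(\<integral>\<^sup>+x\<in>cball 0 (R + norm h). ennreal (norm (G n x)) \<partial>lborel)
        \<le> (\<integral>\<^sup>+x. indicator (cball 0 (R + 1)) x + ennreal p * ennreal (1 / p * norm (G n x) powr p) \<partial>lborel)"
    proof (rule nn_integral_mono)
      fix x
      have "ennreal (norm (G n x)) \<le> ennreal (1 + p * (1 / p * norm (G n x) powr p))"
        using le_eta_plus_powr[OF p, of 1 "norm (G n x)"] p by (intro ennreal_leI) simp
      also have "\<dots> = 1 + ennreal p * ennreal (1 / p * norm (G n x) powr p)"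
        using p by (simp add: ennreal_mult[symmetric] flip: ennreal_1 ennreal_plus)
      finally show "ennreal (norm (G n x)) * indicator (cball 0 (R + norm h)) x
          \<le> indicator (cball 0 (R + 1)) x + ennreal p * ennreal (1 / p * norm (G n x) powr p)"
        using h by (auto simp: indicator_def)
    qed
    also have "\<dots> = emeasure lborel (cball (0::'a) (R + 1)) + ennreal p * dirichlet (G n)"
      unfolding dirichlet_def by (subst nn_integral_add) (auto simp: nn_integral_cmult)
    also have "\<dots> = ennreal (measure lborel (cball (0::'a) (R + 1)) + p * D n)"
      unfolding fin D using p nn(1)[of n] by (simp add: ennreal_mult[symmetric] ennreal_plus[symmetric] del: ennreal_plus)
    also have "\<dots> \<le> ennreal (K R)"
      unfolding K_def using p bd(1)[of n] by (intro ennreal_leI add_left_mono mult_left_mono) auto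
    finally have "ennreal (norm h) * (\<integral>\<^sup>+x\<in>cball 0 (R + norm h). ennreal (norm (G n x)) \<partial>lborel) \<le> ennreal (norm h) * ennreal (K R)"
      by (rule mult_left_mono) simp
    also have "\<dots> = ennreal (norm h * K R)" using K0 by (simp add: ennreal_mult)
    finally show ?thesis by (rule order_trans[OF wgrad_translation_estimate[OF wg]])
  qed
  obtain r2 where r2: "strict_mono (r2 :: nat \<Rightarrow> nat)" "AE x in lborel. convergent (\<lambda>n. u (r1 (r2 n)) x)"
    using Rellich[of "\<lambda>n. u (r1 n)" M K] u_bd(3) K0 est by auto
  define r where "r n = r1 (r2 n)" for n
  have r: "strict_mono r" using strict_mono_o[OF r1(1) r2(1)] by (simp add: r_def[abs_def] o_def)
  have "(\<lambda>n. (D (r n), P (r n), V (r n))) \<longlonglongrightarrow> l"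
    using LIMSEQ_subseq_LIMSEQ[OF r1(2) r2(1)] by (simp add: o_def r_def)
  moreover obtain D' P' V' where "l = (D', P', V')" by (cases l)
  ultimately have "(\<lambda>n. (D (r n), P (r n), V (r n))) \<longlonglongrightarrow> (D', P', V')" by simp
  from tendsto_fst[OF this] tendsto_fst[OF tendsto_snd[OF this]] tendsto_snd[OF tendsto_snd[OF this]]
  have lim': "(\<lambda>n. D (r n)) \<longlonglongrightarrow> D'" "(\<lambda>n. P (r n)) \<longlonglongrightarrow> P'" "(\<lambda>n. V (r n)) \<longlonglongrightarrow> V'"
    by simp_all
  define v where "v x = lim (\<lambda>n. u (r n) x)" for x
  have [measurable]: "v \<in> borel_measurable borel"
    unfolding v_def[abs_def] by (rule borel_measurable_lim_metric) measurable
  have conv: "AE x in lborel. (\<lambda>n. u (r n) x) \<longlonglongrightarrow> v x"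
    using r2(2) by eventually_elim (simp add: v_def r_def convergent_LIMSEQ_iff)
  have "1 / p * (LBINT x. norm (G n x) powr p) = D n" for n
  proof -
    have "dirichlet (G n) = ennreal (1 / p * (LBINT x. norm (G n x) powr p))"
      unfolding dirichlet_def using uG[of n] p
      by (subst nn_integral_eq_integral) (auto simp: sobolev_pair_def)
    with D[of n] nn(1)[of n] p show ?thesis by simp
  qed
  then have "(LBINT x. norm (G n x) powr p) = p * D n" for n using p by (simp add: field_simps)
  then have G_lim: "(\<lambda>n. LBINT x. norm (G (r n) x) powr p) \<longlonglongrightarrow> p * D'"
    using tendsto_mult[OF tendsto_const lim'(1), of p] by simp
  have "wgrad (u (r n)) (G (r n))" "integrable lborel (\<lambda>x. norm (G (r n) x) powr p)" for n
    using uG[of "r n"] by (auto simp: sobolev_pair_def)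
  from wgrad_lower_semicontinuous[OF p this G_lim u_bd(3) _ conv]
  obtain H where H: "wgrad v H" "integrable lborel (\<lambda>x. norm (H x) powr p)"
    "(LBINT x. norm (H x) powr p) \<le> p * D'"
    by auto
  have [measurable]: "H \<in> borel_measurable borel" using H(1) by (auto simp: wgrad_def dest: locint_measurable)
  have D_le: "dirichlet H \<le> ennreal D'"
  proof -
    have "dirichlet H = ennreal (1 / p * (LBINT x. norm (H x) powr p))"
      unfolding dirichlet_def using H(2) p by (subst nn_integral_eq_integral) auto
    also have "\<dots> \<le> ennreal D'" using H(3) p by (intro ennreal_leI) (simp add: field_simps)
    finally show ?thesis .
  qed
  have P_le: "penalty v \<le> ennreal P'"
  proof -
    have "penalty v \<le> liminf (\<lambda>n. penalty (u (r n)))"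
      unfolding penalty_def
    proof (rule Fatou_AE)
      show "AE x in lborel. (\<lambda>n. ennreal (g (u (r n) x - \<phi> x))) \<longlonglongrightarrow> ennreal (g (v x - \<phi> x))"
        using conv
      proof eventually_elim
        fix x assume "(\<lambda>n. u (r n) x) \<longlonglongrightarrow> v x"
        then show "(\<lambda>n. ennreal (g (u (r n) x - \<phi> x))) \<longlonglongrightarrow> ennreal (g (v x - \<phi> x))"
          by (intro tendsto_ennrealI continuous_on_tendsto_compose[OF g_cont] tendsto_intros) auto
      qed
    qed measurable
    also have "\<dots> = ennreal P'"
      unfolding P by (intro lim_imp_Liminf tendsto_ennrealI lim') simp
    finally show ?thesis .
  qed
  have V_le: "volume v \<le> ennreal V'"
  proof -
    have "volume v \<le> liminf (\<lambda>n. volume (u (r n)))"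
      unfolding volume_def
    proof (rule Fatou_AE)
      show "AE x in lborel. (\<lambda>n. ennreal (h_delta \<delta> (u (r n) x)) * indicator (- \<Omega>) x)
          \<longlonglongrightarrow> ennreal (h_delta \<delta> (v x)) * indicator (- \<Omega>) x"
        using conv
      proof eventually_elim
        fix x assume *: "(\<lambda>n. u (r n) x) \<longlonglongrightarrow> v x"
        have "(\<lambda>n. h_delta \<delta> (u (r n) x)) \<longlonglongrightarrow> h_delta \<delta> (v x)"
          unfolding h_delta_eq[OF \<delta>] using \<delta> by (intro tendsto_intros *) auto
        then show "(\<lambda>n. ennreal (h_delta \<delta> (u (r n) x)) * indicator (- \<Omega>) x)
            \<longlonglongrightarrow> ennreal (h_delta \<delta> (v x)) * indicator (- \<Omega>) x"
          by (cases "x \<in> \<Omega>") (auto intro: tendsto_ennrealI)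
      qed
    qed measurable
    also have "\<dots> = ennreal V'"
      unfolding V by (intro lim_imp_Liminf tendsto_ennrealI lim') simp
    finally show ?thesis .
  qed
  have v_bd: "AE x in lborel. 0 \<le> v x \<and> v x \<le> M"
    using conv
  proof eventually_elim
    fix x assume "(\<lambda>n. u (r n) x) \<longlonglongrightarrow> v x"
    then show "0 \<le> v x \<and> v x \<le> M"
      using LIMSEQ_le_const[of _ "v x" 0] LIMSEQ_le_const2[of _ "v x" M] u_bd(1,2) by blast
  qed
  have "integrable lborel (\<lambda>x. \<bar>v x\<bar> powr p)"
    by (rule in_Lp_if_volume_finite[OF _ v_bd]) (use V_le in \<open>auto simp: le_less_trans\<close>)
  then have vH: "sobolev_pair p v H" using H by (simp add: sobolev_pair_def)
  have nn': "0 \<le> D'" "0 \<le> P'" "0 \<le> V'"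
    using LIMSEQ_le_const[OF lim'(1), of 0] LIMSEQ_le_const[OF lim'(2), of 0] LIMSEQ_le_const[OF lim'(3), of 0] nn by auto
  have "J v H \<le> ereal (D' + P') + f_eps \<gamma> \<epsilon> (ereal V')"
    unfolding J_split[OF sobolev_pair_measurable[OF vH]]
  proof (intro add_mono f_eps_mono \<epsilon>)
    have "dirichlet H + penalty v \<le> ennreal (D' + P')"
      using add_mono[OF D_le P_le] nn' by simp
    then show "enn2ereal (dirichlet H + penalty v) \<le> ereal (D' + P')"
      using nn' by (simp add: less_eq_ennreal.rep_eq enn2ereal_ennreal del: ennreal_plus)
    show "enn2ereal (volume v) \<le> ereal V'"
      using V_le nn' by (simp add: less_eq_ennreal.rep_eq enn2ereal_ennreal)
  qed simp
  also have "\<dots> = ereal (D' + P' + volume_cost V')" unfolding f_eps_volume_cost by simp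
  also have "\<dots> = m"
  proof (rule LIMSEQ_unique)
    have "(\<lambda>n. D (r n) + P (r n) + volume_cost (V (r n))) \<longlonglongrightarrow> D' + P' + volume_cost V'"
      unfolding volume_cost_def by (intro tendsto_intros lim')
    then show "(\<lambda>n. ereal (D (r n) + P (r n) + volume_cost (V (r n)))) \<longlonglongrightarrow> ereal (D' + P' + volume_cost V')"
      by simp
    show "(\<lambda>n. ereal (D (r n) + P (r n) + volume_cost (V (r n)))) \<longlonglongrightarrow> m"
      using LIMSEQ_subseq_LIMSEQ[OF J_lim r] unfolding Jn o_def .
  qed
  finally have "J v H \<le> m" .
  then have "J v H \<le> J v' G'" if "sobolev_pair p v' G'" for v' G'
    using m_le[OF that] by (rule order_trans)
  with vH show ?thesis by blast
qed

section \<open>Bounds for minimizers\<close>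

text \<open>Truncation lowers none of the three terms of a minimizer, and it removes from the
  Dirichlet term exactly the part of the gradient outside \<open>0 < v < M\<close>. That part is
  therefore zero. Consequently the negative part of \<open>v\<close> and the positive part of
  \<open>v - M\<close> have vanishing gradients, and as members of \<open>L\<^sup>p\<close> they
  vanish.\<close>

theorem minimizer_bounds:
  assumes vG: "sobolev_pair p v G"
    and min: "\<And>v' G'. sobolev_pair p v' G' \<Longrightarrow> J v G \<le> J v' G'"
  shows "AE x in lborel. 0 \<le> v x \<and> v x \<le> M"
proof -
  note [measurable] = sobolev_pair_measurable[OF vG]
  have wg: "wgrad v G" using vG by (simp add: sobolev_pair_def)
  have Jfin: "J v G < \<infinity>" using min[OF sobolev_pair_zero] J_zero_finite by (rule le_less_trans)
  obtain D P V where 1: "0 \<le> D" "0 \<le> P" "0 \<le> V" "dirichlet G = ennreal D" "penalty v = ennreal P" "volume v = ennreal V"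
    "J v G = ereal (D + P + volume_cost V)"
    by (rule J_real[OF vG Jfin])
  have "J (trunc v) (trunc_grad v G) < \<infinity>" using J_trunc_le[OF vG] Jfin by (rule le_less_trans)
  then obtain D' P' V' where 2: "0 \<le> D'" "0 \<le> P'" "0 \<le> V'" "dirichlet (trunc_grad v G) = ennreal D'"
    "penalty (trunc v) = ennreal P'" "volume (trunc v) = ennreal V'"
    "J (trunc v) (trunc_grad v G) = ereal (D' + P' + volume_cost V')"
    by (rule J_real[OF sobolev_pair_trunc[OF vG]])
  have "P' \<le> P" "V' \<le> V"
    using trunc_decreases(2,3)[of v] 1 2 by simp_all
  moreover from this have "volume_cost V' \<le> volume_cost V" by (intro volume_cost_mono)
  moreover have "D + P + volume_cost V
      \<le> D' + P' + volume_cost V'"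
    using min[OF sobolev_pair_trunc[OF vG]] unfolding 1(7) 2(7) by simp
  ultimately have DD: "D \<le> D'" by linarith
  define E where "E x = (if 0 < v x \<and> v x < M then 0 else 1) *\<^sub>R G x" for x
  have [measurable]: "E \<in> borel_measurable borel" unfolding E_def[abs_def] by measurable
  have "dirichlet G = dirichlet (trunc_grad v G) + dirichlet E"
    unfolding dirichlet_def
    by (subst nn_integral_add[symmetric]) (auto intro!: nn_integral_cong simp: E_def)
  then have "ennreal D = ennreal D' + dirichlet E" using 1(4) 2(4) by simp
  then have "dirichlet E = 0"
    using DD 1(1) 2(1) by (cases "dirichlet E") (auto simp flip: ennreal_plus)
  then have "AE x in lborel. ennreal (1 / p * norm (E x) powr p) = 0"
    unfolding dirichlet_def by (subst (asm) nn_integral_0_iff_AE) auto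
  then have E0: "AE x in lborel. E x = 0"
    by eventually_elim (use p in \<open>auto simp: divide_le_0_iff\<close>)
  have Lp: "integrable lborel (\<lambda>x. \<bar>w x\<bar> powr p)"
    if [measurable]: "w \<in> borel_measurable borel" and "\<And>x. \<bar>w x\<bar> \<le> \<bar>v x\<bar>" for w
  proof (rule Bochner_Integration.integrable_bound)
    show "integrable lborel (\<lambda>x. \<bar>v x\<bar> powr p)" using vG by (simp add: sobolev_pair_def)
    show "AE x in lborel. norm (\<bar>w x\<bar> powr p) \<le> norm (\<bar>v x\<bar> powr p)"
      using that(2) p by (intro AE_I2) (auto intro!: powr_mono2)
  qed measurable
  have "AE x in lborel. max (- v x) 0 = 0"
  proof (rule wgrad_zero_imp_zero[where p = p])
    show "wgrad (\<lambda>x. max (- v x) 0) (\<lambda>x. (if - v x > 0 then 1 else 0) *\<^sub>R (- 1 *\<^sub>R G x))"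
      using wgrad_pos_part[OF wgrad_affine[OF wg, of 0 "- 1"]] by simp
    show "AE x in lborel. (if - v x > 0 then 1 else 0) *\<^sub>R (- 1 *\<^sub>R G x) = 0"
      using E0 by eventually_elim (auto simp: E_def split: if_splits)
    show "integrable lborel (\<lambda>x. \<bar>max (- v x) 0\<bar> powr p)" by (rule Lp) auto
  qed
  moreover have "AE x in lborel. max (- M + v x) 0 = 0"
  proof (rule wgrad_zero_imp_zero[where p = p])
    show "wgrad (\<lambda>x. max (- M + v x) 0) (\<lambda>x. (if - M + v x > 0 then 1 else 0) *\<^sub>R G x)"
      using wgrad_pos_part[OF wgrad_affine[OF wg, of "- M" 1]] by simp
    show "AE x in lborel. (if - M + v x > 0 then 1 else 0) *\<^sub>R G x = 0"
      using E0 by eventually_elim (auto simp: E_def split: if_splits)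
    show "integrable lborel (\<lambda>x. \<bar>max (- M + v x) 0\<bar> powr p)"
      using M_nonneg by (intro Lp) auto
  qed
  ultimately show ?thesis by eventually_elim (auto simp: max_def split: if_splits)
qed

end

text \<open>The least upper bound of the obstacle serves as \<open>M\<close>. The functional takes
  the same value on a Sobolev function and on any pair of Borel representatives of it and its
  gradient, so minimizers and their bounds carry over.\<close>

theorem proposition2p1:
  fixes \<Omega> :: "(real ^ 'n) set"
    and \<phi> :: "real ^ 'n \<Rightarrow> real"
    and g :: "real \<Rightarrow> real"
    and p \<gamma> \<sigma> \<delta> \<epsilon> :: real
  assumes "smooth_bounded_domain \<Omega>"
    and "smooth \<phi>" and "\<And>x. \<phi> x \<ge> 0" and "compact (supp \<phi>)" and "supp \<phi> \<subseteq> \<Omega>"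
    and "\<gamma> > 0" and "1 < p"
    and "\<sigma> > 0" and "\<delta> > 0" and "\<epsilon> > 0"
    and "is_g \<sigma> g"
  shows "(\<exists>u. is_arg_min (J_fun p \<Omega> \<phi> \<gamma> g \<delta> \<epsilon>) (\<lambda>v. v \<in> W1p p) u) \<and>
    (\<forall>u. is_arg_min (J_fun p \<Omega> \<phi> \<gamma> g \<delta> \<epsilon>) (\<lambda>v. v \<in> W1p p) u \<longrightarrow>
      (AE x in lebesgue. 0 \<le> u x \<and> u x \<le> (SUP y. \<bar>\<phi> y\<bar>)))"
proof -
  have test: "test_fun \<phi>" using assms by (simp add: test_fun_def)
  obtain C R where bd: "0 \<le> C" "\<And>x. \<bar>\<phi> x\<bar> \<le> C * indicator (cball 0 R) x"
    using test_fun_bound(1)[OF test] by blast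
  have "\<bar>\<phi> x\<bar> \<le> C" for x
    using order_trans[OF bd(2)[of x], of C] bd(1) by (auto simp: indicator_def)
  then have bdd: "bdd_above (range (\<lambda>y. \<bar>\<phi> y\<bar>))" by (auto intro!: bdd_aboveI[of _ C])
  have "C_k 0 g" using assms(11) unfolding is_g_def smooth_def by blast
  then have g_cont: "continuous_on UNIV g" by simp
  interpret obstacle_functional p \<gamma> \<delta> \<epsilon> "SUP y. \<bar>\<phi> y\<bar>" \<Omega> \<phi> g
  proof
    show "\<Omega> \<in> sets borel" "bounded \<Omega>" using assms(1) by (auto simp: smooth_bounded_domain_def)
    show "\<phi> x \<le> (SUP y. \<bar>\<phi> y\<bar>)" for x
      using cSUP_upper[OF _ bdd, of x] by simp
    show "\<exists>R. \<forall>x. x \<notin> cball 0 R \<longrightarrow> \<phi> x = 0"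
    proof (intro exI allI impI)
      show "\<phi> x = 0" if "x \<notin> cball 0 R" for x using bd(2)[of x] that by simp
    qed
  qed (use assms g_cont test_fun_continuous(1)[OF test] in \<open>simp_all add: is_g_def\<close>)
  have to_fun: "J_fun p \<Omega> \<phi> \<gamma> g \<delta> \<epsilon> v = J v G" if "sobolev_pair p v G" for v G
    by (rule J_fun_eq_J_pair) (use weak_grad_sobolev_pair[OF that] in auto)
  show ?thesis
  proof (intro conjI allI impI)
    obtain v G where v: "sobolev_pair p v G" and min: "\<And>v' G'. sobolev_pair p v' G' \<Longrightarrow> J v G \<le> J v' G'"
      using minimizer_exists by metis
    have "J_fun p \<Omega> \<phi> \<gamma> g \<delta> \<epsilon> v \<le> J_fun p \<Omega> \<phi> \<gamma> g \<delta> \<epsilon> y" if y: "y \<in> W1p p" for y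
    proof -
      obtain y' H where y': "sobolev_pair p y' H" "AE x in lborel. y x = y' x" "AE x in lborel. weak_grad y x = H x"
        using sobolev_pair_if_W1p[OF y] by blast
      show ?thesis unfolding to_fun[OF v] J_fun_eq_J_pair[OF y'(2,3)] by (rule min[OF y'(1)])
    qed
    then show "\<exists>u. is_arg_min (J_fun p \<Omega> \<phi> \<gamma> g \<delta> \<epsilon>) (\<lambda>v. v \<in> W1p p) u"
      using W1p_if_sobolev_pair[OF v] unfolding is_arg_min_def by (metis not_less)
  next
    fix u assume u: "is_arg_min (J_fun p \<Omega> \<phi> \<gamma> g \<delta> \<epsilon>) (\<lambda>v. v \<in> W1p p) u"
    then have uW: "u \<in> W1p p" by (simp add: is_arg_min_def)
    obtain v G where v: "sobolev_pair p v G" "AE x in lborel. u x = v x" "AE x in lborel. weak_grad u x = G x"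
      using sobolev_pair_if_W1p[OF uW] by blast
    have "J v G \<le> J v' G'" if "sobolev_pair p v' G'" for v' G'
      using u W1p_if_sobolev_pair[OF that] to_fun[OF that] J_fun_eq_J_pair[OF v(2,3)]
      unfolding is_arg_min_def by (metis not_less)
    from minimizer_bounds[OF v(1) this]
    have "AE x in lborel. 0 \<le> v x \<and> v x \<le> (SUP y. \<bar>\<phi> y\<bar>)" .
    with v(2) have "AE x in lborel. 0 \<le> u x \<and> u x \<le> (SUP y. \<bar>\<phi> y\<bar>)"
      by eventually_elim simp
    then show "AE x in lebesgue. 0 \<le> u x \<and> u x \<le> (SUP y. \<bar>\<phi> y\<bar>)" by (rule AE_completion)
  qed
qed

end
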